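(* Let $L>0$ and, for $\lambda>0$, let $u=u^{(\lambda)}$ be the mild solution of the stochastic heat equation $\partial_t u_t(x)=\frac12\partial_{xx}u_t(x)+\lambda\sigma(u_t(x))\dot W(t,x)$, $0<x<L$, $t>0$, with Dirichlet boundary condition $u_t(0)=u_t(L)=0$ for $t>0$ and initial condition $u_0$. Then there exists $\lambda_0>0$ such that for all $\lambda\in(0,\lambda_0)$ and all $x\in(0,L)$, $$-\infty<\limsup_{t\to\infty}\frac1t\log \mathrm{E}|u_t(x)|^2<0.$$ On the other hand, for all $\epsilon>0$ there exists $\lambda_1>0$ such that for all $\lambda>\lambda_1$ and all $x\in[\epsilon,L-\epsilon]$, $$0<\liminf_{t\to\infty}\frac1t\log \mathrm{E}|u_t(x)|^2<\infty.$$
   Context: $\dot W$ is space-time white noise on $(0,\infty)\times(0,L)$. The function $\sigma:\mathbf{R}\to\mathbf{R}$ is globally Lipschitz and satisfies $l_\sigma|x|\le|\sigma(x)|\le L_\sigma|x|$ for all $x\in\mathbf{R}$, where $l_\sigma,L_\sigma$ are positive constants. The initial condition $u_0:[0,L]\to[0,\infty)$ is a (deterministic) non-negative bounded function with positive support inside $[0,L]$, i.e. $\{u_0>0\}$ has positive Lebesgue measure. The parameter $\lambda>0$ is the level of the noise. Following Walsh, a mild solution is a predictable random field satisfying $$u_t(x)=\int_0^L u_0(y)p_D(t,x,y)\,dy+\lambda\int_0^L\int_0^t p_D(t-s,x,y)\sigma(u_s(y))\,W(ds,dy),$$ where $p_D$ is the heat kernel of $\frac12\partial_{xx}$ on $(0,L)$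 with Dirichlet boundary condition and the stochastic integral is in the sense of Walsh. It is known that there is a unique (up to modification) mild solution with $\sup_{0\le t\le T,\,x}\mathrm{E}|u_t(x)|^2<\infty$ for all $T<\infty$. *)

theory Defs
  imports "HOL-Probability.Probability" "HOL-Real_Asymp.Real_Asymp"
begin

section \<open>The Dirichlet heat kernel\<close>

text \<open>
  The kernel of the semigroup generated by \<open>(1/2) d\<^sup>2/dx\<^sup>2\<close> on \<open>(0, L)\<close> with Dirichlet boundary
  condition, i.e. \<open>\<Sum>\<^sub>n exp (- \<mu>\<^sub>n t) \<phi>\<^sub>n(x) \<phi>\<^sub>n(y)\<close> with the orthonormal eigenfunctions
  \<open>\<phi>\<^sub>n(x) = sqrt (2/L) sin (n \<pi> x / L)\<close> and the eigenvalues \<open>\<mu>\<^sub>n = (n \<pi> / L)\<^sup>2 / 2\<close>, \<open>n = 1, 2, \<dots>\<close>.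
  Only times \<open>t > 0\<close> are meaningful (at \<open>t \<le> 0\<close> the series need not converge).
\<close>

definition dirichlet_freq :: "real \<Rightarrow> nat \<Rightarrow> real" where
  "dirichlet_freq L n = real (Suc n) * pi / L"

definition dirichlet_heat_kernel :: "real \<Rightarrow> real \<Rightarrow> real \<Rightarrow> real \<Rightarrow> real" where
  "dirichlet_heat_kernel L t x y =
     (\<Sum>n. 2 / L * exp (- (dirichlet_freq L n)\<^sup>2 / 2 * t)
            * sin (dirichlet_freq L n * x) * sin (dirichlet_freq L n * y))"

text \<open>
  For \<open>t > 0\<close> the kernel solves the heat equation in \<open>(t, x)\<close> and vanishes at \<open>x = 0, L\<close>; as
  \<open>t\<close> tends to \<open>0\<close>, integration against it converges to the identity on all functions
  \<open>sin (n \<pi> y / L)\<close>, which span \<open>L\<^sup>2(0, L)\<close>.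
\<close>

lemma dirichlet_freq_summable:
  assumes "L > 0" "t > 0"
  shows "summable (\<lambda>n. dirichlet_freq L n ^ k * exp (- (dirichlet_freq L n)\<^sup>2 / 2 * t))"
proof (rule summable_comparison_test_bigo)
  show "summable (\<lambda>n. norm (inverse (real n ^ 2)))"
    using inverse_power_summable[of 2, where ?'a=real] by simp
  define c where "c = pi / L"
  define a where "a = c^2 / 2 * t"
  have c: "c > 0" "a > 0" using assms by (auto simp: c_def a_def)
  have "(\<lambda>n. (real (Suc n) * c) ^ k * exp (- (a * real (Suc n)^2))) \<in> O(\<lambda>n. inverse (real n ^ 2))"
    using c by real_asymp
  moreover have "(\<lambda>n. (real (Suc n) * c) ^ k * exp (- (a * real (Suc n)^2))) =
     (\<lambda>n. dirichlet_freq L n ^ k * exp (- (dirichlet_freq L n)\<^sup>2 / 2 * t))"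
  proof
    fix n
    have w: "real (Suc n) * c = dirichlet_freq L n" by (simp add: c_def dirichlet_freq_def)
    have "a * real (Suc n)^2 = (real (Suc n) * c)^2 / 2 * t" by (simp add: a_def power_mult_distrib mult_ac)
    then show "(real (Suc n) * c) ^ k * exp (- (a * real (Suc n)^2)) =
       dirichlet_freq L n ^ k * exp (- (dirichlet_freq L n)\<^sup>2 / 2 * t)"
      unfolding w by simp
  qed
  ultimately show "(\<lambda>n. dirichlet_freq L n ^ k * exp (- (dirichlet_freq L n)\<^sup>2 / 2 * t)) \<in> O(\<lambda>n. inverse (real n ^ 2))"
    by simp
qed

lemma dirichlet_freq_pos: "L > 0 \<Longrightarrow> dirichlet_freq L n > 0"
  by (simp add: dirichlet_freq_def)

lemma dirichlet_heat_kernel_boundary: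
  assumes "L > 0"
  shows "dirichlet_heat_kernel L t 0 y = 0" "dirichlet_heat_kernel L t L y = 0"
proof -
  have "sin (dirichlet_freq L n * L) = 0" for n
    using assms sin_npi[of "Suc n"] by (simp add: dirichlet_freq_def del: sin_npi)
  then show "dirichlet_heat_kernel L t 0 y = 0" "dirichlet_heat_kernel L t L y = 0"
    by (simp_all add: dirichlet_heat_kernel_def)
qed

lemma dirichlet_heat_kernel_heat_equation:
  assumes L: "L > 0" and t: "t > 0"
  obtains p1 p2 where
    "\<And>x. ((\<lambda>x. dirichlet_heat_kernel L t x y) has_real_derivative p1 x) (at x)"
    "\<And>x. (p1 has_real_derivative p2 x) (at x)"
    "\<And>x. ((\<lambda>t. dirichlet_heat_kernel L t x y) has_real_derivative p2 x / 2) (at t)"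
proof -
  let ?w = "dirichlet_freq L"
  define e where "e = (\<lambda>n t. exp (- (?w n)\<^sup>2 / 2 * t))"
  have w: "?w n > 0" for n using L by (rule dirichlet_freq_pos)
  have sm: "summable (\<lambda>n. 2 / L * (?w n ^ k * e n s))" if "s > 0" for k s
    unfolding e_def by (intro summable_mult dirichlet_freq_summable L that)
  have bd: "\<bar>2 / L * (?w n ^ k * e n s) * a * b\<bar> \<le> 2 / L * (?w n ^ k * e n s')"
    if "\<bar>a\<bar> \<le> 1" "\<bar>b\<bar> \<le> 1" "s' \<le> s" for n k s s' and a b :: real
  proof -
    have "e n s \<le> e n s'" using that by (auto simp: e_def intro!: mult_left_mono)
    moreover have "\<bar>a\<bar> * \<bar>b\<bar> \<le> 1" using that by (simp add: mult_le_one)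
    ultimately have "(2 / L * (?w n ^ k * e n s)) * (\<bar>a\<bar> * \<bar>b\<bar>) \<le> (2 / L * (?w n ^ k * e n s')) * 1"
      using L w[of n] by (intro mult_mono mult_left_mono) (auto simp: e_def)
    then show ?thesis using L w[of n] by (simp add: abs_mult e_def mult.assoc)
  qed
  have kernel: "dirichlet_heat_kernel L s x y =
      (\<Sum>n. 2 / L * (?w n ^ 0 * e n s) * sin (?w n * x) * sin (?w n * y))" for s x
    by (simp add: dirichlet_heat_kernel_def e_def)
  define p0 where "p0 = (\<lambda>x. \<Sum>n. 2 / L * (?w n ^ 0 * e n t) * sin (?w n * x) * sin (?w n * y))"
  define p1 where "p1 = (\<lambda>x. \<Sum>n. 2 / L * (?w n ^ 1 * e n t) * cos (?w n * x) * sin (?w n * y))"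
  define p2 where "p2 = (\<lambda>x. \<Sum>n. 2 / L * (?w n ^ 2 * e n t) * (- sin (?w n * x)) * sin (?w n * y))"
  have "(p0 has_real_derivative p1 x) (at x)" for x
    unfolding p0_def p1_def
  proof (rule has_field_derivative_series'(2)[of UNIV])
    show "uniformly_convergent_on UNIV (\<lambda>N x. \<Sum>n<N. 2 / L * (?w n ^ 1 * e n t) * cos (?w n * x) * sin (?w n * y))"
      by (rule Weierstrass_m_test'[OF _ sm[OF t, of 1]]) (unfold real_norm_def, rule bd, auto)
    show "summable (\<lambda>n. 2 / L * (?w n ^ 0 * e n t) * sin (?w n * 0) * sin (?w n * y))" by simp
  qed (use L in \<open>auto intro!: derivative_eq_intros\<close>)
  moreover have "(p1 has_real_derivative p2 x) (at x)" for x
    unfolding p1_def p2_def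
  proof (rule has_field_derivative_series'(2)[of UNIV])
    show "uniformly_convergent_on UNIV (\<lambda>N x. \<Sum>n<N. 2 / L * (?w n ^ 2 * e n t) * (- sin (?w n * x)) * sin (?w n * y))"
      by (rule Weierstrass_m_test'[OF _ sm[OF t, of 2]]) (unfold real_norm_def, rule bd, auto)
    show "summable (\<lambda>n. 2 / L * (?w n ^ 1 * e n t) * cos (?w n * x) * sin (?w n * y))"
      by (rule summable_comparison_test'[OF sm[OF t, of 1]]) (unfold real_norm_def, rule bd, auto)
  qed (use L in \<open>auto intro!: derivative_eq_intros simp: power2_eq_square\<close>)
  moreover have "((\<lambda>t. dirichlet_heat_kernel L t x y) has_real_derivative
      (\<Sum>n. 2 / L * (?w n ^ 2 * e n t) * (- sin (?w n * x) / 2) * sin (?w n * y))) (at t)" for x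
    unfolding kernel
  proof (rule has_field_derivative_series'(2)[of "{t/2..}"])
    show "uniformly_convergent_on {t/2..} (\<lambda>N s. \<Sum>n<N. 2 / L * (?w n ^ 2 * e n s) * (- sin (?w n * x) / 2) * sin (?w n * y))"
      using t by (intro Weierstrass_m_test'[OF _ sm[of "t/2" 2]])
         (unfold real_norm_def, rule bd, auto intro: order.trans[OF abs_sin_le_one])
    show "summable (\<lambda>n. 2 / L * (?w n ^ 0 * e n t) * sin (?w n * x) * sin (?w n * y))"
      by (rule summable_comparison_test'[OF sm[OF t, of 0]]) (unfold real_norm_def, rule bd, auto)
  qed (use t L in \<open>auto intro!: derivative_eq_intros simp: e_def\<close>)
  moreover have "(\<Sum>n. 2 / L * (?w n ^ 2 * e n t) * (- sin (?w n * x) / 2) * sin (?w n * y)) = p2 x / 2" for x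
  proof -
    have "summable (\<lambda>n. 2 / L * (?w n ^ 2 * e n t) * (- sin (?w n * x)) * sin (?w n * y))"
      by (rule summable_comparison_test'[OF sm[OF t, of 2]]) (unfold real_norm_def, rule bd, auto)
    from suminf_divide[OF this, of 2]
    have "(\<Sum>n. 2 / L * (?w n ^ 2 * e n t) * (- sin (?w n * x)) * sin (?w n * y) / 2) = p2 x / 2"
      by (simp only: p2_def)
    moreover have "2 / L * (?w n ^ 2 * e n t) * (- sin (?w n * x) / 2) * sin (?w n * y) =
        2 / L * (?w n ^ 2 * e n t) * (- sin (?w n * x)) * sin (?w n * y) / 2" for n
      by (simp only: times_divide_eq_right times_divide_eq_left)
    ultimately show ?thesis by (simp only:)
  qed
  ultimately show thesis
    using that[of p1 p2] by (simp only: p0_def kernel)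
qed

lemma sin_freq_integral:
  assumes L: "L > 0"
  shows "((\<lambda>y. sin (dirichlet_freq L n * y) * sin (dirichlet_freq L m * y))
           has_integral (if n = m then L / 2 else 0)) {0..L}"
proof -
  let ?w = "dirichlet_freq L"
  have s: "sin (?w n * L) = 0" for n
    using assms sin_npi[of "Suc n"] by (simp add: dirichlet_freq_def del: sin_npi)
  have w: "?w n > 0" for n using L by (rule dirichlet_freq_pos)
  show ?thesis
  proof (cases "n = m")
    case True
    define G where "G = (\<lambda>y. y / 2 - sin (?w n * y) * cos (?w n * y) / (2 * ?w n))"
    have "((\<lambda>y. sin (?w n * y) * sin (?w n * y)) has_integral (G L - G 0)) {0..L}"
    proof (rule fundamental_theorem_of_calculus)
      fix y
      have "(G has_real_derivative 1/2 - (cos (?w n * y) ^ 2 - sin (?w n * y) ^ 2) / 2) (at y within {0..L})"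
        unfolding G_def using w[of n] by (auto intro!: derivative_eq_intros simp: field_simps power2_eq_square)
      also have "1/2 - (cos (?w n * y) ^ 2 - sin (?w n * y) ^ 2) / 2 = sin (?w n * y) * sin (?w n * y)"
        using sin_cos_squared_add[of "?w n * y"] by (simp add: power2_eq_square field_simps)
      finally show "(G has_vector_derivative sin (?w n * y) * sin (?w n * y)) (at y within {0..L})"
        by (simp add: has_real_derivative_iff_has_vector_derivative)
    qed (use L in simp)
    then show ?thesis using True s by (simp add: G_def)
  next
    case False
    let ?a = "?w n" and ?b = "?w m"
    have ne: "?a\<^sup>2 - ?b\<^sup>2 \<noteq> 0"
    proof
      assume "?a\<^sup>2 - ?b\<^sup>2 = 0"
      then have "?a = ?b" using w[of n] w[of m] power2_eq_imp_eq[of ?a ?b] by simp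
      then show False using False L by (simp add: dirichlet_freq_def)
    qed
    define G where "G = (\<lambda>y. (?b * sin (?a * y) * cos (?b * y) - ?a * cos (?a * y) * sin (?b * y)) / (?a\<^sup>2 - ?b\<^sup>2))"
    have "((\<lambda>y. sin (?a * y) * sin (?b * y)) has_integral (G L - G 0)) {0..L}"
    proof (rule fundamental_theorem_of_calculus)
      fix y
      have "(G has_real_derivative ((?a\<^sup>2 - ?b\<^sup>2) * (sin (?a * y) * sin (?b * y))) / (?a\<^sup>2 - ?b\<^sup>2)) (at y within {0..L})"
        unfolding G_def
        by (rule DERIV_cdivide)
           (auto intro!: derivative_eq_intros simp: power2_eq_square algebra_simps)
      then show "(G has_vector_derivative sin (?a * y) * sin (?b * y)) (at y within {0..L})"
        using ne by (simp add: has_real_derivative_iff_has_vector_derivative)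
    qed (use L in simp)
    then show ?thesis using False s by (simp add: G_def)
  qed
qed

lemma dirichlet_heat_kernel_eigenfunction:
  assumes L: "L > 0" and t: "t > 0"
  shows "((\<lambda>y. dirichlet_heat_kernel L t x y * sin (dirichlet_freq L m * y))
    has_integral exp (- (dirichlet_freq L m)\<^sup>2 / 2 * t) * sin (dirichlet_freq L m * x)) {0..L}"
proof -
  let ?w = "dirichlet_freq L"
  define f where "f = (\<lambda>n y. 2 / L * exp (- (?w n)\<^sup>2 / 2 * t) * sin (?w n * x) * sin (?w n * y))"
  have bd: "\<bar>f n y\<bar> \<le> 2 / L * (?w n ^ 0 * exp (- (?w n)\<^sup>2 / 2 * t))" for n y
  proof -
    have "\<bar>sin (?w n * x)\<bar> * \<bar>sin (?w n * y)\<bar> \<le> 1" by (simp add: mult_le_one)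
    then have "(2 / L * exp (- (?w n)\<^sup>2 / 2 * t)) * (\<bar>sin (?w n * x)\<bar> * \<bar>sin (?w n * y)\<bar>)
        \<le> (2 / L * exp (- (?w n)\<^sup>2 / 2 * t)) * 1"
      using L by (intro mult_left_mono) auto
    then show ?thesis using L by (simp add: f_def abs_mult mult.assoc)
  qed
  have sm: "summable (\<lambda>n. 2 / L * (?w n ^ 0 * exp (- (?w n)\<^sup>2 / 2 * t)))"
    by (intro summable_mult dirichlet_freq_summable L t)
  have lim: "uniform_limit {0..L} (\<lambda>N y. \<Sum>n<N. f n y * sin (?w m * y))
     (\<lambda>y. \<Sum>n. f n y * sin (?w m * y)) sequentially"
  proof (rule Weierstrass_m_test[OF _ sm])
    fix n y
    have "\<bar>f n y\<bar> * \<bar>sin (?w m * y)\<bar> \<le> \<bar>f n y\<bar> * 1" by (intro mult_left_mono) auto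
    then show "norm (f n y * sin (?w m * y)) \<le> 2 / L * (?w n ^ 0 * exp (- (?w n)\<^sup>2 / 2 * t))"
      using bd[of n y] by (simp add: abs_mult)
  qed
  have eq: "(\<Sum>n. f n y * sin (?w m * y)) = dirichlet_heat_kernel L t x y * sin (?w m * y)" for y
  proof -
    have "summable (\<lambda>n. f n y)"
      by (rule summable_comparison_test'[OF sm]) (use bd in \<open>simp\<close>)
    from suminf_mult2[OF this, of "sin (?w m * y)"] show ?thesis
      by (simp add: dirichlet_heat_kernel_def f_def)
  qed
  let ?v = "exp (- (?w m)\<^sup>2 / 2 * t) * sin (?w m * x)"
  have int: "((\<lambda>y. \<Sum>n<N. f n y * sin (?w m * y)) has_integral (\<Sum>n<N. if n = m then ?v else 0)) {0..L}" for N
  proof (rule has_integral_sum)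
    fix n
    have "((\<lambda>y. (2 / L * exp (- (?w n)\<^sup>2 / 2 * t) * sin (?w n * x)) * (sin (?w n * y) * sin (?w m * y)))
       has_integral (2 / L * exp (- (?w n)\<^sup>2 / 2 * t) * sin (?w n * x)) * (if n = m then L / 2 else 0)) {0..L}"
      by (intro has_integral_mult_right sin_freq_integral L)
    also have "(2 / L * exp (- (?w n)\<^sup>2 / 2 * t) * sin (?w n * x)) * (if n = m then L / 2 else 0) = (if n = m then ?v else 0)"
      using L by auto
    finally show "((\<lambda>y. f n y * sin (?w m * y)) has_integral (if n = m then ?v else 0)) {0..L}"
      by (simp add: f_def mult.assoc)
  qed simp
  obtain I J where I: "\<And>N. ((\<lambda>y. \<Sum>n<N. f n y * sin (?w m * y)) has_integral I N) {0..L}"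
    and J: "((\<lambda>y. \<Sum>n. f n y * sin (?w m * y)) has_integral J) {0..L}" and IJ: "I \<longlonglongrightarrow> J"
    proof (rule uniform_limit_integral[OF lim])
    show "continuous_on {0..L} (\<lambda>y. \<Sum>n<N. f n y * sin (?w m * y))" for N
      unfolding f_def by (intro continuous_intros)
  qed (simp, blast)
  have "I N = (\<Sum>n<N. if n = m then ?v else 0)" for N
    using I int by (rule has_integral_unique)
  then have "I \<longlonglongrightarrow> ?v" 
    by (intro tendsto_eventually eventually_sequentiallyI[of "Suc m"]) (simp add: sum.delta)
  then have "J = ?v" using IJ LIMSEQ_unique by blast
  with J show ?thesis by (simp add: eq)
qed


section \<open>Space-time white noise\<close>

definition noise_sets :: "real \<Rightarrow> (real \<times> real) set set" where
  "noise_sets L = {A \<in> sets borel. A \<subseteq> {0<..} \<times> {0<..<L} \<and> emeasure lborel A < \<infinity>}"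

definition centered_gaussian :: "'a measure \<Rightarrow> ('a \<Rightarrow> real) \<Rightarrow> real \<Rightarrow> bool" where
  "centered_gaussian M X v \<longleftrightarrow> X \<in> borel_measurable M \<and>
     (if v = 0 then (AE \<omega> in M. X \<omega> = 0)
      else v > 0 \<and> distributed M lborel X (normal_density 0 (sqrt v)))"

text \<open>
  White noise \<open>W\<close> on \<open>(0,\<infinity>) \<times> (0,L)\<close>, relative to a filtration \<open>F\<close>: a centered Gaussian process
  (every finite linear combination is Gaussian) indexed by the Borel sets of finite Lebesgue measure,
  with covariance \<open>E[W(A) W(B)] = |A \<inter> B|\<close>, which is adapted to \<open>F\<close> and whose restriction to times
  after \<open>t\<close> is independent of \<open>F t\<close>.  The filtration generated by \<open>W\<close>, completed or not, is a special
  case.  The values of \<open>F\<close> at negative times play no role.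
\<close>

locale white_noise =
  prob_space M + filtration "space M" F
  for M :: "'a measure" and F :: "real \<Rightarrow> 'a measure" +
  fixes L :: real and W :: "(real \<times> real) set \<Rightarrow> 'a \<Rightarrow> real"
  assumes subalgebra_F: "\<And>t. subalgebra M (F t)"
    and gaussian: "\<And>I c. finite I \<Longrightarrow> I \<subseteq> noise_sets L \<Longrightarrow>
      centered_gaussian M (\<lambda>\<omega>. \<Sum>A\<in>I. c A * W A \<omega>)
        (\<Sum>A\<in>I. \<Sum>B\<in>I. c A * c B * measure lborel (A \<inter> B))"
    and adapted: "\<And>t A. 0 \<le> t \<Longrightarrow> A \<in> noise_sets L \<Longrightarrow> A \<subseteq> {..t} \<times> UNIV \<Longrightarrow>
      W A \<in> borel_measurable (F t)"
    and indep_future: "\<And>t. 0 \<le> t \<Longrightarrow>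
      indep_set (sets (F t))
        (sigma_sets (space M) {W A -` S \<inter> space M | A S.
           A \<in> noise_sets L \<and> A \<subseteq> {t<..} \<times> UNIV \<and> S \<in> sets borel})"


section \<open>The Walsh integral\<close>

text \<open>
  A random field is a function of \<open>(s, y, \<omega>)\<close> on \<open>(0,\<infinity>) \<times> (0,L) \<times> \<Omega>\<close>.  The predictable
  \<open>\<sigma>\<close>-algebra is generated by the sets \<open>(a,b] \<times> B \<times> A\<close> with \<open>A\<close> in \<open>F a\<close>.
\<close>

definition predictable_sets ::
  "'a measure \<Rightarrow> (real \<Rightarrow> 'a measure) \<Rightarrow> real \<Rightarrow> (real \<times> real \<times> 'a) measure" where
  "predictable_sets M F L =
     sigma ({0<..} \<times> {0<..<L} \<times> space M)
       {{a<..b} \<times> B \<times> A | a b B A.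
          0 \<le> a \<and> a \<le> b \<and> B \<in> sets borel \<and> B \<subseteq> {0<..<L} \<and> A \<in> sets (F a)}"

definition field_measure :: "'a measure \<Rightarrow> real \<Rightarrow> (real \<times> real \<times> 'a) measure" where
  "field_measure M L =
     restrict_space lborel {0<..} \<Otimes>\<^sub>M (restrict_space lborel {0<..<L} \<Otimes>\<^sub>M M)"

text \<open>
  A list of quadruples \<open>(a, b, B, X)\<close> represents the simple field
  \<open>\<Sum> X(\<omega>) 1\<^sub>(\<^sub>a\<^sub>,\<^sub>b\<^sub>](s) 1\<^sub>B(y)\<close>, with \<open>X\<close> bounded and \<open>F a\<close>-measurable; its integral is
  \<open>\<Sum> X W((a,b] \<times> B)\<close>.
\<close>

type_synonym 'a simple_field = "(real \<times> real \<times> real set \<times> ('a \<Rightarrow> real)) list"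

definition simple_field ::
  "'a measure \<Rightarrow> (real \<Rightarrow> 'a measure) \<Rightarrow> real \<Rightarrow> 'a simple_field \<Rightarrow> bool" where
  "simple_field M F L S \<longleftrightarrow>
     (\<forall>(a, b, B, X) \<in> set S.
        0 \<le> a \<and> a \<le> b \<and> B \<in> sets borel \<and> B \<subseteq> {0<..<L} \<and>
        X \<in> borel_measurable (F a) \<and> bounded (X ` space M))"

definition simple_field_val :: "'a simple_field \<Rightarrow> real \<Rightarrow> real \<Rightarrow> 'a \<Rightarrow> real" where
  "simple_field_val S s y \<omega> =
     (\<Sum>(a, b, B, X) \<leftarrow> S. X \<omega> * indicator {a<..b} s * indicator B y)"

definition simple_field_integral ::
  "((real \<times> real) set \<Rightarrow> 'a \<Rightarrow> real) \<Rightarrow> 'a simple_field \<Rightarrow> 'a \<Rightarrow> real" where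
  "simple_field_integral W S \<omega> = (\<Sum>(a, b, B, X) \<leftarrow> S. X \<omega> * W ({a<..b} \<times> B) \<omega>)"

text \<open>
  \<open>Z\<close> is (a version of) \<open>\<integral>\<integral> \<Phi> dW\<close> over \<open>(0,\<infinity>) \<times> (0,L)\<close>: \<open>\<Phi>\<close> is predictable and
  square integrable, and \<open>Z\<close> is the \<open>L\<^sup>2(M)\<close>-limit of the integrals of simple fields converging to
  \<open>\<Phi>\<close> in \<open>L\<^sup>2(ds dy dM)\<close>.
\<close>

definition has_walsh_integral ::
  "'a measure \<Rightarrow> (real \<Rightarrow> 'a measure) \<Rightarrow> real \<Rightarrow> ((real \<times> real) set \<Rightarrow> 'a \<Rightarrow> real) \<Rightarrow>
     (real \<Rightarrow> real \<Rightarrow> 'a \<Rightarrow> real) \<Rightarrow> ('a \<Rightarrow> real) \<Rightarrow> bool" where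
  "has_walsh_integral M F L W \<Phi> Z \<longleftrightarrow>
     (\<lambda>(s, y, \<omega>). \<Phi> s y \<omega>) \<in> borel_measurable (predictable_sets M F L) \<and>
     (\<integral>\<^sup>+(s, y, \<omega>). ennreal ((\<Phi> s y \<omega>)\<^sup>2) \<partial>field_measure M L) < \<infinity> \<and>
     Z \<in> borel_measurable M \<and>
     (\<exists>S :: nat \<Rightarrow> 'a simple_field.
        (\<forall>n. simple_field M F L (S n)) \<and>
        (\<lambda>n. \<integral>\<^sup>+(s, y, \<omega>). ennreal ((\<Phi> s y \<omega> - simple_field_val (S n) s y \<omega>)\<^sup>2)
               \<partial>field_measure M L) \<longlonglongrightarrow> 0 \<and>
        (\<lambda>n. \<integral>\<^sup>+\<omega>. ennreal ((Z \<omega> - simple_field_integral W (S n) \<omega>)\<^sup>2) \<partial>M) \<longlonglongrightarrow> 0)"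


section \<open>Mild solutions\<close>

text \<open>
  The field is \<open>u t x \<omega>\<close> for \<open>t \<ge> 0\<close> and \<open>0 \<le> x \<le> L\<close>.  The factor \<open>1\<^sub>(\<^sub>0\<^sub>,\<^sub>t\<^sub>)(s)\<close> restricts the
  stochastic integral to \<open>(0,t)\<close>.  The equation is required at the end points \<open>x = 0, L\<close> too, where the
  kernel vanishes, so it contains the boundary condition \<open>u t 0 = u t L = 0\<close>.  At \<open>t = 0\<close>, where the
  kernel is a Dirac mass, it is read as \<open>u 0 x = u0 x\<close>.
\<close>

definition mild_solution ::
  "'a measure \<Rightarrow> (real \<Rightarrow> 'a measure) \<Rightarrow> real \<Rightarrow> ((real \<times> real) set \<Rightarrow> 'a \<Rightarrow> real) \<Rightarrow>
     (real \<Rightarrow> real) \<Rightarrow> real \<Rightarrow> (real \<Rightarrow> real) \<Rightarrow> (real \<Rightarrow> real \<Rightarrow> 'a \<Rightarrow> real) \<Rightarrow> bool" where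
  "mild_solution M F L W \<sigma> lam u0 u \<longleftrightarrow>
     (\<forall>t\<ge>0. \<forall>x\<in>{0..L}. u t x \<in> borel_measurable M) \<and>
     (\<lambda>(s, y, \<omega>). u s y \<omega>) \<in> borel_measurable (predictable_sets M F L) \<and>
     (\<forall>x\<in>{0..L}. AE \<omega> in M. u 0 x \<omega> = u0 x) \<and>
     (\<forall>t>0. \<forall>x\<in>{0..L}. \<exists>Z.
        has_walsh_integral M F L W
          (\<lambda>s y \<omega>. indicator {0<..<t} s * dirichlet_heat_kernel L (t - s) x y * \<sigma> (u s y \<omega>)) Z \<and>
        (AE \<omega> in M. u t x \<omega> =
           (LINT y:{0..L}|lebesgue. u0 y * dirichlet_heat_kernel L t x y) + lam * Z \<omega>))"


section \<open>Second moments\<close>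

definition second_moment :: "'a measure \<Rightarrow> (real \<Rightarrow> real \<Rightarrow> 'a \<Rightarrow> real) \<Rightarrow> real \<Rightarrow> real \<Rightarrow> ennreal" where
  "second_moment M u t x = (\<integral>\<^sup>+\<omega>. ennreal (\<bar>u t x \<omega>\<bar>\<^sup>2) \<partial>M)"

text \<open>Logarithm with \<open>log 0 = -\<infinity>\<close> and \<open>log \<infinity> = \<infinity>\<close>, unlike \<open>ln 0 = 0\<close> for the real logarithm.\<close>

definition elog :: "ennreal \<Rightarrow> ereal" where
  "elog m = (if m = 0 then -\<infinity> else if m = \<infinity> then \<infinity> else ereal (ln (enn2real m)))"

end

theory Submission
  imports Defs
begin

text \<open>
  Let \<open>f(t,x) = E|u\<^sub>t(x)|\<^sup>2\<close>.  The Walsh integral has mean zero and is an isometry, so the mild equation gives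
  \<open>f(t,x) = G\<^sub>t(x)\<^sup>2 + \<lambda>\<^sup>2 \<integral>\<integral> p(t-s,x,y)\<^sup>2 E[\<sigma>(u\<^sub>s(y))\<^sup>2] dy ds\<close>, where \<open>G\<^sub>t\<close> is the heat flow of the initial condition
  (\<open>mild_solution_second_moment\<close>).  Since \<open>\<sigma>(z)\<^sup>2\<close> lies between two multiples of \<open>z\<^sup>2\<close>, the function \<open>f\<close> is squeezed
  between two linear renewal inequalities with the kernel \<open>p\<^sup>2\<close>, and the rest of the proof is deterministic.
  Let \<open>w\<^sub>n = n\<pi>/L\<close> (\<open>dirichlet_freq\<close> counts from \<open>0\<close>, so it starts with \<open>\<pi>/L\<close>), \<open>c = (\<pi>/L)\<^sup>2\<close> and \<open>\<phi>(x) = sin (\<pi>x/L)\<close>.  The square of the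
  semigroup decays like \<open>exp (-c t)\<close>, because \<open>c/2\<close> is the lowest eigenvalue of \<open>-(1/2) d\<^sup>2/dx\<^sup>2\<close>.

  Upper bounds.  For \<open>\<beta> < c\<close> the Laplace transform of \<open>sup\<^sub>x \<integral> p(r,x,y)\<^sup>2 dy\<close> at \<open>-\<beta>\<close> is at most
  \<open>R(\<beta>) = (2/L) \<Sum>\<^sub>n 1/(w\<^sub>n\<^sup>2 - \<beta>)\<close>.  If \<open>\<lambda>\<^sup>2 L\<^sub>\<sigma>\<^sup>2 R(\<beta>) \<le> 1/2\<close>, the integral contributes at most half of the
  supremum of \<open>exp (\<beta>t) f(t,x)\<close> and can be absorbed, whence \<open>f(t,x) \<le> C exp (-\<beta>t)\<close> (\<open>renewal_upper_bound\<close>).  For small \<open>\<lambda>\<close> this applies with \<open>\<beta> = c/2\<close> and gives decay;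
  for every \<open>\<lambda>\<close> it applies with some very negative \<open>\<beta>\<close>, as \<open>R(\<beta>)\<close> tends to \<open>0\<close> when \<open>\<beta>\<close> tends to \<open>-\<infinity>\<close>, so the growth is at most
  exponential.

  Lower bounds.  Already \<open>f \<ge> G\<^sup>2\<close>, and \<open>G\<^sub>t(x)\<close> is at least a multiple of \<open>exp (-c t/2) \<phi>(x)\<close> for large \<open>t\<close>, so the decay is
  at most exponential.  For large \<open>\<lambda>\<close> one tests \<open>f\<close> against \<open>\<phi>\<^sup>2\<close>.  By the Cauchy-Schwarz inequality and the eigenfunction
  property, \<open>\<integral> p(r,x,y)\<^sup>2 \<phi>(x)\<^sup>2 dx \<ge> exp (-c r) \<phi>(y)\<^sup>2 / L\<close>, so \<open>h(t) = exp (c t) \<integral> f(t,x) \<phi>(x)\<^sup>2 dx\<close> satisfies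
  \<open>h(t) \<ge> k + (\<lambda>\<^sup>2 l\<^sub>\<sigma>\<^sup>2/L) \<integral> h(s) ds\<close> with \<open>k > 0\<close> and grows like \<open>exp (\<lambda>\<^sup>2 l\<^sub>\<sigma>\<^sup>2 t/L)\<close>.  Once \<open>\<lambda>\<^sup>2 l\<^sub>\<sigma>\<^sup>2 > c L\<close> this beats the
  decay, and one more use of the renewal inequality, together with \<open>p(r,x,y) \<ge> exp (-c r/2) \<phi>(x) \<phi>(y) / L\<close> for large \<open>r\<close>,
  transfers the growth to every single point \<open>x\<close> (\<open>renewal_lower_bound\<close>).
\<close>

section \<open>White noise as an orthogonal Gaussian family\<close>

lemma (in prob_space) centered_gaussian_moments:
  assumes "centered_gaussian M X v"
  shows "X \<in> borel_measurable M" "integrable M X" "expectation X = 0"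
    "integrable M (\<lambda>\<omega>. (X \<omega>)\<^sup>2)" "expectation (\<lambda>\<omega>. (X \<omega>)\<^sup>2) = v"
proof -
  show X [measurable]: "X \<in> borel_measurable M"
    using assms by (simp add: centered_gaussian_def)
  have "integrable M X \<and> expectation X = 0 \<and> integrable M (\<lambda>\<omega>. (X \<omega>)\<^sup>2) \<and>
      expectation (\<lambda>\<omega>. (X \<omega>)\<^sup>2) = v"
  proof (cases "v = 0")
    case True
    then have ae: "AE \<omega> in M. X \<omega> = 0"
      using assms by (simp add: centered_gaussian_def)
    then have ae2: "AE \<omega> in M. (X \<omega>)\<^sup>2 = 0" by auto
    have "integrable M X"
      by (rule integrable_cong_AE_imp[of _ "\<lambda>_. 0"]) (use ae in auto)
    moreover have "integrable M (\<lambda>\<omega>. (X \<omega>)\<^sup>2)"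
      by (rule integrable_cong_AE_imp[of _ "\<lambda>_. 0"]) (use ae2 in auto)
    moreover have "expectation X = 0" using ae by (rule integral_eq_zero_AE)
    moreover have "expectation (\<lambda>\<omega>. (X \<omega>)\<^sup>2) = 0" using ae2 by (rule integral_eq_zero_AE)
    ultimately show ?thesis using True by simp
  next
    case False
    then have v: "v > 0" and D: "distributed M lborel X (normal_density 0 (sqrt v))"
      using assms by (auto simp: centered_gaussian_def)
    have s: "sqrt v > 0" using v by simp
    have "integrable M X"
      using distributed_integrable[OF D, of "\<lambda>x. x"] integrable_normal_moment[OF s, of 0 1] by simp
    moreover have e: "expectation X = 0"
      by (rule normal_distributed_expectation[OF s D])
    moreover have "integrable M (\<lambda>\<omega>. (X \<omega>)\<^sup>2)"
      using distributed_integrable[OF D, of "\<lambda>x. x\<^sup>2"] integrable_normal_moment[OF s, of 0 2] by simp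
    moreover have "expectation (\<lambda>\<omega>. (X \<omega>)\<^sup>2) = v"
      using normal_distributed_variance[OF s D] e v by simp
    ultimately show ?thesis by simp
  qed
  then show "integrable M X" "expectation X = 0"
    "integrable M (\<lambda>\<omega>. (X \<omega>)\<^sup>2)" "expectation (\<lambda>\<omega>. (X \<omega>)\<^sup>2) = v" by auto
qed

lemma noise_sets_Int: "A \<in> noise_sets L \<Longrightarrow> B \<in> sets borel \<Longrightarrow> A \<inter> B \<in> noise_sets L"
  unfolding noise_sets_def
  by (auto intro: le_less_trans[OF emeasure_mono])

lemma noise_sets_Un: "A \<in> noise_sets L \<Longrightarrow> B \<in> noise_sets L \<Longrightarrow> A \<union> B \<in> noise_sets L"
  unfolding noise_sets_def
  by (auto intro!: le_less_trans[OF emeasure_subadditive])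

context white_noise
begin

lemma noise_moments:
  assumes "A \<in> noise_sets L"
  shows "W A \<in> borel_measurable M" "integrable M (W A)" "expectation (W A) = 0"
    "integrable M (\<lambda>\<omega>. (W A \<omega>)\<^sup>2)" "expectation (\<lambda>\<omega>. (W A \<omega>)\<^sup>2) = measure lborel A"
  using centered_gaussian_moments[OF gaussian[of "{A}" "\<lambda>_. 1"]] assms by simp_all

text \<open>
  Polarization: \<open>W A + W B\<close> is Gaussian with variance \<open>|A| + |B| + 2 |A \<inter> B|\<close>.
\<close>

lemma noise_covariance:
  assumes "A \<in> noise_sets L" "B \<in> noise_sets L"
  shows "integrable M (\<lambda>\<omega>. W A \<omega> * W B \<omega>)"
    "expectation (\<lambda>\<omega>. W A \<omega> * W B \<omega>) = measure lborel (A \<inter> B)"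
proof -
  note A = noise_moments[OF assms(1)] and B = noise_moments[OF assms(2)]
  have [measurable]: "W A \<in> borel_measurable M" "W B \<in> borel_measurable M" using A B by auto
  show int: "integrable M (\<lambda>\<omega>. W A \<omega> * W B \<omega>)"
  proof (rule Bochner_Integration.integrable_bound)
    show "integrable M (\<lambda>\<omega>. (W A \<omega>)\<^sup>2 + (W B \<omega>)\<^sup>2)" using A B by simp
    have "\<bar>a * b\<bar> \<le> \<bar>a\<^sup>2 + b\<^sup>2\<bar>" for a b :: real
    proof -
      have "2 * \<bar>a * b\<bar> \<le> a\<^sup>2 + b\<^sup>2"
        using sum_squares_bound[of "\<bar>a\<bar>" "\<bar>b\<bar>"] by (simp add: abs_mult mult.assoc)
      then show ?thesis by linarith
    qed
    then show "AE \<omega> in M. norm (W A \<omega> * W B \<omega>) \<le> norm ((W A \<omega>)\<^sup>2 + (W B \<omega>)\<^sup>2)" by simp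
  qed simp
  show "expectation (\<lambda>\<omega>. W A \<omega> * W B \<omega>) = measure lborel (A \<inter> B)"
  proof (cases "A = B")
    case True
    then show ?thesis using A by (simp add: power2_eq_square)
  next
    case False
    have "expectation (\<lambda>\<omega>. (W A \<omega> + W B \<omega>)\<^sup>2) =
        measure lborel A + measure lborel B + 2 * measure lborel (A \<inter> B)"
      using centered_gaussian_moments(5)[OF gaussian[of "{A, B}" "\<lambda>_. 1"]] assms False
      by (simp add: Int_commute)
    moreover have "(\<lambda>\<omega>. (W A \<omega> + W B \<omega>)\<^sup>2) = (\<lambda>\<omega>. (W A \<omega>)\<^sup>2 + (W B \<omega>)\<^sup>2 + 2 * (W A \<omega> * W B \<omega>))"
      by (simp add: power2_eq_square algebra_simps fun_eq_iff)
    ultimately show ?thesis using A B int by simp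
  qed
qed

text \<open>
  The square of the difference has mean \<open>0\<close>, by expanding it with the covariances.
\<close>

lemma noise_additive:
  assumes A: "A \<in> noise_sets L" and B: "B \<in> noise_sets L" and "A \<inter> B = {}"
  shows "AE \<omega> in M. W (A \<union> B) \<omega> = W A \<omega> + W B \<omega>"
proof -
  note U = noise_sets_Un[OF A B]
  note [measurable] = noise_moments(1)[OF A] noise_moments(1)[OF B] noise_moments(1)[OF U]
  note cov = noise_covariance[OF A A] noise_covariance[OF B B] noise_covariance[OF U U]
    noise_covariance[OF A B] noise_covariance[OF U A] noise_covariance[OF U B]
  have int: "integrable M (\<lambda>\<omega>. (W (A \<union> B) \<omega> - (W A \<omega> + W B \<omega>))\<^sup>2)"
    using cov by (simp add: power2_eq_square algebra_simps)
  have m: "measure lborel (A \<union> B) = measure lborel A + measure lborel B"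
    by (rule measure_Union) (use assms in \<open>auto simp: noise_sets_def\<close>)
  have "expectation (\<lambda>\<omega>. (W (A \<union> B) \<omega> - (W A \<omega> + W B \<omega>))\<^sup>2) =
    expectation (\<lambda>\<omega>. W (A \<union> B) \<omega> * W (A \<union> B) \<omega> + W A \<omega> * W A \<omega> + W B \<omega> * W B \<omega>
      + 2 * (W A \<omega> * W B \<omega>) - 2 * (W (A \<union> B) \<omega> * W A \<omega>) - 2 * (W (A \<union> B) \<omega> * W B \<omega>))"
    by (rule Bochner_Integration.integral_cong) (auto simp: power2_eq_square algebra_simps)
  also have "\<dots> = 0"
    using cov assms(3) by (simp add: m Int_absorb1)
  finally have "AE \<omega> in M. (W (A \<union> B) \<omega> - (W A \<omega> + W B \<omega>))\<^sup>2 = 0"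
    using integral_nonneg_eq_0_iff_AE[OF int] by auto
  then show ?thesis by auto
qed

text \<open>
  A measure space rather than a set of events, so that all measurable functions of the future noise, in particular
  products of two of its values, can be treated as independent of the past.
\<close>

definition noise_after :: "real \<Rightarrow> 'a measure" where
  "noise_after t = sigma (space M) {W A -` S \<inter> space M | A S.
     A \<in> noise_sets L \<and> A \<subseteq> {t<..} \<times> UNIV \<and> S \<in> sets borel}"

lemma noise_after_space_sets:
  "space (noise_after t) = space M"
  "sets (noise_after t) = sigma_sets (space M) {W A -` S \<inter> space M | A S.
     A \<in> noise_sets L \<and> A \<subseteq> {t<..} \<times> UNIV \<and> S \<in> sets borel}"
proof -
  let ?G = "{W A -` S \<inter> space M | A S. A \<in> noise_sets L \<and> A \<subseteq> {t<..} \<times> UNIV \<and> S \<in> sets borel}"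
  have "?G \<subseteq> Pow (space M)" by auto
  then show "space (noise_after t) = space M" "sets (noise_after t) = sigma_sets (space M) ?G"
    unfolding noise_after_def by simp_all
qed

lemma noise_after_measurable:
  assumes "A \<in> noise_sets L" "A \<subseteq> {t<..} \<times> UNIV"
  shows "W A \<in> borel_measurable (noise_after t)"
  by (rule measurableI) (use assms in \<open>auto simp: noise_after_space_sets intro!: sigma_sets.Basic\<close>)

text \<open>
  The independence of past and future, in the form in which all mixed moments below are computed.
\<close>

lemma past_future_product:
  assumes t: "0 \<le> t" and X: "X \<in> borel_measurable (F t)" and iX: "integrable M X"
    and Y: "Y \<in> borel_measurable (noise_after t)" and iY: "integrable M Y"
  shows "integrable M (\<lambda>\<omega>. X \<omega> * Y \<omega> :: real)"
    "expectation (\<lambda>\<omega>. X \<omega> * Y \<omega>) = expectation X * expectation Y"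
proof -
  have F: "space (F t) = space M"
    using subalgebra_F[of t] by (auto simp: subalgebra_def)
  have preimages: "sigma_sets (space M) {Z -` A \<inter> space M |A. A \<in> sets borel} \<subseteq> sets N"
    if "Z \<in> borel_measurable N" "space N = space M" for Z :: "'a \<Rightarrow> real" and N
    unfolding that(2)[symmetric]
    by (rule sets.sigma_sets_subset) (use that in \<open>auto dest: measurable_sets\<close>)
  have "indep_var borel X borel Y"
    unfolding indep_var_eq
  proof (intro conjI)
    show "random_variable borel X" "random_variable borel Y" using iX iY by auto
    have "indep_set (sets (F t)) (sets (noise_after t))"
      using indep_future[OF t] by (simp add: noise_after_space_sets)
    then show "indep_set (sigma_sets (space M) {X -` A \<inter> space M |A. A \<in> sets borel})
      (sigma_sets (space M) {Y -` A \<inter> space M |A. A \<in> sets borel})"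
      using preimages[OF X F] preimages[OF Y noise_after_space_sets(1)] unfolding indep_set_def
      by (rule_tac indep_sets_mono_sets) (auto split: bool.split)
  qed
  then show "integrable M (\<lambda>\<omega>. X \<omega> * Y \<omega>)"
    "expectation (\<lambda>\<omega>. X \<omega> * Y \<omega>) = expectation X * expectation Y"
    using iX iY by (auto intro: indep_var_integrable indep_var_lebesgue_integral)
qed

end

section \<open>Covariances of elementary integrands\<close>

text \<open>
  For integrands of either sign; it evaluates the integral of an elementary field over time, space and \<open>\<Omega>\<close>.
\<close>

lemma (in pair_sigma_finite) integral_tensor_product:
  fixes f g :: "_ \<Rightarrow> real"
  assumes f: "integrable M1 f" and g: "integrable M2 g"
  shows "integrable (M1 \<Otimes>\<^sub>M M2) (\<lambda>(x, y). f x * g y)"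
    "(\<integral>(x, y). f x * g y \<partial>(M1 \<Otimes>\<^sub>M M2)) = integral\<^sup>L M1 f * integral\<^sup>L M2 g"
proof -
  have [measurable]: "f \<in> borel_measurable M1" "g \<in> borel_measurable M2" using f g by auto
  show int: "integrable (M1 \<Otimes>\<^sub>M M2) (\<lambda>(x, y). f x * g y)"
    by (rule Fubini_integrable) (use f g in \<open>auto simp: abs_mult\<close>)
  show "(\<integral>(x, y). f x * g y \<partial>(M1 \<Otimes>\<^sub>M M2)) = integral\<^sup>L M1 f * integral\<^sup>L M2 g"
    using integral_fst'[OF int] by simp
qed

lemma borel_Times_real:
  fixes A B :: "real set"
  assumes "A \<in> sets borel" "B \<in> sets borel"
  shows "A \<times> B \<in> sets borel"
  using pair_measureI[OF assms] unfolding borel_prod .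

lemma measure_lborel_Times:
  fixes A B :: "real set"
  assumes "A \<in> sets borel" "B \<in> sets borel"
  shows "measure lborel (A \<times> B) = measure lborel A * measure lborel B"
  using lborel.emeasure_pair_measure_Times[of A lborel B] assms
  by (simp add: lborel_prod measure_def enn2real_mult)

lemma box_noise_sets:
  assumes "0 \<le> a" "B \<in> sets borel" "B \<subseteq> {0<..<L}"
  shows "{a<..b} \<times> B \<in> noise_sets L"
proof -
  have "bounded ({a<..b} \<times> B)"
    by (rule bounded_subset[of "{a..b} \<times> {0..L}"])
      (use assms in \<open>auto intro!: bounded_Times bounded_closed_interval\<close>)
  then show ?thesis
    using assms emeasure_bounded_finite by (auto simp: noise_sets_def borel_Times_real)
qed

lemma bounded_times_integrable:
  fixes X Y :: "'a \<Rightarrow> real"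
  assumes "X \<in> borel_measurable M" "bounded (X ` space M)" "integrable M Y"
  shows "integrable M (\<lambda>\<omega>. X \<omega> * Y \<omega>)"
proof -
  obtain K where K: "\<And>\<omega>. \<omega> \<in> space M \<Longrightarrow> \<bar>X \<omega>\<bar> \<le> K"
    using assms(2) by (auto simp: bounded_iff)
  show ?thesis
  proof (rule Bochner_Integration.integrable_bound)
    show "integrable M (\<lambda>\<omega>. K * \<bar>Y \<omega>\<bar>)" using assms(3) by simp
    show "AE \<omega> in M. norm (X \<omega> * Y \<omega>) \<le> norm (K * \<bar>Y \<omega>\<bar>)"
      using K by (auto intro!: AE_I2 simp: abs_mult mult_right_mono order_trans[OF K abs_ge_self])
  qed (use assms in auto)
qed

lemma bounded_times_bounded:
  fixes X Y :: "'a \<Rightarrow> real"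
  assumes "bounded (X ` A)" "bounded (Y ` A)"
  shows "bounded ((\<lambda>\<omega>. X \<omega> * Y \<omega>) ` A)"
proof -
  obtain K K' where "\<And>\<omega>. \<omega> \<in> A \<Longrightarrow> \<bar>X \<omega>\<bar> \<le> K" "\<And>\<omega>. \<omega> \<in> A \<Longrightarrow> \<bar>Y \<omega>\<bar> \<le> K'"
    using assms by (auto simp: bounded_iff)
  then have "\<bar>X \<omega> * Y \<omega>\<bar> \<le> K * K'" if "\<omega> \<in> A" for \<omega>
    using that by (auto simp: abs_mult intro!: mult_mono order_trans[OF abs_ge_zero])
  then show ?thesis by (auto simp: bounded_iff)
qed

context white_noise
begin

lemma F_measurable_mono:
  "X \<in> borel_measurable (F a) \<Longrightarrow> a \<le> t \<Longrightarrow> X \<in> borel_measurable (F t)"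
  using sets_F_mono[of a t] subalgebra_F[of a] subalgebra_F[of t]
  by (auto intro!: measurable_from_subalg[of "F t" "F a"] simp: subalgebra_def)

lemma F_measurable_M: "X \<in> borel_measurable (F a) \<Longrightarrow> X \<in> borel_measurable M"
  using subalgebra_F measurable_from_subalg by blast

text \<open>
  The later integrand starts at \<open>a'\<close>, so the earlier set is cut at time \<open>a'\<close>.  Its part before \<open>a'\<close> belongs, with
  \<open>X\<close> and \<open>X'\<close>, to the past of \<open>a'\<close> and is multiplied by the centered variable \<open>W((a',b'] \<times> B')\<close>, so it contributes
  nothing.  Its part after \<open>a'\<close> is independent of \<open>X X'\<close> and contains the whole intersection of the two sets.
\<close>

lemma step_covariance_ordered:
  assumes a: "0 \<le> a" "a \<le> a'"
    and B: "B \<in> sets borel" "B \<subseteq> {0<..<L}" "B' \<in> sets borel" "B' \<subseteq> {0<..<L}"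
    and X: "X \<in> borel_measurable (F a)" "bounded (X ` space M)"
    and X': "X' \<in> borel_measurable (F a')" "bounded (X' ` space M)"
  shows "integrable M (\<lambda>\<omega>. (X \<omega> * W ({a<..b} \<times> B) \<omega>) * (X' \<omega> * W ({a'<..b'} \<times> B') \<omega>))"
    and "expectation (\<lambda>\<omega>. (X \<omega> * W ({a<..b} \<times> B) \<omega>) * (X' \<omega> * W ({a'<..b'} \<times> B') \<omega>)) =
      expectation (\<lambda>\<omega>. X \<omega> * X' \<omega>) * measure lborel (({a<..b} \<times> B) \<inter> ({a'<..b'} \<times> B'))"
proof -
  let ?A = "{a<..b} \<times> B" and ?A' = "{a'<..b'} \<times> B'"
  let ?P = "?A \<inter> ({..a'} \<times> UNIV)" and ?Q = "?A \<inter> ({a'<..} \<times> UNIV)"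
  have a': "0 \<le> a'" using a by simp
  have A: "?A \<in> noise_sets L" "?A' \<in> noise_sets L"
    using a a' B by (auto intro: box_noise_sets)
  have PQ: "?P \<in> noise_sets L" "?Q \<in> noise_sets L"
    by (rule noise_sets_Int[OF A(1)], rule borel_Times_real, simp, simp)+
  have AE: "AE \<omega> in M. W ?A \<omega> = W ?P \<omega> + W ?Q \<omega>"
  proof -
    have "?A = ?P \<union> ?Q" by auto
    moreover have "AE \<omega> in M. W (?P \<union> ?Q) \<omega> = W ?P \<omega> + W ?Q \<omega>"
      by (rule noise_additive[OF PQ]) auto
    ultimately show ?thesis by metis
  qed
  have XF: "X \<in> borel_measurable (F a')" using X(1) a(2) by (rule F_measurable_mono)
  have XX: "(\<lambda>\<omega>. X \<omega> * X' \<omega>) \<in> borel_measurable (F a')" using XF X' by measurable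
  have XXb: "bounded ((\<lambda>\<omega>. X \<omega> * X' \<omega>) ` space M)" using X X' by (intro bounded_times_bounded)
  have WP: "W ?P \<in> borel_measurable (F a')" by (rule adapted[OF a' PQ(1)]) auto
  have WA': "W ?A' \<in> borel_measurable (noise_after a')"
    by (rule noise_after_measurable[OF A(2)]) auto
  have WQ: "W ?Q \<in> borel_measurable (noise_after a')"
    by (rule noise_after_measurable[OF PQ(2)]) auto
  have iXX: "integrable M (\<lambda>\<omega>. X \<omega> * X' \<omega>)"
    using bounded_times_integrable[OF F_measurable_M[OF XX] XXb, of "\<lambda>_. 1"] by simp
  have iP: "integrable M (\<lambda>\<omega>. (X \<omega> * X' \<omega>) * W ?P \<omega>)"
    by (rule bounded_times_integrable[OF F_measurable_M[OF XX] XXb noise_moments(2)[OF PQ(1)]])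
  have XXP: "(\<lambda>\<omega>. (X \<omega> * X' \<omega>) * W ?P \<omega>) \<in> borel_measurable (F a')"
    using XX WP by measurable
  have QA': "(\<lambda>\<omega>. W ?Q \<omega> * W ?A' \<omega>) \<in> borel_measurable (noise_after a')"
    using WQ WA' by measurable
  note 1 = past_future_product[OF a' XXP iP WA' noise_moments(2)[OF A(2)]]
  note 2 = past_future_product[OF a' XX iXX QA' noise_covariance(1)[OF PQ(2) A(2)]]
  have "?Q \<inter> ?A' = ?A \<inter> ?A'" by auto
  then have e: "expectation (\<lambda>\<omega>. W ?Q \<omega> * W ?A' \<omega>) = measure lborel (?A \<inter> ?A')"
    using noise_covariance(2)[OF PQ(2) A(2)] by simp
  note [measurable] = F_measurable_M[OF X(1)] F_measurable_M[OF X'(1)] noise_moments(1)[OF A(1)]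
    noise_moments(1)[OF A(2)] noise_moments(1)[OF PQ(1)] noise_moments(1)[OF PQ(2)]
  let ?f = "\<lambda>\<omega>. (X \<omega> * W ?A \<omega>) * (X' \<omega> * W ?A' \<omega>)"
  let ?g = "\<lambda>\<omega>. (X \<omega> * X' \<omega>) * W ?P \<omega> * W ?A' \<omega> + (X \<omega> * X' \<omega>) * (W ?Q \<omega> * W ?A' \<omega>)"
  have eq: "AE \<omega> in M. ?f \<omega> = ?g \<omega>"
    using AE by eventually_elim (simp add: algebra_simps)
  have ig: "integrable M ?g" using 1 2 by (intro Bochner_Integration.integrable_add)
  have mf: "?f \<in> borel_measurable M" by measurable
  show "integrable M ?f"
    using integrable_cong_AE[OF mf borel_measurable_integrable[OF ig] eq] ig by simp
  have "expectation ?f = expectation ?g"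
    by (rule integral_cong_AE[OF mf borel_measurable_integrable[OF ig] eq])
  also have "\<dots> = expectation (\<lambda>\<omega>. X \<omega> * X' \<omega>) * measure lborel (?A \<inter> ?A')"
    using 1 2 e noise_moments(3)[OF A(2)] by (simp add: Bochner_Integration.integral_add)
  finally show "expectation ?f = expectation (\<lambda>\<omega>. X \<omega> * X' \<omega>) * measure lborel (?A \<inter> ?A')" .
qed

lemma step_covariance:
  assumes a: "0 \<le> a" "0 \<le> a'"
    and B: "B \<in> sets borel" "B \<subseteq> {0<..<L}" "B' \<in> sets borel" "B' \<subseteq> {0<..<L}"
    and X: "X \<in> borel_measurable (F a)" "bounded (X ` space M)"
    and X': "X' \<in> borel_measurable (F a')" "bounded (X' ` space M)"
  shows "integrable M (\<lambda>\<omega>. (X \<omega> * W ({a<..b} \<times> B) \<omega>) * (X' \<omega> * W ({a'<..b'} \<times> B') \<omega>))"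
      (is "integrable M ?f")
    and "expectation (\<lambda>\<omega>. (X \<omega> * W ({a<..b} \<times> B) \<omega>) * (X' \<omega> * W ({a'<..b'} \<times> B') \<omega>)) =
      expectation (\<lambda>\<omega>. X \<omega> * X' \<omega>) * measure lborel (({a<..b} \<times> B) \<inter> ({a'<..b'} \<times> B'))"
      (is "?l = ?r")
proof -
  have "integrable M ?f \<and> ?l = ?r"
  proof (cases "a \<le> a'")
    case True
    then show ?thesis using step_covariance_ordered[OF a(1) True B X X'] by blast
  next
    case False
    then show ?thesis
      using step_covariance_ordered[OF a(2) _ B(3,4,1,2) X' X, of b' b]
      by (simp add: mult.commute Int_commute)
  qed
  then show "integrable M ?f" "?l = ?r" by auto
qed

lemma step_expectation:
  assumes a: "0 \<le> a" and B: "B \<in> sets borel" "B \<subseteq> {0<..<L}"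
    and X: "X \<in> borel_measurable (F a)" "bounded (X ` space M)"
  shows "integrable M (\<lambda>\<omega>. X \<omega> * W ({a<..b} \<times> B) \<omega>)"
    and "expectation (\<lambda>\<omega>. X \<omega> * W ({a<..b} \<times> B) \<omega>) = 0"
proof -
  let ?A = "{a<..b} \<times> B"
  have A: "?A \<in> noise_sets L" using a B by (intro box_noise_sets)
  have iX: "integrable M X"
    using bounded_times_integrable[OF F_measurable_M[OF X(1)] X(2), of "\<lambda>_. 1"] by simp
  have WA: "W ?A \<in> borel_measurable (noise_after a)"
    by (rule noise_after_measurable[OF A]) auto
  note 1 = past_future_product[OF a X(1) iX WA noise_moments(2)[OF A]]
  show "integrable M (\<lambda>\<omega>. X \<omega> * W ?A \<omega>)" by (rule 1)
  show "expectation (\<lambda>\<omega>. X \<omega> * W ?A \<omega>) = 0" using 1 noise_moments(3)[OF A] by simp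
qed

text \<open>
  The same value as in \<open>step_covariance\<close>, now for the integrands: this is the isometry on pairs of elementary fields.
\<close>

lemma step_field_covariance:
  assumes a: "0 \<le> a" "0 \<le> a'"
    and B: "B \<in> sets borel" "B \<subseteq> {0<..<L}" "B' \<in> sets borel" "B' \<subseteq> {0<..<L}"
    and X: "X \<in> borel_measurable M" "bounded (X ` space M)"
    and X': "X' \<in> borel_measurable M" "bounded (X' ` space M)"
  shows "integrable (field_measure M L) (\<lambda>(s, y, \<omega>). (X \<omega> * indicator {a<..b} s * indicator B y) *
          (X' \<omega> * indicator {a'<..b'} s * indicator B' y))" (is "integrable _ ?f")
    and "(\<integral>(s, y, \<omega>). (X \<omega> * indicator {a<..b} s * indicator B y) *
          (X' \<omega> * indicator {a'<..b'} s * indicator B' y) \<partial>field_measure M L) =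
      expectation (\<lambda>\<omega>. X \<omega> * X' \<omega>) * measure lborel (({a<..b} \<times> B) \<inter> ({a'<..b'} \<times> B'))"
proof -
  let ?I = "{a<..b} \<inter> {a'<..b'}" and ?C = "B \<inter> B'"
  let ?T = "restrict_space lborel {0::real<..}" and ?S = "restrict_space lborel {0::real<..<L}"
  interpret T: sigma_finite_measure ?T
    by (rule sigma_finite_measure_restrict_space) (auto intro: lborel.sigma_finite_measure_axioms)
  interpret S: sigma_finite_measure ?S
    by (rule sigma_finite_measure_restrict_space) (auto intro: lborel.sigma_finite_measure_axioms)
  interpret SM: pair_sigma_finite ?S M ..
  interpret TSM: pair_sigma_finite ?T "?S \<Otimes>\<^sub>M M" ..
  have fin: "emeasure lborel D < \<infinity>" if "D \<subseteq> {u..v}" for D and u v :: real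
    using emeasure_bounded_finite[OF bounded_subset[OF bounded_closed_interval that]] .
  have "emeasure lborel ?I < \<infinity>" by (rule fin[of _ a b]) auto
  with a have I: "?I \<subseteq> {0<..}" "?I \<in> sets borel" "emeasure lborel ?I < \<infinity>" by auto
  have "emeasure lborel ?C < \<infinity>" by (rule fin[of _ 0 L]) (use B in auto)
  with B have C: "?C \<subseteq> {0<..<L}" "?C \<in> sets borel" "emeasure lborel ?C < \<infinity>" by auto
  have iI: "integrable ?T (indicator ?I :: real \<Rightarrow> real)" "integral\<^sup>L ?T (indicator ?I :: real \<Rightarrow> real) = measure lborel ?I"
    using I by (auto simp: emeasure_restrict_space measure_restrict_space sets_restrict_space_iff Int_absorb2)
  have iC: "integrable ?S (indicator ?C :: real \<Rightarrow> real)" "integral\<^sup>L ?S (indicator ?C :: real \<Rightarrow> real) = measure lborel ?C"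
    using C by (auto simp: emeasure_restrict_space measure_restrict_space sets_restrict_space_iff Int_absorb2)
  have "(\<lambda>\<omega>. X \<omega> * X' \<omega>) \<in> borel_measurable M" using X X' by measurable
  from bounded_times_integrable[OF this bounded_times_bounded[OF X(2) X'(2)], of "\<lambda>_. 1"]
  have iX: "integrable M (\<lambda>\<omega>. X \<omega> * X' \<omega>)" by simp
  note 1 = SM.integral_tensor_product[OF iC(1) iX]
  note 2 = TSM.integral_tensor_product[OF iI(1) 1(1)]
  have f: "?f = (\<lambda>(s, q). indicator ?I s * (case q of (y, \<omega>) \<Rightarrow> indicator ?C y * (X \<omega> * X' \<omega>)))"
    by (auto simp: fun_eq_iff indicator_def)
  show "integrable (field_measure M L) ?f"
    unfolding f field_measure_def by (rule 2)
  have "({a<..b} \<times> B) \<inter> ({a'<..b'} \<times> B') = ?I \<times> ?C" by auto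
  then have "measure lborel (({a<..b} \<times> B) \<inter> ({a'<..b'} \<times> B')) = measure lborel ?I * measure lborel ?C"
    using I C measure_lborel_Times by simp
  then show "(\<integral>(s, y, \<omega>). (X \<omega> * indicator {a<..b} s * indicator B y) *
          (X' \<omega> * indicator {a'<..b'} s * indicator B' y) \<partial>field_measure M L) =
      expectation (\<lambda>\<omega>. X \<omega> * X' \<omega>) * measure lborel (({a<..b} \<times> B) \<inter> ({a'<..b'} \<times> B'))"
    unfolding f field_measure_def 2(2) 1(2) iI(2) iC(2) by simp
qed

end

section \<open>The Walsh isometry\<close>

lemma integral_double_sum:
  fixes f :: "'i \<Rightarrow> 'j \<Rightarrow> 'b \<Rightarrow> real"
  assumes int: "\<And>i j. i \<in> I \<Longrightarrow> j \<in> J \<Longrightarrow> integrable N (f i j)"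
  shows "(\<integral>x. (\<Sum>i\<in>I. \<Sum>j\<in>J. f i j x) \<partial>N) = (\<Sum>i\<in>I. \<Sum>j\<in>J. \<integral>x. f i j x \<partial>N)"
proof -
  have "(\<integral>x. (\<Sum>i\<in>I. \<Sum>j\<in>J. f i j x) \<partial>N) = (\<Sum>i\<in>I. \<integral>x. (\<Sum>j\<in>J. f i j x) \<partial>N)"
    using int by (intro Bochner_Integration.integral_sum Bochner_Integration.integrable_sum)
  also have "\<dots> = (\<Sum>i\<in>I. \<Sum>j\<in>J. \<integral>x. f i j x \<partial>N)"
    using int by (intro sum.cong refl Bochner_Integration.integral_sum)
  finally show ?thesis .
qed

context white_noise
begin

text \<open>
  Both sides expand into a double sum over the pieces, and the summands agree by \<open>step_covariance\<close> and
  \<open>step_field_covariance\<close>.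
\<close>

lemma simple_field_isometry:
  assumes S: "simple_field M F L S"
  shows "integrable M (simple_field_integral W S)"
    and "expectation (simple_field_integral W S) = 0"
    and "integrable M (\<lambda>\<omega>. (simple_field_integral W S \<omega>)\<^sup>2)"
    and "integrable (field_measure M L) (\<lambda>(s, y, \<omega>). (simple_field_val S s y \<omega>)\<^sup>2)"
    and "expectation (\<lambda>\<omega>. (simple_field_integral W S \<omega>)\<^sup>2) =
      (\<integral>(s, y, \<omega>). (simple_field_val S s y \<omega>)\<^sup>2 \<partial>field_measure M L)"
    and "(\<lambda>(s, y, \<omega>). simple_field_val S s y \<omega>) \<in> borel_measurable (field_measure M L)"
proof -
  define a b B X where "a i = fst (S ! i)" and "b i = fst (snd (S ! i))"
    and "B i = fst (snd (snd (S ! i)))" and "X i = snd (snd (snd (S ! i)))" for i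
  let ?n = "length S"
  let ?A = "\<lambda>i. {a i<..b i} \<times> B i"
  let ?v = "\<lambda>i s y \<omega>. X i \<omega> * indicator {a i<..b i} s * indicator (B i) y :: real"
  have Si: "0 \<le> a i" "B i \<in> sets borel" "B i \<subseteq> {0<..<L}"
    "X i \<in> borel_measurable (F (a i))" "bounded (X i ` space M)" if "i < ?n" for i
    using S nth_mem[OF that] unfolding simple_field_def a_def b_def B_def X_def
    by (auto split: prod.splits simp: case_prod_beta)
  have I: "simple_field_integral W S = (\<lambda>\<omega>. \<Sum>i<?n. X i \<omega> * W (?A i) \<omega>)"
    by (simp add: fun_eq_iff simple_field_integral_def sum_list_sum_nth case_prod_beta
        a_def b_def B_def X_def atLeast0LessThan)
  have V: "simple_field_val S = (\<lambda>s y \<omega>. \<Sum>i<?n. ?v i s y \<omega>)"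
    by (simp add: fun_eq_iff simple_field_val_def sum_list_sum_nth case_prod_beta
        a_def b_def B_def X_def atLeast0LessThan)
  have exp: "integrable M (\<lambda>\<omega>. X i \<omega> * W (?A i) \<omega>)" "expectation (\<lambda>\<omega>. X i \<omega> * W (?A i) \<omega>) = 0"
    if "i < ?n" for i
    by (rule step_expectation, (rule Si[OF that])+)+
  have cov: "integrable M (\<lambda>\<omega>. (X i \<omega> * W (?A i) \<omega>) * (X j \<omega> * W (?A j) \<omega>))"
      "expectation (\<lambda>\<omega>. (X i \<omega> * W (?A i) \<omega>) * (X j \<omega> * W (?A j) \<omega>)) =
        expectation (\<lambda>\<omega>. X i \<omega> * X j \<omega>) * measure lborel (?A i \<inter> ?A j)"
    and fcov: "integrable (field_measure M L) (\<lambda>(s, y, \<omega>). ?v i s y \<omega> * ?v j s y \<omega>)"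
      "(\<integral>(s, y, \<omega>). ?v i s y \<omega> * ?v j s y \<omega> \<partial>field_measure M L) =
        expectation (\<lambda>\<omega>. X i \<omega> * X j \<omega>) * measure lborel (?A i \<inter> ?A j)"
    if i: "i < ?n" and j: "j < ?n" for i j
  proof -
    note ij = Si(1)[OF i] Si(1)[OF j] Si(2)[OF i] Si(3)[OF i] Si(2)[OF j] Si(3)[OF j]
    note XF = Si(4)[OF i] Si(5)[OF i] Si(4)[OF j] Si(5)[OF j]
    note XM = F_measurable_M[OF Si(4)[OF i]] Si(5)[OF i] F_measurable_M[OF Si(4)[OF j]] Si(5)[OF j]
    show "integrable M (\<lambda>\<omega>. (X i \<omega> * W (?A i) \<omega>) * (X j \<omega> * W (?A j) \<omega>))"
      by (rule step_covariance(1)[OF ij XF])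
    show "expectation (\<lambda>\<omega>. (X i \<omega> * W (?A i) \<omega>) * (X j \<omega> * W (?A j) \<omega>)) =
        expectation (\<lambda>\<omega>. X i \<omega> * X j \<omega>) * measure lborel (?A i \<inter> ?A j)"
      by (rule step_covariance(2)[OF ij XF])
    show "integrable (field_measure M L) (\<lambda>(s, y, \<omega>). ?v i s y \<omega> * ?v j s y \<omega>)"
      by (rule step_field_covariance(1)[OF ij XM])
    show "(\<integral>(s, y, \<omega>). ?v i s y \<omega> * ?v j s y \<omega> \<partial>field_measure M L) =
        expectation (\<lambda>\<omega>. X i \<omega> * X j \<omega>) * measure lborel (?A i \<inter> ?A j)"
      by (rule step_field_covariance(2)[OF ij XM])
  qed
  have "(\<lambda>(s, y, \<omega>). ?v i s y \<omega>) \<in> borel_measurable (field_measure M L)" if "i < ?n" for i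
  proof -
    have "(\<lambda>(s, y, \<omega>). ?v i s y \<omega> * (1 * indicator {a i<..b i} s * indicator (B i) y))
        \<in> borel_measurable (field_measure M L)"
    proof (rule borel_measurable_integrable, rule step_field_covariance(1))
      show "X i \<in> borel_measurable M" by (rule F_measurable_M[OF Si(4)[OF that]])
      show "bounded ((\<lambda>_. 1::real) ` space M)" by (auto simp: bounded_iff)
    qed (use Si[OF that] in simp_all)
    also have "(\<lambda>(s, y, \<omega>). ?v i s y \<omega> * (1 * indicator {a i<..b i} s * indicator (B i) y)) =
        (\<lambda>(s, y, \<omega>). ?v i s y \<omega>)"
      by (auto simp: fun_eq_iff indicator_def)
    finally show ?thesis .
  qed
  then have "(\<lambda>p. \<Sum>i<?n. (case p of (s, y, \<omega>) \<Rightarrow> ?v i s y \<omega>)) \<in> borel_measurable (field_measure M L)"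
    by (intro borel_measurable_sum) auto
  also have "(\<lambda>p. \<Sum>i<?n. (case p of (s, y, \<omega>) \<Rightarrow> ?v i s y \<omega>)) = (\<lambda>(s, y, \<omega>). simple_field_val S s y \<omega>)"
    by (simp add: V fun_eq_iff)
  finally show "(\<lambda>(s, y, \<omega>). simple_field_val S s y \<omega>) \<in> borel_measurable (field_measure M L)" .
  show "integrable M (simple_field_integral W S)" "expectation (simple_field_integral W S) = 0"
    unfolding I by (auto simp: Bochner_Integration.integral_sum exp intro!: exp(1))
  have I2: "(\<lambda>\<omega>. (simple_field_integral W S \<omega>)\<^sup>2) =
      (\<lambda>\<omega>. \<Sum>i<?n. \<Sum>j<?n. (X i \<omega> * W (?A i) \<omega>) * (X j \<omega> * W (?A j) \<omega>))"
    unfolding I by (simp add: power2_eq_square sum_product)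
  have V2: "(\<lambda>(s, y, \<omega>). (simple_field_val S s y \<omega>)\<^sup>2) =
      (\<lambda>p. \<Sum>i<?n. \<Sum>j<?n. (case p of (s, y, \<omega>) \<Rightarrow> ?v i s y \<omega> * ?v j s y \<omega>))"
  proof
    fix p :: "real \<times> real \<times> 'a"
    obtain s y \<omega> where p: "p = (s, y, \<omega>)" by (cases p)
    show "(case p of (s, y, \<omega>) \<Rightarrow> (simple_field_val S s y \<omega>)\<^sup>2) =
      (\<Sum>i<?n. \<Sum>j<?n. (case p of (s, y, \<omega>) \<Rightarrow> ?v i s y \<omega> * ?v j s y \<omega>))"
      unfolding p prod.case V power2_eq_square by (rule sum_product)
  qed
  show "integrable M (\<lambda>\<omega>. (simple_field_integral W S \<omega>)\<^sup>2)"
    unfolding I2 by (intro Bochner_Integration.integrable_sum) (simp add: cov(1))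
  show "integrable (field_measure M L) (\<lambda>(s, y, \<omega>). (simple_field_val S s y \<omega>)\<^sup>2)"
    unfolding V2 by (intro Bochner_Integration.integrable_sum) (simp add: fcov(1))
  have "expectation (\<lambda>\<omega>. (simple_field_integral W S \<omega>)\<^sup>2) =
      (\<Sum>i<?n. \<Sum>j<?n. expectation (\<lambda>\<omega>. (X i \<omega> * W (?A i) \<omega>) * (X j \<omega> * W (?A j) \<omega>)))"
    unfolding I2 by (rule integral_double_sum) (rule cov(1); simp)
  also have "\<dots> = (\<Sum>i<?n. \<Sum>j<?n. expectation (\<lambda>\<omega>. X i \<omega> * X j \<omega>) * measure lborel (?A i \<inter> ?A j))"
    by (intro sum.cong refl cov(2)) simp_all
  also have "\<dots> = (\<Sum>i<?n. \<Sum>j<?n. (\<integral>(s, y, \<omega>). ?v i s y \<omega> * ?v j s y \<omega> \<partial>field_measure M L))"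
    by (intro sum.cong refl fcov(2)[symmetric]) simp_all
  also have "\<dots> = (\<integral>(s, y, \<omega>). (simple_field_val S s y \<omega>)\<^sup>2 \<partial>field_measure M L)"
    unfolding V2 by (rule integral_double_sum[symmetric]) (rule fcov(1); simp)
  finally show "expectation (\<lambda>\<omega>. (simple_field_integral W S \<omega>)\<^sup>2) =
      (\<integral>(s, y, \<omega>). (simple_field_val S s y \<omega>)\<^sup>2 \<partial>field_measure M L)" .
qed

end

text \<open>
  A substitute for the triangle inequality in \<open>L\<^sup>2\<close> that is valid for infinite norms, from Young's inequality
  \<open>2 v (u - v) \<le> d v\<^sup>2 + (u - v)\<^sup>2 / d\<close>.
\<close>

lemma nn_integral_square_perturb:
  fixes f g :: "'b \<Rightarrow> real"
  assumes [measurable]: "f \<in> borel_measurable M" "g \<in> borel_measurable M" and d: "d > 0"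
  shows "(\<integral>\<^sup>+x. ennreal ((f x)\<^sup>2) \<partial>M) \<le>
    ennreal (1 + d) * (\<integral>\<^sup>+x. ennreal ((g x)\<^sup>2) \<partial>M) + ennreal (1 + 1 / d) * (\<integral>\<^sup>+x. ennreal ((f x - g x)\<^sup>2) \<partial>M)"
proof -
  have young: "u\<^sup>2 \<le> (1 + d) * v\<^sup>2 + (1 + 1 / d) * (u - v)\<^sup>2" for u v :: real
  proof -
    have "0 \<le> (d * v - (u - v))\<^sup>2 / d" using d by simp
    also have "\<dots> = (1 + d) * v\<^sup>2 + (1 + 1 / d) * (u - v)\<^sup>2 - u\<^sup>2"
      using d by (simp add: field_simps power2_eq_square)
    finally show ?thesis by simp
  qed
  have "(\<integral>\<^sup>+x. ennreal ((f x)\<^sup>2) \<partial>M) \<le>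
      (\<integral>\<^sup>+x. ennreal (1 + d) * ennreal ((g x)\<^sup>2) + ennreal (1 + 1 / d) * ennreal ((f x - g x)\<^sup>2) \<partial>M)"
    using young d by (intro nn_integral_mono)
      (simp add: ennreal_mult[symmetric] ennreal_plus[symmetric] del: ennreal_plus)
  also have "\<dots> = ennreal (1 + d) * (\<integral>\<^sup>+x. ennreal ((g x)\<^sup>2) \<partial>M) + ennreal (1 + 1 / d) * (\<integral>\<^sup>+x. ennreal ((f x - g x)\<^sup>2) \<partial>M)"
    by (simp add: nn_integral_add nn_integral_cmult)
  finally show ?thesis .
qed

text \<open>
  An isometry passes to \<open>L\<^sup>2\<close>-limits.  Only one inequality is stated; exchanging the roles of the two spaces gives
  the other.
\<close>

lemma square_norm_limit_le:
  fixes f :: "'b \<Rightarrow> real" and g :: "'c \<Rightarrow> real"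
  assumes [measurable]: "f \<in> borel_measurable M" "\<And>n. fn n \<in> borel_measurable M"
    "g \<in> borel_measurable N" "\<And>n. gn n \<in> borel_measurable N"
    and eq: "\<And>n. (\<integral>\<^sup>+x. ennreal ((fn n x)\<^sup>2) \<partial>M) = (\<integral>\<^sup>+x. ennreal ((gn n x)\<^sup>2) \<partial>N)"
    and f: "(\<lambda>n. \<integral>\<^sup>+x. ennreal ((f x - fn n x)\<^sup>2) \<partial>M) \<longlonglongrightarrow> 0"
    and g: "(\<lambda>n. \<integral>\<^sup>+x. ennreal ((g x - gn n x)\<^sup>2) \<partial>N) \<longlonglongrightarrow> 0"
  shows "(\<integral>\<^sup>+x. ennreal ((f x)\<^sup>2) \<partial>M) \<le> (\<integral>\<^sup>+x. ennreal ((g x)\<^sup>2) \<partial>N)"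
proof -
  let ?f = "\<integral>\<^sup>+x. ennreal ((f x)\<^sup>2) \<partial>M" and ?g = "\<integral>\<^sup>+x. ennreal ((g x)\<^sup>2) \<partial>N"
  let ?a = "\<lambda>n. \<integral>\<^sup>+x. ennreal ((f x - fn n x)\<^sup>2) \<partial>M" and ?b = "\<lambda>n. \<integral>\<^sup>+x. ennreal ((g x - gn n x)\<^sup>2) \<partial>N"
  have step: "?f \<le> ennreal (1 + d) * (ennreal (1 + d) * ?g)" if d: "d > 0" for d
  proof (rule LIMSEQ_le_const)
    have "?f \<le> ennreal (1 + d) * (ennreal (1 + d) * ?g + ennreal (1 + 1 / d) * ?b n) + ennreal (1 + 1 / d) * ?a n" for n
    proof -
      have "?f \<le> ennreal (1 + d) * (\<integral>\<^sup>+x. ennreal ((fn n x)\<^sup>2) \<partial>M) + ennreal (1 + 1 / d) * ?a n"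
        by (rule nn_integral_square_perturb) (use d in auto)
      also have "\<dots> = ennreal (1 + d) * (\<integral>\<^sup>+x. ennreal ((gn n x)\<^sup>2) \<partial>N) + ennreal (1 + 1 / d) * ?a n"
        by (simp add: eq)
      also have "(\<integral>\<^sup>+x. ennreal ((gn n x)\<^sup>2) \<partial>N) \<le> ennreal (1 + d) * ?g + ennreal (1 + 1 / d) * ?b n"
        using nn_integral_square_perturb[of "gn n" N g d] d by (simp add: power2_commute)
      finally show ?thesis by (simp add: add_mono mult_left_mono)
    qed
    then show "\<exists>N. \<forall>n\<ge>N. ?f \<le> ennreal (1 + d) * (ennreal (1 + d) * ?g + ennreal (1 + 1 / d) * ?b n) + ennreal (1 + 1 / d) * ?a n"
      by blast
    have "(\<lambda>n. ennreal (1 + d) * (ennreal (1 + d) * ?g + ennreal (1 + 1 / d) * ?b n) + ennreal (1 + 1 / d) * ?a n)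
       \<longlonglongrightarrow> ennreal (1 + d) * (ennreal (1 + d) * ?g + ennreal (1 + 1 / d) * 0) + ennreal (1 + 1 / d) * 0"
      by (intro tendsto_add tendsto_const ennreal_tendsto_cmult f g) (simp_all add: less_top[symmetric])
    then show "(\<lambda>n. ennreal (1 + d) * (ennreal (1 + d) * ?g + ennreal (1 + 1 / d) * ?b n) + ennreal (1 + 1 / d) * ?a n)
       \<longlonglongrightarrow> ennreal (1 + d) * (ennreal (1 + d) * ?g)" by simp
  qed
  have lim: "(\<lambda>n. ennreal (1 + 1 / real (Suc n))) \<longlonglongrightarrow> ennreal 1"
    by (rule tendsto_ennrealI) real_asymp
  have "(\<lambda>n. ennreal (1 + 1 / real (Suc n)) * (ennreal (1 + 1 / real (Suc n)) * ?g)) \<longlonglongrightarrow> ennreal 1 * (ennreal 1 * ?g)"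
    by (intro tendsto_mult_ennreal lim tendsto_const) auto
  then have "ennreal 1 * (ennreal 1 * ?g) \<ge> ?f"
  proof (rule LIMSEQ_le_const)
    show "\<exists>N. \<forall>n\<ge>N. ?f \<le> ennreal (1 + 1 / real (Suc n)) * (ennreal (1 + 1 / real (Suc n)) * ?g)"
      by (intro exI allI impI step) simp
  qed
  then show "?f \<le> ?g" by simp
qed

text \<open>
  Predictable rectangles are measurable rectangles, since the filtration consists of sub-\<open>\<sigma>\<close>-algebras.
\<close>

lemma predictable_measurable_field:
  assumes sub: "\<And>t. subalgebra M (F t)"
    and f: "f \<in> borel_measurable (predictable_sets M F L)"
  shows "f \<in> borel_measurable (field_measure M L)"
proof -
  let ?\<Omega> = "{0::real<..} \<times> {0::real<..<L} \<times> space M"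
  let ?G = "{{a<..b} \<times> B \<times> A | a b B A.
          0 \<le> a \<and> a \<le> b \<and> B \<in> sets borel \<and> B \<subseteq> {0<..<L} \<and> A \<in> sets (F a)}"
  have sp: "space (field_measure M L) = ?\<Omega>"
    by (simp add: field_measure_def space_pair_measure space_restrict_space)
  have sets: "A \<in> sets (F a) \<Longrightarrow> A \<in> sets M" for A a using sub[of a] by (auto simp: subalgebra_def)
  have G: "?G \<subseteq> sets (field_measure M L)"
  proof
    fix Q assume "Q \<in> ?G"
    then obtain a b B A where Q: "Q = {a<..b} \<times> B \<times> A" "0 \<le> a" "a \<le> b" "B \<in> sets borel"
      "B \<subseteq> {0<..<L}" "A \<in> sets (F a)" by blast
    show "Q \<in> sets (field_measure M L)"
      unfolding Q(1) field_measure_def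
      by (intro pair_measureI) (use Q sets in \<open>auto simp: sets_restrict_space_iff\<close>)
  qed
  have GP: "?G \<subseteq> Pow ?\<Omega>"
  proof
    fix Q assume "Q \<in> ?G"
    then have "Q \<in> sets (field_measure M L)" by (rule subsetD[OF G])
    from sets.sets_into_space[OF this] show "Q \<in> Pow ?\<Omega>" unfolding sp by (rule PowI)
  qed
  have "(\<lambda>x. x) \<in> measurable (field_measure M L) (predictable_sets M F L)"
    unfolding predictable_sets_def
  proof (rule measurable_measure_of[OF GP])
    show "(\<lambda>x. x) \<in> space (field_measure M L) \<rightarrow> ?\<Omega>" unfolding sp by (rule Pi_I)
    fix Q assume "Q \<in> ?G"
    then have "Q \<in> sets (field_measure M L)" by (rule subsetD[OF G])
    then show "(\<lambda>x. x) -` Q \<inter> space (field_measure M L) \<in> sets (field_measure M L)"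
      unfolding vimage_ident by (intro sets.Int sets.top)
  qed
  from measurable_compose[OF this f] show ?thesis .
qed

context white_noise
begin

text \<open>
  The isometry survives the limit by \<open>square_norm_limit_le\<close>, used in both directions, and the mean is \<open>0\<close> because
  it depends continuously on the integral in \<open>L\<^sup>2\<close>.
\<close>

lemma walsh_integral_moments:
  assumes wi: "has_walsh_integral M F L W \<Phi> Z"
  shows "Z \<in> borel_measurable M" "integrable M (\<lambda>\<omega>. (Z \<omega>)\<^sup>2)" "integrable M Z" "expectation Z = 0"
    and "(\<integral>\<^sup>+\<omega>. ennreal ((Z \<omega>)\<^sup>2) \<partial>M) = (\<integral>\<^sup>+(s, y, \<omega>). ennreal ((\<Phi> s y \<omega>)\<^sup>2) \<partial>field_measure M L)"
proof -
  obtain S where \<Phi>: "(\<lambda>(s, y, \<omega>). \<Phi> s y \<omega>) \<in> borel_measurable (predictable_sets M F L)"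
      "(\<integral>\<^sup>+(s, y, \<omega>). ennreal ((\<Phi> s y \<omega>)\<^sup>2) \<partial>field_measure M L) < \<infinity>"
    and Z[measurable]: "Z \<in> borel_measurable M"
    and S: "\<And>n. simple_field M F L (S n)"
    and lim\<Phi>: "(\<lambda>n. \<integral>\<^sup>+(s, y, \<omega>). ennreal ((\<Phi> s y \<omega> - simple_field_val (S n) s y \<omega>)\<^sup>2)
               \<partial>field_measure M L) \<longlonglongrightarrow> 0"
    and limZ: "(\<lambda>n. \<integral>\<^sup>+\<omega>. ennreal ((Z \<omega> - simple_field_integral W (S n) \<omega>)\<^sup>2) \<partial>M) \<longlonglongrightarrow> 0"
    using wi unfolding has_walsh_integral_def by auto
  show "Z \<in> borel_measurable M" by fact
  let ?N = "field_measure M L"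
  let ?I = "\<lambda>n. simple_field_integral W (S n)"
  let ?V = "\<lambda>n (s, y, \<omega>). simple_field_val (S n) s y \<omega>"
  let ?P = "\<lambda>(s, y, \<omega>). \<Phi> s y \<omega>"
  note iso = simple_field_isometry[OF S]
  have [measurable]: "?P \<in> borel_measurable ?N"
    by (rule predictable_measurable_field[OF subalgebra_F \<Phi>(1)])
  have I[measurable]: "?I n \<in> borel_measurable M" for n using iso(1) by auto
  have V[measurable]: "?V n \<in> borel_measurable ?N" for n by (rule iso(6))
  have eq: "(\<integral>\<^sup>+\<omega>. ennreal ((?I n \<omega>)\<^sup>2) \<partial>M) = (\<integral>\<^sup>+p. ennreal ((?V n p)\<^sup>2) \<partial>?N)" for n
  proof -
    have 1: "(\<integral>\<^sup>+\<omega>. ennreal ((?I n \<omega>)\<^sup>2) \<partial>M) = ennreal (expectation (\<lambda>\<omega>. (?I n \<omega>)\<^sup>2))"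
      by (rule nn_integral_eq_integral[OF iso(3)]) simp
    have "(\<integral>\<^sup>+p. ennreal (case p of (s, y, \<omega>) \<Rightarrow> (simple_field_val (S n) s y \<omega>)\<^sup>2) \<partial>?N) =
        ennreal (expectation (\<lambda>\<omega>. (?I n \<omega>)\<^sup>2))"
      unfolding iso(5) by (rule nn_integral_eq_integral[OF iso(4)]) auto
    with 1 show ?thesis by (simp add: case_prod_beta)
  qed
  have lim\<Phi>': "(\<lambda>n. \<integral>\<^sup>+p. ennreal ((?P p - ?V n p)\<^sup>2) \<partial>?N) \<longlonglongrightarrow> 0"
  proof -
    have "(\<lambda>p. ennreal ((?P p - ?V n p)\<^sup>2)) =
        (\<lambda>(s, y, \<omega>). ennreal ((\<Phi> s y \<omega> - simple_field_val (S n) s y \<omega>)\<^sup>2))" for n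
      by (rule ext) (simp split: prod.split)
    then show ?thesis using lim\<Phi> by (simp only:)
  qed
  have "(\<integral>\<^sup>+\<omega>. ennreal ((Z \<omega>)\<^sup>2) \<partial>M) = (\<integral>\<^sup>+p. ennreal ((?P p)\<^sup>2) \<partial>?N)"
  proof (rule antisym)
    show "(\<integral>\<^sup>+\<omega>. ennreal ((Z \<omega>)\<^sup>2) \<partial>M) \<le> (\<integral>\<^sup>+p. ennreal ((?P p)\<^sup>2) \<partial>?N)"
      by (rule square_norm_limit_le[of Z M ?I ?P ?N ?V]) (use eq limZ lim\<Phi>' in auto)
    show "(\<integral>\<^sup>+p. ennreal ((?P p)\<^sup>2) \<partial>?N) \<le> (\<integral>\<^sup>+\<omega>. ennreal ((Z \<omega>)\<^sup>2) \<partial>M)"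
      by (rule square_norm_limit_le[of ?P ?N ?V Z M ?I]) (use eq limZ lim\<Phi>' in auto)
  qed
  moreover have PP: "(\<lambda>p. ennreal ((?P p)\<^sup>2)) = (\<lambda>(s, y, \<omega>). ennreal ((\<Phi> s y \<omega>)\<^sup>2))"
    by (rule ext) (simp split: prod.split)
  ultimately show ZZ: "(\<integral>\<^sup>+\<omega>. ennreal ((Z \<omega>)\<^sup>2) \<partial>M) = (\<integral>\<^sup>+(s, y, \<omega>). ennreal ((\<Phi> s y \<omega>)\<^sup>2) \<partial>?N)"
    by (simp only:)
  show Z2: "integrable M (\<lambda>\<omega>. (Z \<omega>)\<^sup>2)"
    using ZZ \<Phi>(2) by (intro integrableI_bounded) auto
  show iZ: "integrable M Z" by (rule square_integrable_imp_integrable[OF Z Z2])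
  have le: "ennreal ((expectation Z)\<^sup>2) \<le> (\<integral>\<^sup>+\<omega>. ennreal ((Z \<omega> - ?I n \<omega>)\<^sup>2) \<partial>M)" for n
  proof -
    let ?Y = "\<lambda>\<omega>. Z \<omega> - ?I n \<omega>"
    have iY: "integrable M ?Y" using iZ iso(1)[of n] by simp
    have iY2: "integrable M (\<lambda>\<omega>. (?Y \<omega>)\<^sup>2)"
    proof (rule Bochner_Integration.integrable_bound)
      show "integrable M (\<lambda>\<omega>. 2 * (Z \<omega>)\<^sup>2 + 2 * (?I n \<omega>)\<^sup>2)" using Z2 iso(3)[of n] by simp
      have "(u - v)\<^sup>2 \<le> 2 * u\<^sup>2 + 2 * v\<^sup>2" for u v :: real
        using zero_le_power2[of "u + v"] by (simp add: power2_eq_square algebra_simps)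
      then show "AE \<omega> in M. norm ((?Y \<omega>)\<^sup>2) \<le> norm (2 * (Z \<omega>)\<^sup>2 + 2 * (?I n \<omega>)\<^sup>2)" by simp
    qed measurable
    have "(expectation ?Y)\<^sup>2 \<le> expectation (\<lambda>\<omega>. (?Y \<omega>)\<^sup>2)"
      using variance_eq[OF iY iY2] variance_positive[of ?Y] by simp
    moreover have "expectation ?Y = expectation Z" using iZ iso(1,2)[of n] by simp
    ultimately show ?thesis
      using iY2 by (subst nn_integral_eq_integral) (auto simp: ennreal_leI)
  qed
  have "ennreal ((expectation Z)\<^sup>2) \<le> 0"
    by (rule LIMSEQ_le_const[OF limZ]) (use le in auto)
  then show "expectation Z = 0" by (simp add: ennreal_eq_0_iff)
qed

end

section \<open>The Dirichlet heat kernel and its ground state\<close>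

lemma dirichlet_freq_Suc: "dirichlet_freq L n = real (Suc n) * dirichlet_freq L 0"
  by (simp add: dirichlet_freq_def)

lemma dirichlet_heat_kernel_sym: "dirichlet_heat_kernel L t x y = dirichlet_heat_kernel L t y x"
  by (simp add: dirichlet_heat_kernel_def mult_ac)

text \<open>
  The trace of the Dirichlet heat semigroup.  Since the sines are bounded by \<open>1\<close>, it controls the kernel uniformly in
  both points.
\<close>

definition dirichlet_trace :: "real \<Rightarrow> real \<Rightarrow> real" where
  "dirichlet_trace L t = (\<Sum>n. exp (- (dirichlet_freq L n)\<^sup>2 / 2 * t))"

lemma dirichlet_trace_summable:
  assumes "L > 0" "t > 0"
  shows "summable (\<lambda>n. exp (- (dirichlet_freq L n)\<^sup>2 / 2 * t))"
  using dirichlet_freq_summable[OF assms, of 0] by simp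

lemma kernel_term_bound:
  assumes "L > 0"
  shows "\<bar>2 / L * exp (- (dirichlet_freq L n)\<^sup>2 / 2 * t) * sin (dirichlet_freq L n * x) * sin (dirichlet_freq L n * y)\<bar>
    \<le> 2 / L * exp (- (dirichlet_freq L n)\<^sup>2 / 2 * t)"
proof -
  have "\<bar>sin (dirichlet_freq L n * x)\<bar> * \<bar>sin (dirichlet_freq L n * y)\<bar> \<le> 1" by (simp add: mult_le_one)
  then have "(2 / L * exp (- (dirichlet_freq L n)\<^sup>2 / 2 * t)) * (\<bar>sin (dirichlet_freq L n * x)\<bar> * \<bar>sin (dirichlet_freq L n * y)\<bar>)
      \<le> (2 / L * exp (- (dirichlet_freq L n)\<^sup>2 / 2 * t)) * 1"
    using assms by (intro mult_left_mono) auto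
  then show ?thesis using assms by (simp add: abs_mult mult.assoc)
qed

lemma kernel_summable:
  assumes "L > 0" "t > 0"
  shows "summable (\<lambda>n. 2 / L * exp (- (dirichlet_freq L n)\<^sup>2 / 2 * t) * sin (dirichlet_freq L n * x) * sin (dirichlet_freq L n * y))"
  by (rule summable_comparison_test'[OF summable_mult[OF dirichlet_trace_summable[OF assms], of "2 / L"]])
    (use kernel_term_bound[OF assms(1)] in simp)

lemma dirichlet_heat_kernel_abs_le:
  assumes "L > 0" "t > 0"
  shows "\<bar>dirichlet_heat_kernel L t x y\<bar> \<le> 2 / L * dirichlet_trace L t"
  unfolding dirichlet_heat_kernel_def dirichlet_trace_def
  unfolding suminf_mult[OF dirichlet_trace_summable[OF assms], symmetric] real_norm_def[symmetric]
  by (rule norm_suminf_le) (use kernel_term_bound[OF assms(1)] summable_mult[OF dirichlet_trace_summable[OF assms]] in auto)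

text \<open>
  The kernel is differentiable in its first point, and it is symmetric.
\<close>

lemma dirichlet_heat_kernel_continuous:
  assumes "L > 0" "t > 0"
  shows "continuous_on A (\<lambda>y. dirichlet_heat_kernel L t x y)"
proof -
  obtain p1 where "\<And>y. ((\<lambda>y. dirichlet_heat_kernel L t y x) has_real_derivative p1 y) (at y)"
    by (rule dirichlet_heat_kernel_heat_equation[OF assms, of x]) metis
  then have "continuous_on A (\<lambda>y. dirichlet_heat_kernel L t y x)"
    by (intro continuous_at_imp_continuous_on ballI DERIV_isCont) auto
  then show ?thesis by (simp add: dirichlet_heat_kernel_sym[of L t x])
qed

lemma nn_integral_open_interval:
  fixes h :: "real \<Rightarrow> real"
  assumes h: "(h has_integral I) {a..b}" and nn: "\<And>y. 0 \<le> h y" and m: "h \<in> borel_measurable borel"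
  shows "(\<integral>\<^sup>+y\<in>{a<..<b}. ennreal (h y) \<partial>lborel) = ennreal I"
proof -
  have "(h has_integral I) {a<..<b}"
    using h has_integral_open_interval[of h I a b] by simp
  from nn_integral_has_integral_lebesgue[OF _ this] nn
  have "integral\<^sup>N lborel (\<lambda>x. indicator {a<..<b} x * h x) = I" by auto
  then show ?thesis by (simp add: ennreal_mult'' nn mult.commute ennreal_indicator)
qed

text \<open>
  By Parseval's identity the left hand side is \<open>p(2t,x,x)\<close>.  It suffices to integrate \<open>p\<close> against the partial sums of
  its own series, where the eigenfunction property of the kernel evaluates each term, and to pass to the limit uniformly.
\<close>

lemma kernel_square_integral_le:
  assumes L: "L > 0" and t: "t > 0"
  shows "(\<integral>\<^sup>+y\<in>{0<..<L}. ennreal ((dirichlet_heat_kernel L t x y)\<^sup>2) \<partial>lborel)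
    \<le> ennreal (2 / L * dirichlet_trace L (2 * t))"
proof -
  let ?w = "dirichlet_freq L" and ?p = "dirichlet_heat_kernel L t x"
  let ?C = "2 / L * dirichlet_trace L t"
  let ?c = "\<lambda>n. 2 / L * exp (- (?w n)\<^sup>2 / 2 * t)"
  define f where "f n y = ?c n * sin (?w n * x) * sin (?w n * y)" for n y
  have C: "\<bar>?p y\<bar> \<le> ?C" for y by (rule dirichlet_heat_kernel_abs_le[OF L t])
  have p: "?p y = (\<Sum>n. f n y)" for y by (simp add: dirichlet_heat_kernel_def f_def)
  have lim: "uniform_limit {0..L} (\<lambda>N y. \<Sum>n<N. ?p y * f n y) (\<lambda>y. \<Sum>n. ?p y * f n y) sequentially"
  proof (rule Weierstrass_m_test)
    show "norm (?p y * f n y) \<le> ?C * ?c n" for n y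
      using mult_mono[OF C[of y] kernel_term_bound[OF L, of n t x y]] C[of y]
      by (auto simp: abs_mult f_def)
    show "summable (\<lambda>n. ?C * ?c n)"
      by (intro summable_mult dirichlet_trace_summable L t)
  qed
  have eq: "(\<Sum>n. ?p y * f n y) = ?p y * ?p y" for y
    using suminf_mult[of "\<lambda>n. f n y" "?p y"] kernel_summable[OF L t, of x y] by (simp add: p f_def)
  let ?J = "\<lambda>n. 2 / L * (exp (- (?w n)\<^sup>2 / 2 * t) * sin (?w n * x))\<^sup>2"
  have int: "((\<lambda>y. \<Sum>n<N. ?p y * f n y) has_integral (\<Sum>n<N. ?J n)) {0..L}" for N
  proof (rule has_integral_sum)
    fix n
    have "((\<lambda>y. ?c n * sin (?w n * x) * (?p y * sin (?w n * y))) has_integral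
       ?c n * sin (?w n * x) * (exp (- (?w n)\<^sup>2 / 2 * t) * sin (?w n * x))) {0..L}"
      by (intro has_integral_mult_right dirichlet_heat_kernel_eigenfunction L t)
    then show "((\<lambda>y. ?p y * f n y) has_integral ?J n) {0..L}"
      by (simp add: f_def power2_eq_square mult_ac)
  qed simp
  obtain I J where I: "\<And>N. ((\<lambda>y. \<Sum>n<N. ?p y * f n y) has_integral I N) {0..L}"
    and J: "((\<lambda>y. \<Sum>n. ?p y * f n y) has_integral J) {0..L}" and IJ: "I \<longlonglongrightarrow> J"
  proof (rule uniform_limit_integral[OF lim])
    show "continuous_on {0..L} (\<lambda>y. \<Sum>n<N. ?p y * f n y)" for N
      unfolding f_def by (intro continuous_intros dirichlet_heat_kernel_continuous L t)
  qed (simp, blast)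
  have "I N \<le> 2 / L * dirichlet_trace L (2 * t)" for N
  proof -
    have "I N = (\<Sum>n<N. ?J n)" using I int by (rule has_integral_unique)
    also have "\<dots> \<le> (\<Sum>n<N. 2 / L * exp (- (?w n)\<^sup>2 / 2 * (2 * t)))"
    proof (rule sum_mono)
      fix n
      have "exp (- (?w n)\<^sup>2 / 2 * (2 * t)) = (exp (- (?w n)\<^sup>2 / 2 * t))\<^sup>2"
        by (simp add: power2_eq_square exp_add[symmetric])
      moreover have "(sin (?w n * x))\<^sup>2 \<le> 1" by (simp add: abs_square_le_1)
      ultimately show "?J n \<le> 2 / L * exp (- (?w n)\<^sup>2 / 2 * (2 * t))"
        using L by (auto simp: power_mult_distrib intro!: divide_right_mono mult_left_le)
    qed
    also have "\<dots> \<le> (\<Sum>n. 2 / L * exp (- (?w n)\<^sup>2 / 2 * (2 * t)))"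
      using L t by (intro sum_le_suminf summable_mult dirichlet_trace_summable) auto
    also have "\<dots> = 2 / L * dirichlet_trace L (2 * t)"
      unfolding dirichlet_trace_def using L t by (intro suminf_mult dirichlet_trace_summable) auto
    finally show ?thesis .
  qed
  then have JC: "J \<le> 2 / L * dirichlet_trace L (2 * t)"
    using IJ by (intro LIMSEQ_le_const2) auto
  have "?p \<in> borel_measurable borel"
    by (rule borel_measurable_continuous_onI[OF dirichlet_heat_kernel_continuous[OF L t]])
  then have "(\<integral>\<^sup>+y\<in>{0<..<L}. ennreal ((?p y)\<^sup>2) \<partial>lborel) = ennreal J"
    using J by (intro nn_integral_open_interval) (auto simp: eq power2_eq_square)
  then show ?thesis using JC by (simp add: ennreal_leI)
qed

text \<open>
  Cauchy-Schwarz: the integral of \<open>g = p(t,y,.) \<phi>\<close> over \<open>[0,L]\<close> is \<open>m = exp (-c t/2) \<phi>(y)\<close>, as \<open>\<phi>\<close> is an eigenfunction, so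
  the integral of \<open>g\<^sup>2\<close> is at least \<open>m\<^sup>2/L\<close>.
\<close>

lemma kernel_ground_state_square_integral:
  assumes L: "L > 0" and t: "t > 0"
  shows "ennreal (exp (- (dirichlet_freq L 0)\<^sup>2 * t) * (sin (dirichlet_freq L 0 * y))\<^sup>2 / L) \<le>
    (\<integral>\<^sup>+x\<in>{0<..<L}. ennreal ((dirichlet_heat_kernel L t x y)\<^sup>2 * (sin (dirichlet_freq L 0 * x))\<^sup>2) \<partial>lborel)"
proof -
  let ?w = "dirichlet_freq L 0"
  let ?g = "\<lambda>x. dirichlet_heat_kernel L t y x * sin (?w * x)"
  define m where "m = exp (- ?w\<^sup>2 / 2 * t) * sin (?w * y)"
  have g: "(?g has_integral m) {0..L}"
    unfolding m_def by (rule dirichlet_heat_kernel_eigenfunction[OF L t])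
  have cont: "continuous_on A ?g" for A
    by (intro continuous_intros dirichlet_heat_kernel_continuous L t)
  obtain J where J: "((\<lambda>x. (?g x)\<^sup>2) has_integral J) {0..L}"
    using integrable_continuous_interval[of 0 L "\<lambda>x. (?g x)\<^sup>2"] continuous_on_power[OF cont, of "{0..L}" 2]
    by (auto simp: integrable_on_def)
  have "((\<lambda>x. (?g x)\<^sup>2 - 2 * (m / L) * ?g x + (m / L)\<^sup>2) has_integral
      J - 2 * (m / L) * m + (m / L)\<^sup>2 * L) {0..L}"
    using has_integral_const_real[of "(m / L)\<^sup>2" 0 L] L
    by (intro has_integral_add has_integral_diff J has_integral_mult_right g) (simp_all add: mult.commute)
  moreover have "0 \<le> (?g x)\<^sup>2 - 2 * (m / L) * ?g x + (m / L)\<^sup>2" for x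
    using zero_le_power2[of "?g x - m / L"] by (simp add: power2_eq_square algebra_simps)
  ultimately have "0 \<le> J - 2 * (m / L) * m + (m / L)\<^sup>2 * L"
    by (rule has_integral_nonneg)
  then have "m\<^sup>2 / L \<le> J"
    using L by (simp add: power2_eq_square field_simps)
  moreover have "m\<^sup>2 / L = exp (- ?w\<^sup>2 * t) * (sin (?w * y))\<^sup>2 / L"
    by (simp add: m_def power_mult_distrib power2_eq_square[of "exp _"] exp_add[symmetric])
  moreover have "(\<integral>\<^sup>+x\<in>{0<..<L}. ennreal ((?g x)\<^sup>2) \<partial>lborel) = ennreal J"
    by (rule nn_integral_open_interval[OF J])
      (use borel_measurable_continuous_onI[OF continuous_on_power[OF cont]] in auto)
  ultimately show ?thesis
    by (simp add: power_mult_distrib dirichlet_heat_kernel_sym[of L t y] ennreal_leI)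
qed

lemma abs_sin_multiple_le: "\<bar>sin (real n * x)\<bar> \<le> real n * \<bar>sin x\<bar>"
proof (induction n)
  case (Suc n)
  have "\<bar>sin (real (Suc n) * x)\<bar> = \<bar>sin (real n * x) * cos x + cos (real n * x) * sin x\<bar>"
  proof -
    have "real (Suc n) * x = real n * x + x" by (simp add: distrib_right)
    then show ?thesis by (simp only: sin_add)
  qed
  also have "\<dots> \<le> \<bar>sin (real n * x)\<bar> * 1 + 1 * \<bar>sin x\<bar>"
    by (rule order.trans[OF abs_triangle_ineq]) (auto simp: abs_mult intro!: add_mono mult_mono mult_left_le mult_left_le_one_le)
  finally show ?case using Suc by (simp add: distrib_right)
qed simp

text \<open>
  All exponents are at least the lowest one, so a factor with the lowest exponent can be split off after time \<open>1\<close>.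
\<close>

lemma dirichlet_trace_decay:
  assumes L: "L > 0" and t: "t \<ge> 1"
  shows "dirichlet_trace L t \<le> exp (- (dirichlet_freq L 0)\<^sup>2 / 2 * (t - 1)) * dirichlet_trace L 1"
proof -
  let ?w = "dirichlet_freq L"
  have "exp (- (?w n)\<^sup>2 / 2 * t) \<le> exp (- (?w 0)\<^sup>2 / 2 * (t - 1)) * exp (- (?w n)\<^sup>2 / 2 * 1)" for n
  proof -
    have "?w 0 \<le> ?w n" using L by (simp add: dirichlet_freq_def divide_right_mono)
    then have "(?w 0)\<^sup>2 \<le> (?w n)\<^sup>2" using dirichlet_freq_pos[OF L, of 0] by (intro power_mono) auto
    then have "(?w 0)\<^sup>2 * (t - 1) \<le> (?w n)\<^sup>2 * (t - 1)" using t by (intro mult_right_mono) auto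
    then have "- (?w n)\<^sup>2 / 2 * t \<le> - (?w 0)\<^sup>2 / 2 * (t - 1) + - (?w n)\<^sup>2 / 2 * 1"
      by (simp add: field_simps)
    then show ?thesis by (simp only: exp_add[symmetric] exp_le_cancel_iff)
  qed
  then have "dirichlet_trace L t \<le> (\<Sum>n. exp (- (?w 0)\<^sup>2 / 2 * (t - 1)) * exp (- (?w n)\<^sup>2 / 2 * 1))"
    unfolding dirichlet_trace_def
  proof (rule suminf_le)
    show "summable (\<lambda>n. exp (- (?w n)\<^sup>2 / 2 * t))" using L t by (intro dirichlet_trace_summable) auto
    show "summable (\<lambda>n. exp (- (?w 0)\<^sup>2 / 2 * (t - 1)) * exp (- (?w n)\<^sup>2 / 2 * 1))"
      using L by (intro summable_mult dirichlet_trace_summable) auto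
  qed
  also have "\<dots> = exp (- (?w 0)\<^sup>2 / 2 * (t - 1)) * dirichlet_trace L 1"
    unfolding dirichlet_trace_def using L by (intro suminf_mult dirichlet_trace_summable) simp_all
  finally show ?thesis .
qed

lemma sin_ground_pos: "L > 0 \<Longrightarrow> 0 < x \<Longrightarrow> x < L \<Longrightarrow> 0 < sin (dirichlet_freq L 0 * x)"
  by (rule sin_gt_zero) (auto simp: dirichlet_freq_def field_simps)

lemma sin_ground_nonneg: "L > 0 \<Longrightarrow> 0 \<le> x \<Longrightarrow> x \<le> L \<Longrightarrow> 0 \<le> sin (dirichlet_freq L 0 * x)"
  by (rule sin_ge_zero) (auto simp: dirichlet_freq_def field_simps)

text \<open>
  For large times the first term of the series dominates the others uniformly up to the boundary: by
  \<open>abs_sin_multiple_le\<close> the term of index \<open>n\<close> is at most \<open>(2/L) (n+1)\<^sup>2 \<phi>(x) \<phi>(y)\<close> times its exponential factor, so all terms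
  vanish at the boundary at the rate of the first one.
\<close>

lemma kernel_ground_state_lower:
  assumes L: "L > 0"
  obtains r0 where "r0 \<ge> 1" "\<And>t x y. r0 \<le> t \<Longrightarrow> x \<in> {0..L} \<Longrightarrow> y \<in> {0..L} \<Longrightarrow>
    exp (- (dirichlet_freq L 0)\<^sup>2 / 2 * t) * sin (dirichlet_freq L 0 * x) * sin (dirichlet_freq L 0 * y) / L
      \<le> dirichlet_heat_kernel L t x y"
proof -
  let ?w = "dirichlet_freq L" and ?e = "\<lambda>n t. exp (- (dirichlet_freq L n)\<^sup>2 / 2 * t)"
  let ?\<phi> = "\<lambda>x. sin (dirichlet_freq L 0 * x)"
  define c where "c = (?w 0)\<^sup>2"
  have c: "c > 0" using dirichlet_freq_pos[OF L, of 0] by (simp add: c_def)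
  have wc: "(?w n)\<^sup>2 = (real (Suc n))\<^sup>2 * c" for n
    by (subst dirichlet_freq_Suc) (simp only: power_mult_distrib c_def)
  define a where "a n = (real (Suc (Suc n)))\<^sup>2 * ?e (Suc n) 1" for n
  have sma: "summable a"
  proof -
    have "summable (\<lambda>n. (?w n)\<^sup>2 * ?e n 1 / c)"
      by (intro summable_divide dirichlet_freq_summable L) simp
    also have "(\<lambda>n. (?w n)\<^sup>2 * ?e n 1 / c) = (\<lambda>n. (real (Suc n))\<^sup>2 * ?e n 1)"
      using c by (simp add: wc fun_eq_iff)
    finally show ?thesis
      unfolding a_def by (rule summable_Suc_iff[THEN iffD2])
  qed
  define A where "A = suminf a"
  \<comment> \<open>The terms after the first decay at least like \<open>exp (-2 c (t-1))\<close>, which is \<open>exp (-c t/2)\<close> times this exponential.\<close>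
  have "((\<lambda>t. exp (2 * c - 3 / 2 * c * t)) \<longlongrightarrow> 0) at_top"
    using c by real_asymp
  then have "((\<lambda>t. 2 * A * exp (2 * c - 3 / 2 * c * t)) \<longlongrightarrow> 0) at_top"
    by (rule tendsto_mult_right_zero)
  then have "eventually (\<lambda>t. 2 * A * exp (2 * c - 3 / 2 * c * t) < 1) at_top"
    by (rule order_tendstoD) simp
  then obtain r where r: "\<And>t. r \<le> t \<Longrightarrow> 2 * A * exp (2 * c - 3 / 2 * c * t) < 1"
    by (auto simp: eventually_at_top_linorder)
  show thesis
  proof (rule that[of "max 1 r"])
    fix t x y assume t: "max 1 r \<le> t" and x: "x \<in> {0..L}" and y: "y \<in> {0..L}"
    have t1: "1 \<le> t" "0 < t" using t by auto
    let ?F = "?\<phi> x * ?\<phi> y"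
    have F: "0 \<le> ?F" using sin_ground_nonneg[OF L] x y by simp
    define f where "f n = 2 / L * ?e n t * sin (?w n * x) * sin (?w n * y)" for n
    have smf: "summable f" unfolding f_def by (rule kernel_summable[OF L t1(2)])
    have term_le: "norm (f (Suc n)) \<le> 2 / L * exp (- 2 * c * (t - 1)) * ?F * a n" for n
    proof -
      have s: "\<bar>sin (?w (Suc n) * z)\<bar> \<le> real (Suc (Suc n)) * ?\<phi> z" if "z \<in> {0..L}" for z
        using abs_sin_multiple_le[of "Suc (Suc n)" "?w 0 * z"] sin_ground_nonneg[OF L, of z] that
        by (subst dirichlet_freq_Suc) (simp add: mult.assoc)
      have ss: "\<bar>sin (?w (Suc n) * x)\<bar> * \<bar>sin (?w (Suc n) * y)\<bar> \<le> (real (Suc (Suc n)))\<^sup>2 * ?F"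
        using mult_mono[OF s[OF x] s[OF y]] sin_ground_nonneg[OF L, of x] x
        by (simp add: power2_eq_square mult_ac)
      have "4 * c \<le> (?w (Suc n))\<^sup>2"
      proof -
        have "2\<^sup>2 \<le> (real (Suc (Suc n)))\<^sup>2" by (intro power_mono) auto
        then show ?thesis using c mult_right_mono[of 4 "(real (Suc (Suc n)))\<^sup>2" c] by (simp add: wc)
      qed
      then have "4 * c * (t - 1) \<le> (?w (Suc n))\<^sup>2 * (t - 1)" using t1 by (intro mult_right_mono) auto
      then have "?e (Suc n) t \<le> exp (- 2 * c * (t - 1)) * ?e (Suc n) 1"
        by (simp add: exp_add[symmetric] algebra_simps)
      then have "2 / L * ?e (Suc n) t * (\<bar>sin (?w (Suc n) * x)\<bar> * \<bar>sin (?w (Suc n) * y)\<bar>)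
          \<le> 2 / L * (exp (- 2 * c * (t - 1)) * ?e (Suc n) 1) * ((real (Suc (Suc n)))\<^sup>2 * ?F)"
        by (rule mult_mono[OF mult_left_mono ss]) (use L in auto)
      then show ?thesis using L by (simp add: f_def a_def abs_mult mult_ac)
    qed
    have "\<bar>\<Sum>n. f (Suc n)\<bar> \<le> (\<Sum>n. 2 / L * exp (- 2 * c * (t - 1)) * ?F * a n)"
      unfolding real_norm_def[symmetric]
      by (rule norm_suminf_le[OF term_le]) (intro summable_mult sma)
    also have "\<dots> = 2 / L * exp (- 2 * c * (t - 1)) * ?F * A"
      unfolding A_def by (rule suminf_mult[OF sma])
    also have "\<dots> = (1 / L * ?F * exp (- c / 2 * t)) * (2 * A * exp (2 * c - 3 / 2 * c * t))"
    proof -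
      have "exp (- 2 * c * (t - 1)) = exp (- c / 2 * t) * exp (2 * c - 3 / 2 * c * t)"
        by (simp add: exp_add[symmetric] algebra_simps)
      then show ?thesis by (simp only:) (simp add: mult_ac)
    qed
    also have "\<dots> \<le> (1 / L * ?F * exp (- c / 2 * t)) * 1"
      using r[of t] t F L by (intro mult_left_mono) auto
    finally have tail: "\<bar>\<Sum>n. f (Suc n)\<bar> \<le> 1 / L * ?F * exp (- c / 2 * t)" by simp
    have "dirichlet_heat_kernel L t x y = (\<Sum>n. f n)" by (simp add: dirichlet_heat_kernel_def f_def)
    also have "\<dots> = f 0 + (\<Sum>n. f (Suc n))" using suminf_split_head[OF smf] by simp
    also have "f 0 = 2 * (1 / L * ?F * exp (- c / 2 * t))" by (simp add: f_def c_def)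
    finally have "1 / L * ?F * exp (- c / 2 * t) \<le> dirichlet_heat_kernel L t x y"
      using tail by linarith
    then show "exp (- (?w 0)\<^sup>2 / 2 * t) * ?\<phi> x * ?\<phi> y / L \<le> dirichlet_heat_kernel L t x y"
      by (simp add: c_def mult_ac)
  qed simp
qed

text \<open>
  The trace of the resolvent at \<open>\<beta>\<close> of \<open>-d\<^sup>2/dx\<^sup>2\<close> with Dirichlet conditions, whose eigenvalues are \<open>(n \<pi>/L)\<^sup>2\<close>.  It is
  the Laplace transform of the trace of the semigroup at doubled time.
\<close>

definition trace_resolvent :: "real \<Rightarrow> real \<Rightarrow> real" where
  "trace_resolvent L \<beta> = (\<Sum>n. 1 / ((dirichlet_freq L n)\<^sup>2 - \<beta>))"

lemma trace_resolvent_summable: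
  assumes L: "L > 0" and \<beta>: "\<beta> < (dirichlet_freq L 0)\<^sup>2"
  shows "summable (\<lambda>n. 1 / ((dirichlet_freq L n)\<^sup>2 - \<beta>))"
    and "\<And>n. 0 < (dirichlet_freq L n)\<^sup>2 - \<beta>"
proof -
  let ?w = "dirichlet_freq L"
  show pos: "0 < (?w n)\<^sup>2 - \<beta>" for n
  proof -
    have "?w 0 \<le> ?w n" using L by (simp add: dirichlet_freq_def divide_right_mono)
    then have "(?w 0)\<^sup>2 \<le> (?w n)\<^sup>2" using dirichlet_freq_pos[OF L, of 0] by (intro power_mono) auto
    with \<beta> show ?thesis by simp
  qed
  define c where "c = pi / L"
  have c: "c > 0" using L by (simp add: c_def)
  show "summable (\<lambda>n. 1 / ((?w n)\<^sup>2 - \<beta>))"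
  proof (rule summable_comparison_test_bigo)
    show "summable (\<lambda>n. norm (inverse (real n ^ 2)))"
      using inverse_power_summable[of 2, where ?'a=real] by simp
    have "(\<lambda>n. 1 / ((real (Suc n) * c)\<^sup>2 - \<beta>)) \<in> O(\<lambda>n. inverse (real n ^ 2))"
      using c by real_asymp
    then show "(\<lambda>n. 1 / ((?w n)\<^sup>2 - \<beta>)) \<in> O(\<lambda>n. inverse (real n ^ 2))"
      by (simp add: dirichlet_freq_def c_def)
  qed
qed

lemma trace_laplace:
  assumes L: "L > 0" and \<beta>: "\<beta> < (dirichlet_freq L 0)\<^sup>2"
  shows "(\<integral>\<^sup>+r\<in>{0<..}. ennreal (exp (\<beta> * r) * (2 / L * dirichlet_trace L (2 * r))) \<partial>lborel)
    \<le> ennreal (2 / L * trace_resolvent L \<beta>)"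
proof -
  let ?w = "dirichlet_freq L"
  note pos = trace_resolvent_summable(2)[OF L \<beta>]
  let ?h = "\<lambda>n r. 2 / L * exp (- ((?w n)\<^sup>2 - \<beta>) * r)"
  have "(\<integral>\<^sup>+r\<in>{0<..}. ennreal (exp (\<beta> * r) * (2 / L * dirichlet_trace L (2 * r))) \<partial>lborel)
      \<le> (\<integral>\<^sup>+r. (\<Sum>n. indicator {0..} r * ennreal (?h n r)) \<partial>lborel)"
  proof (rule nn_integral_mono)
    fix r :: real
    show "ennreal (exp (\<beta> * r) * (2 / L * dirichlet_trace L (2 * r))) * indicator {0<..} r
        \<le> (\<Sum>n. indicator {0..} r * ennreal (?h n r))"
    proof (cases "r > 0")
      case True
      then have sm: "summable (\<lambda>n. exp (- (?w n)\<^sup>2 / 2 * (2 * r)))"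
        using dirichlet_trace_summable[OF L, of "2 * r"] by simp
      have h: "?h n r = (exp (\<beta> * r) * (2 / L)) * exp (- (?w n)\<^sup>2 / 2 * (2 * r))" for n
        by (simp add: exp_add[symmetric] algebra_simps)
      have "exp (\<beta> * r) * (2 / L * dirichlet_trace L (2 * r)) = (\<Sum>n. ?h n r)"
        unfolding h dirichlet_trace_def suminf_mult[OF sm] by (simp only: mult.assoc)
      moreover have "summable (\<lambda>n. ?h n r)" unfolding h by (intro summable_mult sm)
      ultimately show ?thesis
        using True L by (simp add: suminf_ennreal2)
    qed simp
  qed
  also have "\<dots> = (\<Sum>n. \<integral>\<^sup>+r. indicator {0..} r * ennreal (?h n r) \<partial>lborel)"
    by (rule nn_integral_suminf) measurable
  also have "\<dots> = (\<Sum>n. ennreal (2 / L * (1 / ((?w n)\<^sup>2 - \<beta>))))"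
  proof (rule suminf_cong)
    fix n
    have "(?h n has_integral 2 / L * (exp (- ((?w n)\<^sup>2 - \<beta>) * 0) / ((?w n)\<^sup>2 - \<beta>))) {0..}"
      using has_integral_exp_minus_to_infinity[OF pos[of n], of 0] by (intro has_integral_mult_right)
    from nn_integral_has_integral_lebesgue[OF _ this] L
    have "(\<integral>\<^sup>+r. ennreal (indicator {0..} r * ?h n r) \<partial>lborel) = ennreal (2 / L * (1 / ((?w n)\<^sup>2 - \<beta>)))"
      by simp
    moreover have "(\<integral>\<^sup>+r. indicator {0..} r * ennreal (?h n r) \<partial>lborel) = (\<integral>\<^sup>+r. ennreal (indicator {0..} r * ?h n r) \<partial>lborel)"
      by (intro nn_integral_cong) (simp split: split_indicator)
    ultimately show "(\<integral>\<^sup>+r. indicator {0..} r * ennreal (?h n r) \<partial>lborel) = ennreal (2 / L * (1 / ((?w n)\<^sup>2 - \<beta>)))"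
      by simp
  qed
  also have "\<dots> = ennreal (2 / L * trace_resolvent L \<beta>)"
  proof -
    have "(\<Sum>n. ennreal (2 / L * (1 / ((?w n)\<^sup>2 - \<beta>)))) = ennreal (\<Sum>n. 2 / L * (1 / ((?w n)\<^sup>2 - \<beta>)))"
      using L less_imp_le[OF pos]
      by (intro suminf_ennreal2 summable_mult trace_resolvent_summable(1) \<beta> mult_nonneg_nonneg) auto
    then show ?thesis
      unfolding trace_resolvent_def by (simp only: suminf_mult[OF trace_resolvent_summable(1)[OF L \<beta>]])
  qed
  finally show ?thesis .
qed

text \<open>
  Tannery's theorem, with the summable majorant given by \<open>\<beta> = 0\<close>.
\<close>

lemma trace_resolvent_tendsto_0:
  assumes L: "L > 0"
  shows "((\<lambda>b. trace_resolvent L (- b)) \<longlongrightarrow> 0) at_top"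
proof -
  let ?w = "dirichlet_freq L"
  have w: "0 < (?w n)\<^sup>2" for n using dirichlet_freq_pos[OF L, of n] by simp
  have "((\<lambda>b. \<Sum>n. 1 / ((?w n)\<^sup>2 - - b)) \<longlongrightarrow> (\<Sum>n. 0)) at_top"
  proof (rule tannerys_theorem[THEN conjunct2, THEN conjunct2])
    show "\<forall>\<^sub>F (n, b) in at_top \<times>\<^sub>F at_top. norm (1 / ((?w n)\<^sup>2 - - b)) \<le> 1 / ((?w n)\<^sup>2 - 0)"
    proof -
      have "\<forall>\<^sub>F p :: nat \<times> real in at_top \<times>\<^sub>F at_top. 0 \<le> snd p"
        using eventually_prod2[of sequentially "\<lambda>b::real. 0 \<le> b" at_top] eventually_ge_at_top[of 0]
        by (simp add: case_prod_unfold)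
      then show ?thesis
        by (rule eventually_mono) (use w in \<open>auto simp: abs_of_pos add_pos_nonneg intro!: divide_left_mono mult_pos_pos\<close>)
    qed
    show "summable (\<lambda>n. 1 / ((?w n)\<^sup>2 - 0))" using w by (intro trace_resolvent_summable(1) L) auto
    show "((\<lambda>b. 1 / ((?w n)\<^sup>2 - - b)) \<longlongrightarrow> 0) at_top" for n
      by real_asymp
  qed simp
  then show ?thesis by (simp add: trace_resolvent_def)
qed

section \<open>The renewal equation for the second moment\<close>

text \<open>
  For \<open>f = E|u|\<^sup>2\<close> this is, by the isometry, the second moment of the stochastic integral of the mild equation with
  \<open>\<sigma>(z) = z\<close> and \<open>\<lambda> = 1\<close>.
\<close>

definition volterra :: "real \<Rightarrow> (real \<Rightarrow> real \<Rightarrow> ennreal) \<Rightarrow> real \<Rightarrow> real \<Rightarrow> ennreal" where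
  "volterra L f t x =
     (\<integral>\<^sup>+s\<in>{0<..<t}. (\<integral>\<^sup>+y\<in>{0<..<L}. ennreal ((dirichlet_heat_kernel L (t - s) x y)\<^sup>2) * f s y \<partial>lborel) \<partial>lborel)"

lemma volterra_mono:
  assumes "\<And>s y. 0 < s \<Longrightarrow> s < t \<Longrightarrow> 0 < y \<Longrightarrow> y < L \<Longrightarrow> f s y \<le> g s y"
  shows "volterra L f t x \<le> volterra L g t x"
  unfolding volterra_def
proof (rule nn_integral_mono)
  fix s :: real
  have "(\<integral>\<^sup>+y\<in>{0<..<L}. ennreal ((dirichlet_heat_kernel L (t - s) x y)\<^sup>2) * f s y \<partial>lborel)
      \<le> (\<integral>\<^sup>+y\<in>{0<..<L}. ennreal ((dirichlet_heat_kernel L (t - s) x y)\<^sup>2) * g s y \<partial>lborel)"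
    if "0 < s" "s < t"
    using assms[OF that] by (intro nn_integral_mono) (auto split: split_indicator intro!: mult_left_mono)
  then show "(\<integral>\<^sup>+y\<in>{0<..<L}. ennreal ((dirichlet_heat_kernel L (t - s) x y)\<^sup>2) * f s y \<partial>lborel)
        * indicator {0<..<t} s
      \<le> (\<integral>\<^sup>+y\<in>{0<..<L}. ennreal ((dirichlet_heat_kernel L (t - s) x y)\<^sup>2) * g s y \<partial>lborel)
        * indicator {0<..<t} s"
    by (auto split: split_indicator)
qed

lemma measurable_dirichlet_heat_kernel[measurable]:
  assumes [measurable]: "a \<in> borel_measurable N" "b \<in> borel_measurable N" "c \<in> borel_measurable N"
  shows "(\<lambda>q. dirichlet_heat_kernel L (a q) (b q) (c q)) \<in> borel_measurable N"
  unfolding dirichlet_heat_kernel_def by measurable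

definition initial_flow :: "real \<Rightarrow> (real \<Rightarrow> real) \<Rightarrow> real \<Rightarrow> real \<Rightarrow> real" where
  "initial_flow L u0 t x = (LINT y:{0..L}|lebesgue. u0 y * dirichlet_heat_kernel L t x y)"

context white_noise
begin

lemma field_measure_nn_integral:
  assumes h: "(\<lambda>(s, y, \<omega>). h s y \<omega>) \<in> borel_measurable (field_measure M L)"
  shows "(\<integral>\<^sup>+(s, y, \<omega>). h s y \<omega> \<partial>field_measure M L) =
    (\<integral>\<^sup>+s\<in>{0<..}. (\<integral>\<^sup>+y\<in>{0<..<L}. (\<integral>\<^sup>+\<omega>. h s y \<omega> \<partial>M) \<partial>lborel) \<partial>lborel)"
proof -
  let ?T = "restrict_space lborel {0::real<..}" and ?S = "restrict_space lborel {0::real<..<L}"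
  interpret T: sigma_finite_measure ?T
    by (rule sigma_finite_measure_restrict_space) (auto intro: lborel.sigma_finite_measure_axioms)
  interpret S: sigma_finite_measure ?S
    by (rule sigma_finite_measure_restrict_space) (auto intro: lborel.sigma_finite_measure_axioms)
  interpret SM: pair_sigma_finite ?S M ..
  have h': "(\<lambda>(s, q). case q of (y, \<omega>) \<Rightarrow> h s y \<omega>) \<in> borel_measurable (?T \<Otimes>\<^sub>M (?S \<Otimes>\<^sub>M M))"
    using h by (simp only: field_measure_def)
  have sec: "(\<lambda>(y, \<omega>). h s y \<omega>) \<in> borel_measurable (?S \<Otimes>\<^sub>M M)" if "s > 0" for s
    using measurable_compose[OF measurable_Pair1'[of s ?T "?S \<Otimes>\<^sub>M M"] h'] that
    by (simp add: space_restrict_space)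
  have "(\<integral>\<^sup>+(s, y, \<omega>). h s y \<omega> \<partial>field_measure M L) =
      (\<integral>\<^sup>+s. (\<integral>\<^sup>+q. (case q of (y, \<omega>) \<Rightarrow> h s y \<omega>) \<partial>(?S \<Otimes>\<^sub>M M)) \<partial>?T)"
    unfolding field_measure_def using SM.nn_integral_fst[OF h', symmetric] by (simp only: prod.case)
  also have "\<dots> = (\<integral>\<^sup>+s. (\<integral>\<^sup>+y. (\<integral>\<^sup>+\<omega>. h s y \<omega> \<partial>M) \<partial>?S) \<partial>?T)"
  proof (rule nn_integral_cong)
    fix s assume "s \<in> space ?T"
    then have "s > 0" by (simp add: space_restrict_space)
    from nn_integral_fst[OF sec[OF this]]
    show "(\<integral>\<^sup>+q. (case q of (y, \<omega>) \<Rightarrow> h s y \<omega>) \<partial>(?S \<Otimes>\<^sub>M M)) = (\<integral>\<^sup>+y. (\<integral>\<^sup>+\<omega>. h s y \<omega> \<partial>M) \<partial>?S)"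
      by (simp only: prod.case)
  qed
  also have "\<dots> = (\<integral>\<^sup>+s\<in>{0<..}. (\<integral>\<^sup>+y\<in>{0<..<L}. (\<integral>\<^sup>+\<omega>. h s y \<omega> \<partial>M) \<partial>lborel) \<partial>lborel)"
    by (simp add: nn_integral_restrict_space)
  finally show ?thesis .
qed

text \<open>
  Predictability gives joint measurability on the open strip \<open>(0,\<infinity>) \<times> (0,L)\<close>, outside of which \<open>0\<close> is a
  measurable extension.
\<close>

lemma second_moment_measurable:
  assumes u: "(\<lambda>(s, y, \<omega>). u s y \<omega>) \<in> borel_measurable (predictable_sets M F L)"
  shows "(\<lambda>(s, y). second_moment M u s y * indicator ({0<..} \<times> {0<..<L}) (s, y)) \<in> borel_measurable (lborel \<Otimes>\<^sub>M lborel)"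
proof -
  let ?T = "restrict_space lborel {0::real<..}" and ?S = "restrict_space lborel {0::real<..<L}"
  let ?D = "{0::real<..} \<times> {0::real<..<L}"
  have "(\<lambda>(s, y, \<omega>). u s y \<omega>) \<in> borel_measurable (?T \<Otimes>\<^sub>M (?S \<Otimes>\<^sub>M M))"
    using predictable_measurable_field[OF subalgebra_F u] by (simp only: field_measure_def)
  moreover have "(\<lambda>q. (fst (fst q), snd (fst q), snd q)) \<in> measurable ((?T \<Otimes>\<^sub>M ?S) \<Otimes>\<^sub>M M) (?T \<Otimes>\<^sub>M (?S \<Otimes>\<^sub>M M))"
    by measurable
  ultimately have "(\<lambda>q. case (fst (fst q), snd (fst q), snd q) of (s, y, \<omega>) \<Rightarrow> u s y \<omega>)
      \<in> borel_measurable ((?T \<Otimes>\<^sub>M ?S) \<Otimes>\<^sub>M M)"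
    by (rule measurable_compose[rotated])
  then have [measurable]: "(\<lambda>q. u (fst (fst q)) (snd (fst q)) (snd q)) \<in> borel_measurable ((?T \<Otimes>\<^sub>M ?S) \<Otimes>\<^sub>M M)"
    by (simp only: prod.case)
  have "(\<lambda>q. ennreal (\<bar>u (fst (fst q)) (snd (fst q)) (snd q)\<bar>\<^sup>2)) \<in> borel_measurable ((?T \<Otimes>\<^sub>M ?S) \<Otimes>\<^sub>M M)"
    by measurable
  from borel_measurable_nn_integral_fst[OF this]
  have 1: "(\<lambda>p. second_moment M u (fst p) (snd p)) \<in> borel_measurable (?T \<Otimes>\<^sub>M ?S)"
    unfolding second_moment_def by simp
  let ?R = "restrict_space (lborel \<Otimes>\<^sub>M lborel) ?D"
  have "(\<lambda>p. (fst p, snd p)) \<in> measurable ?R (?T \<Otimes>\<^sub>M ?S)"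
    by (intro measurable_Pair measurable_restrict_space2 measurable_restrict_space1)
      (auto simp: space_restrict_space)
  from measurable_compose[OF this 1]
  have "(\<lambda>p. second_moment M u (fst p) (snd p)) \<in> borel_measurable ?R" by simp
  moreover have "?D \<inter> space (lborel \<Otimes>\<^sub>M lborel) \<in> sets (lborel \<Otimes>\<^sub>M lborel)"
    by (simp add: space_pair_measure)
  ultimately show ?thesis
    using borel_measurable_restrict_space_iff_ennreal[of ?D "lborel \<Otimes>\<^sub>M lborel"
        "\<lambda>p. second_moment M u (fst p) (snd p)"]
    by (simp add: case_prod_unfold mult.commute)
qed

text \<open>
  The mixed term in \<open>E (G + \<lambda> Z)\<^sup>2\<close> vanishes because the Walsh integral \<open>Z\<close> is centered; its second moment is given by
  the isometry and Tonelli's theorem.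
\<close>

lemma mild_solution_second_moment:
  assumes sol: "mild_solution M F L W \<sigma> lam u0 u" and \<sigma>[measurable]: "\<sigma> \<in> borel_measurable borel"
    and t: "0 < t" and x: "x \<in> {0..L}"
  shows "second_moment M u t x = ennreal ((initial_flow L u0 t x)\<^sup>2) +
    ennreal (lam\<^sup>2) * volterra L (\<lambda>s y. \<integral>\<^sup>+\<omega>. ennreal ((\<sigma> (u s y \<omega>))\<^sup>2) \<partial>M) t x"
proof -
  let ?p = "dirichlet_heat_kernel L" and ?G = "initial_flow L u0 t x"
  let ?\<Phi> = "\<lambda>s y \<omega>. indicator {0<..<t} s * ?p (t - s) x y * \<sigma> (u s y \<omega>)"
  have um[measurable]: "u s y \<in> borel_measurable M" if "0 \<le> s" "y \<in> {0..L}" for s y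
    using sol that by (auto simp: mild_solution_def)
  obtain Z where wi: "has_walsh_integral M F L W ?\<Phi> Z" and AE: "AE \<omega> in M. u t x \<omega> = ?G + lam * Z \<omega>"
    using sol t x unfolding mild_solution_def initial_flow_def by meson
  note Z = walsh_integral_moments[OF wi]
  note [measurable] = Z(1)
  have "second_moment M u t x = (\<integral>\<^sup>+\<omega>. ennreal ((?G + lam * Z \<omega>)\<^sup>2) \<partial>M)"
    unfolding second_moment_def by (rule nn_integral_cong_AE) (use AE in \<open>auto elim!: eventually_mono\<close>)
  also have "(\<lambda>\<omega>. (?G + lam * Z \<omega>)\<^sup>2) = (\<lambda>\<omega>. ?G\<^sup>2 + 2 * ?G * lam * Z \<omega> + lam\<^sup>2 * (Z \<omega>)\<^sup>2)"
    by (simp add: fun_eq_iff power2_eq_square algebra_simps)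
  then have "(\<integral>\<^sup>+\<omega>. ennreal ((?G + lam * Z \<omega>)\<^sup>2) \<partial>M) =
      ennreal (expectation (\<lambda>\<omega>. ?G\<^sup>2 + 2 * ?G * lam * Z \<omega> + lam\<^sup>2 * (Z \<omega>)\<^sup>2))"
    using Z by (subst nn_integral_eq_integral[symmetric])
      (auto intro!: AE_I2 simp: fun_eq_iff, metis zero_le_power2)
  also have "expectation (\<lambda>\<omega>. ?G\<^sup>2 + 2 * ?G * lam * Z \<omega> + lam\<^sup>2 * (Z \<omega>)\<^sup>2) =
      ?G\<^sup>2 + lam\<^sup>2 * expectation (\<lambda>\<omega>. (Z \<omega>)\<^sup>2)"
    using Z by (simp add: prob_space)
  also have "ennreal \<dots> = ennreal (?G\<^sup>2) + ennreal (lam\<^sup>2) * (\<integral>\<^sup>+\<omega>. ennreal ((Z \<omega>)\<^sup>2) \<partial>M)"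
    using Z(2) by (subst nn_integral_eq_integral) (auto simp: ennreal_mult)
  also have "(\<integral>\<^sup>+\<omega>. ennreal ((Z \<omega>)\<^sup>2) \<partial>M) =
     (\<integral>\<^sup>+s\<in>{0<..}. (\<integral>\<^sup>+y\<in>{0<..<L}. (\<integral>\<^sup>+\<omega>. ennreal ((?\<Phi> s y \<omega>)\<^sup>2) \<partial>M) \<partial>lborel) \<partial>lborel)"
    unfolding Z(5)
  proof (rule field_measure_nn_integral)
    have "(\<lambda>(s, y, \<omega>). ?\<Phi> s y \<omega>) \<in> borel_measurable (field_measure M L)"
      by (rule predictable_measurable_field[OF subalgebra_F])
        (rule wi[unfolded has_walsh_integral_def, THEN conjunct1])
    then have "(\<lambda>p. ennreal ((case p of (s, y, \<omega>) \<Rightarrow> ?\<Phi> s y \<omega>)\<^sup>2)) \<in> borel_measurable (field_measure M L)"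
      by measurable
    also have "(\<lambda>p. ennreal ((case p of (s, y, \<omega>) \<Rightarrow> ?\<Phi> s y \<omega>)\<^sup>2)) = (\<lambda>(s, y, \<omega>). ennreal ((?\<Phi> s y \<omega>)\<^sup>2))"
      by (rule ext) (simp split: prod.split)
    finally show "(\<lambda>(s, y, \<omega>). ennreal ((?\<Phi> s y \<omega>)\<^sup>2)) \<in> borel_measurable (field_measure M L)" .
  qed
  also have "\<dots> = volterra L (\<lambda>s y. \<integral>\<^sup>+\<omega>. ennreal ((\<sigma> (u s y \<omega>))\<^sup>2) \<partial>M) t x"
    unfolding volterra_def
  proof (rule nn_integral_cong)
    fix s :: real
    have "(\<integral>\<^sup>+\<omega>. ennreal ((?\<Phi> s y \<omega>)\<^sup>2) \<partial>M) =
        ennreal ((?p (t - s) x y)\<^sup>2) * (\<integral>\<^sup>+\<omega>. ennreal ((\<sigma> (u s y \<omega>))\<^sup>2) \<partial>M)"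
      if "0 < s" "s < t" "0 < y" "y < L" for y
    proof -
      have "y \<in> {0..L}" "0 \<le> s" using that by auto
      note [measurable] = um[OF this(2,1)]
      show ?thesis
        using that by (subst nn_integral_cmult[symmetric]) (auto simp: power_mult_distrib ennreal_mult)
    qed
    then show "(\<integral>\<^sup>+y\<in>{0<..<L}. (\<integral>\<^sup>+\<omega>. ennreal ((?\<Phi> s y \<omega>)\<^sup>2) \<partial>M) \<partial>lborel) * indicator {0<..} s =
      (\<integral>\<^sup>+y\<in>{0<..<L}. ennreal ((?p (t - s) x y)\<^sup>2) * (\<integral>\<^sup>+\<omega>. ennreal ((\<sigma> (u s y \<omega>))\<^sup>2) \<partial>M) \<partial>lborel)
        * indicator {0<..<t} s"
      by (auto split: split_indicator intro!: nn_integral_cong)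
  qed
  finally show ?thesis .
qed

end

lemma jointly_measurable_compose:
  assumes "(\<lambda>(s, y). g s y) \<in> borel_measurable (lborel \<Otimes>\<^sub>M lborel)"
    and "a \<in> borel_measurable N" "b \<in> borel_measurable N"
  shows "(\<lambda>q. g (a q) (b q) :: ennreal) \<in> borel_measurable N"
proof -
  have "(\<lambda>q. (a q, b q)) \<in> measurable N (lborel \<Otimes>\<^sub>M lborel)" using assms by measurable
  from measurable_compose[OF this assms(1)] show ?thesis by simp
qed

text \<open>
  A form with one integrand on the whole plane, to which Tonelli's theorem applies.
\<close>

lemma volterra_extension:
  "volterra L f t x = (\<integral>\<^sup>+s. (\<integral>\<^sup>+y. ennreal ((dirichlet_heat_kernel L (t - s) x y)\<^sup>2) *
      (f s y * indicator ({0<..} \<times> {0<..<L}) (s, y)) * indicator {0<..<t} s \<partial>lborel) \<partial>lborel)"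
  unfolding volterra_def
proof (rule nn_integral_cong)
  fix s :: real
  let ?p = "dirichlet_heat_kernel L"
  show "(\<integral>\<^sup>+y\<in>{0<..<L}. ennreal ((?p (t - s) x y)\<^sup>2) * f s y \<partial>lborel) * indicator {0<..<t} s =
    (\<integral>\<^sup>+y. ennreal ((?p (t - s) x y)\<^sup>2) * (f s y * indicator ({0<..} \<times> {0<..<L}) (s, y)) * indicator {0<..<t} s \<partial>lborel)"
    by (cases "0 < s \<and> s < t") (auto split: split_indicator intro!: nn_integral_cong)
qed

lemma volterra_cmult:
  assumes f: "(\<lambda>(s, y). f s y * indicator ({0<..} \<times> {0<..<L}) (s, y)) \<in> borel_measurable (lborel \<Otimes>\<^sub>M lborel)"
  shows "volterra L (\<lambda>s y. c * f s y) t x = c * volterra L f t x"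
proof -
  let ?p = "dirichlet_heat_kernel L"
  define g where "g s y = f s y * indicator ({0<..} \<times> {0<..<L}) (s, y)" for s y
  note [measurable] = jointly_measurable_compose[OF f[folded g_def]]
  have "volterra L (\<lambda>s y. c * f s y) t x =
      (\<integral>\<^sup>+s. (\<integral>\<^sup>+y. c * (ennreal ((?p (t - s) x y)\<^sup>2) * g s y * indicator {0<..<t} s) \<partial>lborel) \<partial>lborel)"
    by (simp add: volterra_extension g_def mult_ac)
  also have "\<dots> = (\<integral>\<^sup>+s. c * (\<integral>\<^sup>+y. ennreal ((?p (t - s) x y)\<^sup>2) * g s y * indicator {0<..<t} s \<partial>lborel) \<partial>lborel)"
    by (intro nn_integral_cong nn_integral_cmult) measurable
  also have "\<dots> = c * (\<integral>\<^sup>+s. (\<integral>\<^sup>+y. ennreal ((?p (t - s) x y)\<^sup>2) * g s y * indicator {0<..<t} s \<partial>lborel) \<partial>lborel)"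
    by (rule nn_integral_cmult) measurable
  also have "\<dots> = c * volterra L f t x"
    by (simp add: volterra_extension g_def)
  finally show ?thesis .
qed

context white_noise
begin

lemma mild_solution_moment_inequalities:
  assumes sol: "mild_solution M F L W \<sigma> lam u0 u" and \<sigma>: "\<sigma> \<in> borel_measurable borel"
    and bounds: "\<And>z. l * \<bar>z\<bar> \<le> \<bar>\<sigma> z\<bar> \<and> \<bar>\<sigma> z\<bar> \<le> K * \<bar>z\<bar>" and "0 \<le> l" "0 \<le> K"
    and t: "0 < t" and x: "x \<in> {0..L}"
  shows "ennreal ((initial_flow L u0 t x)\<^sup>2) + ennreal (lam\<^sup>2 * l\<^sup>2) * volterra L (second_moment M u) t x
      \<le> second_moment M u t x"
    and "second_moment M u t x
      \<le> ennreal ((initial_flow L u0 t x)\<^sup>2) + ennreal (lam\<^sup>2 * K\<^sup>2) * volterra L (second_moment M u) t x"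
proof -
  let ?m = "\<lambda>s y. \<integral>\<^sup>+\<omega>. ennreal ((\<sigma> (u s y \<omega>))\<^sup>2) \<partial>M"
  have pred: "(\<lambda>(s, y, \<omega>). u s y \<omega>) \<in> borel_measurable (predictable_sets M F L)"
    and um: "\<And>s y. 0 \<le> s \<Longrightarrow> y \<in> {0..L} \<Longrightarrow> u s y \<in> borel_measurable M"
    using sol by (auto simp: mild_solution_def)
  have sq: "l\<^sup>2 * z\<^sup>2 \<le> (\<sigma> z)\<^sup>2" "(\<sigma> z)\<^sup>2 \<le> K\<^sup>2 * z\<^sup>2" for z
    using power_mono[of "l * \<bar>z\<bar>" "\<bar>\<sigma> z\<bar>" 2] power_mono[of "\<bar>\<sigma> z\<bar>" "K * \<bar>z\<bar>" 2] bounds[of z] \<open>0 \<le> l\<close>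
    by (auto simp: power_mult_distrib)
  have m: "ennreal (l\<^sup>2) * second_moment M u s y \<le> ?m s y" "?m s y \<le> ennreal (K\<^sup>2) * second_moment M u s y"
    if "0 < s" "0 < y" "y < L" for s y
  proof -
    have [measurable]: "u s y \<in> borel_measurable M" using that by (intro um) auto
    have e: "ennreal k * second_moment M u s y = (\<integral>\<^sup>+\<omega>. ennreal (k * (u s y \<omega>)\<^sup>2) \<partial>M)" if "0 \<le> k" for k
      unfolding second_moment_def using that
      by (subst nn_integral_cmult[symmetric]) (auto simp: ennreal_mult)
    show "ennreal (l\<^sup>2) * second_moment M u s y \<le> ?m s y" "?m s y \<le> ennreal (K\<^sup>2) * second_moment M u s y"
      using sq by (auto simp: e intro!: nn_integral_mono ennreal_leI)
  qed
  have c: "ennreal (lam\<^sup>2) * volterra L (\<lambda>s y. ennreal (k\<^sup>2) * second_moment M u s y) t x =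
      ennreal (lam\<^sup>2 * k\<^sup>2) * volterra L (second_moment M u) t x" for k
    by (subst volterra_cmult[OF second_moment_measurable[OF pred]]) (simp add: ennreal_mult mult.assoc)
  note id = mild_solution_second_moment[OF sol \<sigma> t x]
  show "ennreal ((initial_flow L u0 t x)\<^sup>2) + ennreal (lam\<^sup>2 * l\<^sup>2) * volterra L (second_moment M u) t x
      \<le> second_moment M u t x"
    unfolding id c[symmetric] using m(1) by (intro add_left_mono mult_left_mono volterra_mono) auto
  show "second_moment M u t x
      \<le> ennreal ((initial_flow L u0 t x)\<^sup>2) + ennreal (lam\<^sup>2 * K\<^sup>2) * volterra L (second_moment M u) t x"
    unfolding id c[symmetric] using m(2) by (intro add_left_mono mult_left_mono volterra_mono) auto
qed

end

section \<open>Deterministic renewal inequalities\<close>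

lemma measurable_dirichlet_trace[measurable]:
  assumes [measurable]: "a \<in> borel_measurable N"
  shows "(\<lambda>q. dirichlet_trace L (a q)) \<in> borel_measurable N"
  unfolding dirichlet_trace_def by measurable

lemma ennreal_exp_mult: "ennreal (exp a) * (ennreal (exp b) * z) = ennreal (exp (a + b)) * z"
  by (simp add: mult.assoc[symmetric] ennreal_mult[symmetric] exp_add)

text \<open>
  Against the weight \<open>exp (\<beta> t)\<close> the operator is bounded by the Laplace transform at \<open>-\<beta>\<close> of the \<open>L\<^sup>2\<close>-norms of the
  kernel.
\<close>

lemma volterra_weighted_le:
  assumes L: "L > 0" and \<beta>: "\<beta> < (dirichlet_freq L 0)\<^sup>2"
    and f: "\<And>s y. 0 < s \<Longrightarrow> s < t \<Longrightarrow> 0 < y \<Longrightarrow> y < L \<Longrightarrow> ennreal (exp (\<beta> * s)) * f s y \<le> N"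
  shows "ennreal (exp (\<beta> * t)) * volterra L f t x \<le> ennreal (2 / L * trace_resolvent L \<beta>) * N"
proof -
  let ?p = "dirichlet_heat_kernel L" and ?\<tau> = "\<lambda>r. 2 / L * dirichlet_trace L (2 * r)"
  have f': "f s y \<le> ennreal (exp (- \<beta> * s)) * N" if "0 < s" "s < t" "0 < y" "y < L" for s y
  proof -
    have "f s y = ennreal (exp (- \<beta> * s)) * (ennreal (exp (\<beta> * s)) * f s y)"
      by (simp add: ennreal_exp_mult)
    then show ?thesis using f[OF that] by (metis mult_left_mono zero_le)
  qed
  have "volterra L f t x \<le> volterra L (\<lambda>s y. ennreal (exp (- \<beta> * s)) * N) t x"
    using f' by (rule volterra_mono)
  also have "\<dots> \<le> (\<integral>\<^sup>+s\<in>{0<..<t}. ennreal (exp (- \<beta> * s)) * N * ennreal (?\<tau> (t - s)) \<partial>lborel)"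
    unfolding volterra_def
  proof (rule nn_integral_mono)
    fix s :: real
    have "(\<integral>\<^sup>+y\<in>{0<..<L}. ennreal ((?p (t - s) x y)\<^sup>2) * (ennreal (exp (- \<beta> * s)) * N) \<partial>lborel)
        = ennreal (exp (- \<beta> * s)) * N * (\<integral>\<^sup>+y\<in>{0<..<L}. ennreal ((?p (t - s) x y)\<^sup>2) \<partial>lborel)"
      by (subst nn_integral_cmult[symmetric]) (auto simp: mult_ac)
    moreover have "(\<integral>\<^sup>+y\<in>{0<..<L}. ennreal ((?p (t - s) x y)\<^sup>2) \<partial>lborel) \<le> ennreal (?\<tau> (t - s))" if "s < t"
      using that by (intro kernel_square_integral_le L) simp
    ultimately show "(\<integral>\<^sup>+y\<in>{0<..<L}. ennreal ((?p (t - s) x y)\<^sup>2) * (ennreal (exp (- \<beta> * s)) * N) \<partial>lborel) * indicator {0<..<t} s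
        \<le> ennreal (exp (- \<beta> * s)) * N * ennreal (?\<tau> (t - s)) * indicator {0<..<t} s"
      by (auto split: split_indicator intro!: mult_left_mono)
  qed
  finally have "ennreal (exp (\<beta> * t)) * volterra L f t x \<le>
      ennreal (exp (\<beta> * t)) * (\<integral>\<^sup>+s\<in>{0<..<t}. ennreal (exp (- \<beta> * s)) * N * ennreal (?\<tau> (t - s)) \<partial>lborel)"
    by (rule mult_left_mono) simp
  also have "\<dots> = (\<integral>\<^sup>+s. N * (ennreal (exp (\<beta> * (t - s)) * ?\<tau> (t - s)) * indicator {0<..<t} s) \<partial>lborel)"
  proof (subst nn_integral_cmult[symmetric], measurable, rule nn_integral_cong)
    fix s :: real
    have "exp (\<beta> * (t - s)) = exp (\<beta> * t) * exp (- \<beta> * s)"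
      by (simp add: exp_add[symmetric] algebra_simps)
    then have "ennreal (exp (\<beta> * (t - s)) * ?\<tau> (t - s)) = ennreal (exp (\<beta> * t)) * ennreal (exp (- \<beta> * s)) * ennreal (?\<tau> (t - s))"
      by (simp only: ennreal_mult' mult_nonneg_nonneg exp_ge_zero)
    then show "ennreal (exp (\<beta> * t)) * (ennreal (exp (- \<beta> * s)) * N * ennreal (?\<tau> (t - s)) * indicator {0<..<t} s)
      = N * (ennreal (exp (\<beta> * (t - s)) * ?\<tau> (t - s)) * indicator {0<..<t} s)"
      by (simp add: mult_ac)
  qed
  also have "\<dots> = N * (\<integral>\<^sup>+s. ennreal (exp (\<beta> * (t - s)) * ?\<tau> (t - s)) * indicator {0<..<t} s \<partial>lborel)"
    by (rule nn_integral_cmult) measurable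
  also have "\<dots> \<le> N * ennreal (2 / L * trace_resolvent L \<beta>)"
  proof (rule mult_left_mono)
    have "(\<integral>\<^sup>+s. ennreal (exp (\<beta> * (t - s)) * ?\<tau> (t - s)) * indicator {0<..<t} s \<partial>lborel)
      \<le> (\<integral>\<^sup>+s. (\<lambda>r. ennreal (exp (\<beta> * r) * ?\<tau> r) * indicator {0<..} r) (t + (-1) * s) \<partial>lborel)"
      by (intro nn_integral_mono) (auto split: split_indicator)
    also have "\<dots> = (\<integral>\<^sup>+r\<in>{0<..}. ennreal (exp (\<beta> * r) * ?\<tau> r) \<partial>lborel)"
      using nn_integral_real_affine[of "\<lambda>r. ennreal (exp (\<beta> * r) * ?\<tau> r) * indicator {0<..} r" "-1" t]
      by simp
    also have "\<dots> \<le> ennreal (2 / L * trace_resolvent L \<beta>)"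
      by (rule trace_laplace[OF L \<beta>])
    finally show "(\<integral>\<^sup>+s. ennreal (exp (\<beta> * (t - s)) * ?\<tau> (t - s)) * indicator {0<..<t} s \<partial>lborel)
      \<le> ennreal (2 / L * trace_resolvent L \<beta>)" .
  qed simp
  finally show ?thesis by (simp only: mult.commute)
qed

text \<open>
  Let \<open>N\<close> be the supremum of \<open>exp (\<beta> s) f(s,y)\<close> up to time \<open>t\<close>.  The renewal inequality gives \<open>N \<le> C + N/2\<close>, and \<open>N\<close> is
  finite by the a priori bound on \<open>f\<close>, so \<open>N \<le> 2C\<close> with a bound that does not depend on \<open>t\<close>.
\<close>

lemma renewal_upper_bound:
  fixes f :: "real \<Rightarrow> real \<Rightarrow> ennreal" and G :: "real \<Rightarrow> real \<Rightarrow> real"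
  assumes L: "L > 0" and \<beta>: "\<beta> < (dirichlet_freq L 0)\<^sup>2" and b: "0 \<le> b"
    and small: "b * (2 / L * trace_resolvent L \<beta>) \<le> 1 / 2"
    and f: "\<And>t x. 0 < t \<Longrightarrow> 0 < x \<Longrightarrow> x < L \<Longrightarrow> f t x \<le> ennreal ((G t x)\<^sup>2) + ennreal b * volterra L f t x"
    and fin: "\<And>T. T \<ge> 0 \<Longrightarrow> (SUP t\<in>{0..T}. SUP x\<in>{0..L}. f t x) < \<infinity>"
    and G: "\<And>t x. 0 < t \<Longrightarrow> 0 < x \<Longrightarrow> x < L \<Longrightarrow> exp (\<beta> * t) * (G t x)\<^sup>2 \<le> C"
    and t: "0 < t" and x: "0 < x" "x < L"
  shows "f t x \<le> ennreal (2 * C * exp (- \<beta> * t))"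
proof -
  have C: "0 \<le> C" using G[OF t x] by (rule order.trans[rotated]) simp
  define N where "N = (SUP s\<in>{0<..t}. SUP y\<in>{0<..<L}. ennreal (exp (\<beta> * s)) * f s y)"
  have fN: "ennreal (exp (\<beta> * s)) * f s y \<le> N" if "0 < s" "s \<le> t" "0 < y" "y < L" for s y
    unfolding N_def by (rule SUP_upper2[of s], use that in simp, rule SUP_upper) (use that in simp)
  have Nfin: "N < \<infinity>"
  proof -
    have "N \<le> ennreal (exp (\<bar>\<beta>\<bar> * t)) * (SUP s\<in>{0..t}. SUP y\<in>{0..L}. f s y)"
      unfolding N_def
    proof (intro SUP_least mult_mono)
      fix s y assume s: "s \<in> {0<..t}" and y: "y \<in> {0<..<L}"
      have "\<beta> * s \<le> \<bar>\<beta>\<bar> * t" using s by (intro mult_mono) auto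
      then show "ennreal (exp (\<beta> * s)) \<le> ennreal (exp (\<bar>\<beta>\<bar> * t))" by (simp add: ennreal_leI)
      show "f s y \<le> (SUP s\<in>{0..t}. SUP y\<in>{0..L}. f s y)"
        by (rule SUP_upper2[of s], use s in simp, rule SUP_upper) (use y in simp)
    qed simp_all
    also have "\<dots> < \<infinity>"
      using fin[of t] t by (simp add: ennreal_mult_less_top)
    finally show ?thesis .
  qed
  have "N \<le> ennreal C + ennreal (1 / 2) * N"
    unfolding N_def
  proof (intro SUP_least, fold N_def)
    fix s y assume "s \<in> {0<..t}" "y \<in> {0<..<L}"
    then have s: "0 < s" "s \<le> t" and y: "0 < y" "y < L" by auto
    have "ennreal (exp (\<beta> * s)) * f s y \<le> ennreal (exp (\<beta> * s)) * (ennreal ((G s y)\<^sup>2) + ennreal b * volterra L f s y)"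
      by (intro mult_left_mono f s y) simp
    also have "\<dots> = ennreal (exp (\<beta> * s) * (G s y)\<^sup>2) + ennreal b * (ennreal (exp (\<beta> * s)) * volterra L f s y)"
      by (simp add: distrib_left ennreal_mult mult_ac)
    also have "\<dots> \<le> ennreal C + ennreal b * (ennreal (2 / L * trace_resolvent L \<beta>) * N)"
      using s y by (intro add_mono ennreal_leI G mult_left_mono volterra_weighted_le L \<beta> fN) auto
    also have "ennreal b * (ennreal (2 / L * trace_resolvent L \<beta>) * N) \<le> ennreal (1 / 2) * N"
    proof -
      have "ennreal b * (ennreal (2 / L * trace_resolvent L \<beta>) * N) = ennreal (b * (2 / L * trace_resolvent L \<beta>)) * N"
        by (simp only: ennreal_mult'[OF b] mult.assoc)
      also have "\<dots> \<le> ennreal (1 / 2) * N"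
        by (rule mult_right_mono[OF ennreal_leI[OF small]]) simp
      finally show ?thesis .
    qed
    finally show "ennreal (exp (\<beta> * s)) * f s y \<le> ennreal C + ennreal (1 / 2) * N"
      by (simp add: add_left_mono)
  qed
  moreover obtain n where n: "N = ennreal n" "0 \<le> n" using Nfin by (cases N) auto
  moreover have "ennreal (C + 1 / 2 * n) = ennreal C + ennreal (1 / 2) * ennreal n"
  proof -
    have "0 \<le> 1 / 2 * n" using n(2) by simp
    then have "ennreal (C + 1 / 2 * n) = ennreal C + ennreal (1 / 2 * n)" by (rule ennreal_plus[OF C])
    also have "ennreal (1 / 2 * n) = ennreal (1 / 2) * ennreal n" by (rule ennreal_mult[OF _ n(2)]) simp
    finally show ?thesis .
  qed
  ultimately have "ennreal n \<le> ennreal (C + 1 / 2 * n)" by (simp only:)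
  then have "n \<le> C + 1 / 2 * n" using C n by (subst (asm) ennreal_le_iff) auto
  then have "N \<le> ennreal (2 * C)" using n by (simp add: ennreal_leI)
  with fN[OF t _ x] have "ennreal (exp (\<beta> * t)) * f t x \<le> ennreal (2 * C)" by (auto intro: order.trans)
  then have "ennreal (exp (- \<beta> * t)) * (ennreal (exp (\<beta> * t)) * f t x) \<le> ennreal (exp (- \<beta> * t)) * ennreal (2 * C)"
    by (intro mult_left_mono) auto
  also have "ennreal (exp (- \<beta> * t)) * ennreal (2 * C) = ennreal (2 * C * exp (- \<beta> * t))"
    using C by (subst ennreal_mult[symmetric]) (auto simp: mult.commute)
  finally show ?thesis by (simp add: ennreal_exp_mult)
qed

text \<open>
  The weight is the square of the ground state because this is what the Cauchy-Schwarz bound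
  \<open>kernel_ground_state_square_integral\<close> reproduces.
\<close>

definition ground_energy :: "real \<Rightarrow> (real \<Rightarrow> ennreal) \<Rightarrow> ennreal" where
  "ground_energy L h = (\<integral>\<^sup>+x\<in>{0<..<L}. h x * ennreal ((sin (dirichlet_freq L 0 * x))\<^sup>2) \<partial>lborel)"

text \<open>
  After Tonelli's theorem the integral in \<open>x\<close> comes first, where \<open>kernel_ground_state_square_integral\<close> applies.
\<close>

lemma volterra_ground_energy:
  assumes L: "L > 0"
    and f: "(\<lambda>(s, y). f s y * indicator ({0<..} \<times> {0<..<L}) (s, y)) \<in> borel_measurable (lborel \<Otimes>\<^sub>M lborel)"
  shows "ennreal (1 / L) * (\<integral>\<^sup>+s\<in>{0<..<t}. ennreal (exp (- (dirichlet_freq L 0)\<^sup>2 * (t - s))) * ground_energy L (f s) \<partial>lborel)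
    \<le> ground_energy L (volterra L f t)"
proof -
  let ?p = "dirichlet_heat_kernel L" and ?\<phi> = "\<lambda>x. sin (dirichlet_freq L 0 * x)"
  define g where "g s y = f s y * indicator ({0<..} \<times> {0<..<L}) (s, y)" for s y
  define e where "e s = exp (- (dirichlet_freq L 0)\<^sup>2 * (t - s))" for s
  note [measurable] = jointly_measurable_compose[OF f[folded g_def]]
  have [measurable]: "e \<in> borel_measurable borel" unfolding e_def by measurable
  let ?K = "\<lambda>s y x. ennreal ((?p (t - s) x y)\<^sup>2) * g s y * indicator {0<..<t} s * ennreal ((?\<phi> x)\<^sup>2) * indicator {0<..<L} x"
  have "ennreal (1 / L) * (\<integral>\<^sup>+s\<in>{0<..<t}. ennreal (e s) * ground_energy L (f s) \<partial>lborel)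
      = (\<integral>\<^sup>+s. (\<integral>\<^sup>+y. ennreal (e s * (?\<phi> y)\<^sup>2 / L) * (g s y * indicator {0<..<t} s) \<partial>lborel) \<partial>lborel)"
  proof -
    have "(\<integral>\<^sup>+y. ennreal (e s * (?\<phi> y)\<^sup>2 / L) * (g s y * indicator {0<..<t} s) \<partial>lborel)
      = ennreal (1 / L) * (ennreal (e s) * ground_energy L (f s) * indicator {0<..<t} s)" for s
    proof (cases "0 < s \<and> s < t")
      case True
      have "ground_energy L (f s) = (\<integral>\<^sup>+y. g s y * ennreal ((?\<phi> y)\<^sup>2) \<partial>lborel)"
        unfolding ground_energy_def g_def using True by (intro nn_integral_cong) (auto split: split_indicator)
      then have "ennreal (1 / L) * (ennreal (e s) * ground_energy L (f s))
          = (\<integral>\<^sup>+y. ennreal (1 / L) * (ennreal (e s) * (g s y * ennreal ((?\<phi> y)\<^sup>2))) \<partial>lborel)"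
        by (simp add: nn_integral_cmult)
      also have "\<dots> = (\<integral>\<^sup>+y. ennreal (e s * (?\<phi> y)\<^sup>2 / L) * g s y \<partial>lborel)"
      proof (intro nn_integral_cong)
        fix y
        have "ennreal (e s * (?\<phi> y)\<^sup>2 / L) = ennreal (1 / L) * (ennreal (e s) * ennreal ((?\<phi> y)\<^sup>2))"
          using L by (simp add: ennreal_mult[symmetric] e_def)
        then show "ennreal (1 / L) * (ennreal (e s) * (g s y * ennreal ((?\<phi> y)\<^sup>2))) = ennreal (e s * (?\<phi> y)\<^sup>2 / L) * g s y"
          by (simp add: mult_ac)
      qed
      finally show ?thesis using True by simp
    qed auto
    moreover have "(\<lambda>s. ennreal (e s) * ground_energy L (f s) * indicator {0<..<t} s) \<in> borel_measurable lborel"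
    proof -
      have "(\<lambda>s. ennreal (e s) * ground_energy L (f s) * indicator {0<..<t} s) =
          (\<lambda>s. ennreal (e s) * (\<integral>\<^sup>+y. g s y * ennreal ((?\<phi> y)\<^sup>2) \<partial>lborel) * indicator {0<..<t} s)"
      proof
        fix s
        have "ground_energy L (f s) = (\<integral>\<^sup>+y. g s y * ennreal ((?\<phi> y)\<^sup>2) \<partial>lborel)" if "0 < s"
          unfolding ground_energy_def g_def using that by (intro nn_integral_cong) (auto split: split_indicator)
        then show "ennreal (e s) * ground_energy L (f s) * indicator {0<..<t} s =
            ennreal (e s) * (\<integral>\<^sup>+y. g s y * ennreal ((?\<phi> y)\<^sup>2) \<partial>lborel) * indicator {0<..<t} s"
          by (auto split: split_indicator)
      qed
      also have "\<dots> \<in> borel_measurable lborel" by measurable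
      finally show ?thesis .
    qed
    ultimately show ?thesis by (simp add: nn_integral_cmult)
  qed
  also have "\<dots> \<le> (\<integral>\<^sup>+s. (\<integral>\<^sup>+y. (\<integral>\<^sup>+x. ?K s y x \<partial>lborel) \<partial>lborel) \<partial>lborel)"
  proof (intro nn_integral_mono)
    fix s y :: real
    show "ennreal (e s * (?\<phi> y)\<^sup>2 / L) * (g s y * indicator {0<..<t} s) \<le> (\<integral>\<^sup>+x. ?K s y x \<partial>lborel)"
    proof (cases "0 < s \<and> s < t")
      case True
      have "ennreal (e s * (?\<phi> y)\<^sup>2 / L) * g s y \<le>
          (\<integral>\<^sup>+x\<in>{0<..<L}. ennreal ((?p (t - s) x y)\<^sup>2 * (?\<phi> x)\<^sup>2) \<partial>lborel) * g s y"
        unfolding e_def using True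
        by (intro mult_right_mono kernel_ground_state_square_integral L) auto
      also have "\<dots> = (\<integral>\<^sup>+x. ?K s y x \<partial>lborel)"
        using True by (subst nn_integral_multc[symmetric]) (auto simp: ennreal_mult mult_ac)
      finally show ?thesis using True by simp
    qed auto
  qed
  also have "\<dots> = (\<integral>\<^sup>+s. (\<integral>\<^sup>+x. (\<integral>\<^sup>+y. ?K s y x \<partial>lborel) \<partial>lborel) \<partial>lborel)"
    by (intro nn_integral_cong lborel_pair.Fubini') measurable
  also have "\<dots> = (\<integral>\<^sup>+x. (\<integral>\<^sup>+s. (\<integral>\<^sup>+y. ?K s y x \<partial>lborel) \<partial>lborel) \<partial>lborel)"
    by (rule lborel_pair.Fubini') measurable
  also have "\<dots> = ground_energy L (volterra L f t)"
    unfolding ground_energy_def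
  proof (rule nn_integral_cong)
    fix x :: real
    have "volterra L f t x * ennreal ((?\<phi> x)\<^sup>2) * indicator {0<..<L} x =
       (\<integral>\<^sup>+s. (\<integral>\<^sup>+y. ennreal ((?p (t - s) x y)\<^sup>2) * g s y * indicator {0<..<t} s \<partial>lborel) \<partial>lborel)
         * (ennreal ((?\<phi> x)\<^sup>2) * indicator {0<..<L} x)"
      unfolding volterra_extension g_def by (simp only: mult.assoc)
    also have "\<dots> = (\<integral>\<^sup>+s. (\<integral>\<^sup>+y. ennreal ((?p (t - s) x y)\<^sup>2) * g s y * indicator {0<..<t} s \<partial>lborel)
         * (ennreal ((?\<phi> x)\<^sup>2) * indicator {0<..<L} x) \<partial>lborel)"
      by (rule nn_integral_multc[symmetric]) measurable
    also have "\<dots> = (\<integral>\<^sup>+s. (\<integral>\<^sup>+y. ?K s y x \<partial>lborel) \<partial>lborel)"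
      by (subst nn_integral_multc[symmetric], measurable) (simp only: mult.assoc)
    finally show "(\<integral>\<^sup>+s. (\<integral>\<^sup>+y. ?K s y x \<partial>lborel) \<partial>lborel) =
        volterra L f t x * ennreal ((?\<phi> x)\<^sup>2) * indicator {0<..<L} x" by simp
  qed
  finally show ?thesis unfolding e_def .
qed

text \<open>
  Iterating the inequality \<open>n\<close> times bounds \<open>h\<close> below by \<open>k\<close> times the partial sum of the exponential series.  This is
  Gronwall's argument for lower bounds.
\<close>

lemma exponential_lower_bound:
  fixes h :: "real \<Rightarrow> ennreal"
  assumes \<kappa>: "0 \<le> \<kappa>"
    and h: "\<And>t. r < t \<Longrightarrow> k + ennreal \<kappa> * (\<integral>\<^sup>+s\<in>{r<..<t}. h s \<partial>lborel) \<le> h t"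
    and t: "r < t"
  shows "k * ennreal (exp (\<kappa> * (t - r))) \<le> h t"
proof -
  have partial: "k * ennreal (\<Sum>i<n. (\<kappa> * (t - r)) ^ i / fact i) \<le> h t" if "r < t" for n t
    using that
  proof (induction n arbitrary: t)
    case (Suc n)
    let ?P = "\<lambda>s. \<Sum>i<n. (\<kappa> * (s - r)) ^ i / fact i"
    let ?Q = "\<lambda>s. \<Sum>i<n. \<kappa> ^ i * (s - r) ^ Suc i / fact (Suc i)"
    have P: "0 \<le> ?P s" if "r \<le> s" for s using that \<kappa> by (intro sum_nonneg) auto
    have "(?P has_integral ?Q t - ?Q r) {r..t}"
    proof (rule fundamental_theorem_of_calculus)
      fix s assume "s \<in> {r..t}"
      have "((\<lambda>s. \<kappa> ^ i * (s - r) ^ Suc i / fact (Suc i)) has_real_derivative (\<kappa> * (s - r)) ^ i / fact i)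
          (at s within {r..t})" for i
      proof -
        have "((\<lambda>s. (s - r) ^ Suc i) has_real_derivative real (Suc i) * (1 * (s - r) ^ (Suc i - Suc 0))) (at s within {r..t})"
          by (rule DERIV_power) (auto intro!: derivative_eq_intros)
        from DERIV_cmult[OF this, of "\<kappa> ^ i / fact (Suc i)"] show ?thesis
          by (simp add: power_mult_distrib)
      qed
      then have "(?Q has_real_derivative ?P s) (at s within {r..t})" by (intro DERIV_sum)
      then show "(?Q has_vector_derivative ?P s) (at s within {r..t})"
        by (simp add: has_real_derivative_iff_has_vector_derivative)
    qed (use Suc.prems in simp)
    then have "(?P has_integral ?Q t) {r<..<t}"
      using has_integral_open_interval[of ?P _ r t] by simp
    from nn_integral_has_integral_lebesgue[OF _ this]
    have I: "(\<integral>\<^sup>+s. ennreal (indicator {r<..<t} s * ?P s) \<partial>lborel) = ennreal (?Q t)"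
      using P by (simp add: zero_le_mult_iff indicator_def)
    have sum: "(\<Sum>i<Suc n. (\<kappa> * (t - r)) ^ i / fact i) = 1 + \<kappa> * ?Q t"
      by (simp add: sum.lessThan_Suc_shift sum_distrib_left power_mult_distrib mult_ac del: sum.lessThan_Suc fact_Suc)
    have Q: "0 \<le> ?Q t" using \<kappa> Suc.prems by (intro sum_nonneg) auto
    have "k * ennreal (?Q t) = (\<integral>\<^sup>+s. k * ennreal (indicator {r<..<t} s * ?P s) \<partial>lborel)"
      unfolding I[symmetric] by (rule nn_integral_cmult[symmetric]) measurable
    also have "\<dots> \<le> (\<integral>\<^sup>+s\<in>{r<..<t}. h s \<partial>lborel)"
      by (intro nn_integral_mono) (auto split: split_indicator intro: Suc.IH)
    finally have "k + ennreal \<kappa> * (k * ennreal (?Q t)) \<le> k + ennreal \<kappa> * (\<integral>\<^sup>+s\<in>{r<..<t}. h s \<partial>lborel)"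
      by (intro add_left_mono mult_left_mono) auto
    also have "\<dots> \<le> h t" by (rule h[OF Suc.prems])
    also have "k + ennreal \<kappa> * (k * ennreal (?Q t)) = k * ennreal (1 + \<kappa> * ?Q t)"
    proof -
      have "ennreal (1 + \<kappa> * ?Q t) = 1 + ennreal \<kappa> * ennreal (?Q t)"
        using \<kappa> Q by (simp only: ennreal_plus mult_nonneg_nonneg zero_le_one ennreal_1 ennreal_mult)
      then show ?thesis by (simp only: distrib_left mult_1_right mult.left_commute)
    qed
    finally show ?case unfolding sum .
  qed simp
  have "(\<lambda>n. \<Sum>i<n. (\<kappa> * (t - r)) ^ i / fact i) \<longlonglongrightarrow> exp (\<kappa> * (t - r))"
    using exp_converges[of "\<kappa> * (t - r)"] by (simp add: sums_def divide_inverse mult.commute)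
  then have "(\<lambda>n. k * ennreal (\<Sum>i<n. (\<kappa> * (t - r)) ^ i / fact i)) \<longlonglongrightarrow> k * ennreal (exp (\<kappa> * (t - r)))"
    by (intro tendsto_mult_ennreal tendsto_const tendsto_ennrealI) (auto simp: ennreal_eq_0_iff)
  then show ?thesis
    by (rule LIMSEQ_le_const2) (use partial[OF t] in auto)
qed

section \<open>Exponential growth above the spectral threshold\<close>

text \<open>
  Tested against \<open>\<phi>\<^sup>2\<close> and multiplied by \<open>exp (c t)\<close>, the renewal inequality becomes the hypothesis of
  \<open>exponential_lower_bound\<close> with rate \<open>a/L\<close>.  The pointwise bound follows by applying the renewal inequality again and keeping
  only the times \<open>s\<close> at a distance between \<open>r0\<close> and \<open>r0 + 1\<close> before \<open>t\<close>, where the kernel is bounded below by the ground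
  state.
\<close>

lemma renewal_lower_bound:
  fixes f :: "real \<Rightarrow> real \<Rightarrow> ennreal" and G :: "real \<Rightarrow> real \<Rightarrow> real"
  assumes L: "L > 0" and a: "0 < a" and supercritical: "(dirichlet_freq L 0)\<^sup>2 < a / L"
    and f_meas: "(\<lambda>(s, y). f s y * indicator ({0<..} \<times> {0<..<L}) (s, y)) \<in> borel_measurable (lborel \<Otimes>\<^sub>M lborel)"
    and f: "\<And>t x. 0 < t \<Longrightarrow> 0 < x \<Longrightarrow> x < L \<Longrightarrow> ennreal ((G t x)\<^sup>2) + ennreal a * volterra L f t x \<le> f t x"
    and g: "0 < g" "0 < r"
    and G: "\<And>t x. r \<le> t \<Longrightarrow> 0 < x \<Longrightarrow> x < L \<Longrightarrow>
      g * exp (- (dirichlet_freq L 0)\<^sup>2 / 2 * t) * sin (dirichlet_freq L 0 * x) \<le> G t x"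
    and x: "0 < x" "x < L"
  shows "\<exists>D>0. \<forall>\<^sub>F t in at_top. ennreal (D * exp ((a / L - (dirichlet_freq L 0)\<^sup>2) * t)) \<le> f t x"
proof -
  define c where "c = (dirichlet_freq L 0)\<^sup>2"
  define \<phi> where "\<phi> y = sin (dirichlet_freq L 0 * y)" for y
  note supercritical = supercritical[folded c_def]
  note G = G[folded c_def \<phi>_def]
  let ?\<kappa> = "a / L" and ?p = "dirichlet_heat_kernel L"
  have \<kappa>: "0 < ?\<kappa>" using L a by simp
  have \<phi>_pos: "0 < \<phi> x" if "0 < x" "x < L" for x unfolding \<phi>_def by (rule sin_ground_pos[OF L that])
  have [measurable]: "\<phi> \<in> borel_measurable borel" unfolding \<phi>_def by measurable
  have GE: "ground_energy L w = (\<integral>\<^sup>+x\<in>{0<..<L}. w x * ennreal ((\<phi> x)\<^sup>2) \<partial>lborel)" for w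
    by (simp add: ground_energy_def \<phi>_def)
  define H where "H t = ground_energy L (f t)" for t
  have H: "H t = (\<integral>\<^sup>+x\<in>{0<..<L}. f t x * ennreal ((\<phi> x)\<^sup>2) \<partial>lborel)" for t
    by (simp add: H_def GE)
  define f' where "f' s y = f s y * indicator ({0<..} \<times> {0<..<L}) (s, y)" for s y
  note [measurable] = jointly_measurable_compose[OF f_meas[folded f'_def]]
  \<comment> \<open>Multiplying by \<open>exp (c t)\<close> turns the exponential kernel of \<open>volterra_ground_energy\<close> into a constant.\<close>
  define h where "h t = ennreal (exp (c * t)) * H t" for t
  define k where "k = (\<integral>\<^sup>+x\<in>{0<..<L}. ennreal (g\<^sup>2 * (\<phi> x)\<^sup>2 * (\<phi> x)\<^sup>2) \<partial>lborel)"
  have k: "k \<noteq> 0"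
  proof
    assume "k = 0"
    then have "AE x in lborel. ennreal (g\<^sup>2 * (\<phi> x)\<^sup>2 * (\<phi> x)\<^sup>2) * indicator {0<..<L} x = 0"
      unfolding k_def by (subst (asm) nn_integral_0_iff_AE) auto
    then have "AE x in lborel. \<not> (0 < x \<and> x < L)"
    proof eventually_elim
      case (elim x)
      show ?case
      proof
        assume x: "0 < x \<and> x < L"
        then have "0 < g\<^sup>2 * (\<phi> x)\<^sup>2 * (\<phi> x)\<^sup>2" using g \<phi>_pos[of x] by simp
        moreover have "ennreal (g\<^sup>2 * (\<phi> x)\<^sup>2 * (\<phi> x)\<^sup>2) = 0"
          using elim x by (simp only: greaterThanLessThan_iff indicator_simps(1) mult_1_right)
        ultimately show False by (meson ennreal_eq_0_iff not_less)
      qed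
    qed
    then have "emeasure lborel {x \<in> space lborel. 0 < x \<and> x < L} = 0" by (rule emeasure_eq_0_AE)
    also have "{x \<in> space lborel. 0 < x \<and> x < L} = {0<..<L}" by auto
    finally show False using L by simp
  qed
  have vol: "ennreal ?\<kappa> * (\<integral>\<^sup>+s\<in>{r<..<t}. h s \<partial>lborel) \<le> ennreal (exp (c * t)) * (ennreal a * ground_energy L (volterra L f t))" for t
  proof -
    have hm: "(\<lambda>s. h s * indicator {0<..<t} s) \<in> borel_measurable lborel"
    proof -
      have "(\<lambda>s. h s * indicator {0<..<t} s) =
        (\<lambda>s. ennreal (exp (c * s)) * (\<integral>\<^sup>+y. f' s y * ennreal ((\<phi> y)\<^sup>2) \<partial>lborel) * indicator {0<..<t} s)"
      proof
        fix s
        have "H s = (\<integral>\<^sup>+y. f' s y * ennreal ((\<phi> y)\<^sup>2) \<partial>lborel)" if "0 < s"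
          unfolding H f'_def using that by (intro nn_integral_cong) (auto split: split_indicator)
        then show "h s * indicator {0<..<t} s = ennreal (exp (c * s)) * (\<integral>\<^sup>+y. f' s y * ennreal ((\<phi> y)\<^sup>2) \<partial>lborel) * indicator {0<..<t} s"
          by (auto simp: h_def split: split_indicator)
      qed
      also have "\<dots> \<in> borel_measurable lborel" by measurable
      finally show ?thesis .
    qed
    have "ennreal ?\<kappa> * (\<integral>\<^sup>+s\<in>{r<..<t}. h s \<partial>lborel) \<le> ennreal ?\<kappa> * (\<integral>\<^sup>+s\<in>{0<..<t}. h s \<partial>lborel)"
      using g by (intro mult_left_mono nn_integral_mono) (auto split: split_indicator)
    also have "(\<integral>\<^sup>+s\<in>{0<..<t}. h s \<partial>lborel) =
      (\<integral>\<^sup>+s. ennreal (exp (c * t)) * ((ennreal (exp (- c * (t - s))) * H s) * indicator {0<..<t} s) \<partial>lborel)"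
    proof (rule nn_integral_cong)
      fix s
      have "exp (c * s) = exp (c * t) * exp (- c * (t - s))" by (simp add: exp_add[symmetric] algebra_simps)
      then have "ennreal (exp (c * s)) = ennreal (exp (c * t)) * ennreal (exp (- c * (t - s)))"
        by (simp only: ennreal_mult' exp_ge_zero)
      then show "h s * indicator {0<..<t} s = ennreal (exp (c * t)) * ((ennreal (exp (- c * (t - s))) * H s) * indicator {0<..<t} s)"
        by (simp only: h_def mult.assoc)
    qed
    also have "\<dots> = ennreal (exp (c * t)) * (\<integral>\<^sup>+s. (ennreal (exp (- c * (t - s))) * H s) * indicator {0<..<t} s \<partial>lborel)"
    proof (rule nn_integral_cmult)
      have "(\<lambda>s. ennreal (exp (- c * (t - s))) * H s * indicator {0<..<t} s) =
          (\<lambda>s. ennreal (exp (- c * t)) * (h s * indicator {0<..<t} s))"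
      proof
        fix s
        have "exp (- c * (t - s)) = exp (- c * t) * exp (c * s)" by (simp add: exp_add[symmetric] algebra_simps)
        then have "ennreal (exp (- c * (t - s))) = ennreal (exp (- c * t)) * ennreal (exp (c * s))"
          by (simp only: ennreal_mult' exp_ge_zero)
        then show "ennreal (exp (- c * (t - s))) * H s * indicator {0<..<t} s = ennreal (exp (- c * t)) * (h s * indicator {0<..<t} s)"
          by (simp only: h_def mult.assoc)
      qed
      also have "\<dots> \<in> borel_measurable lborel" using hm by measurable
      finally show "(\<lambda>s. ennreal (exp (- c * (t - s))) * H s * indicator {0<..<t} s) \<in> borel_measurable lborel" .
    qed
    also have "ennreal ?\<kappa> * (ennreal (exp (c * t)) * (\<integral>\<^sup>+s. (ennreal (exp (- c * (t - s))) * H s) * indicator {0<..<t} s \<partial>lborel))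
       = ennreal (exp (c * t)) * (ennreal a * (ennreal (1 / L) * (\<integral>\<^sup>+s\<in>{0<..<t}. ennreal (exp (- c * (t - s))) * H s \<partial>lborel)))"
    proof -
      have "ennreal ?\<kappa> = ennreal a * ennreal (1 / L)" using a L by (simp add: ennreal_mult[symmetric])
      then show ?thesis by (simp only: mult_ac)
    qed
    also have "\<dots> \<le> ennreal (exp (c * t)) * (ennreal a * ground_energy L (volterra L f t))"
      using volterra_ground_energy[OF L f_meas, of t]
      unfolding H_def c_def by (intro mult_left_mono) auto
    finally show ?thesis .
  qed
  have h: "k + ennreal ?\<kappa> * (\<integral>\<^sup>+s\<in>{r<..<t}. h s \<partial>lborel) \<le> h t" if t: "r < t" for t
  proof -
    have t0: "0 < t" using t g by simp
    have Vm: "(\<lambda>x. volterra L f t x) \<in> borel_measurable lborel"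
      unfolding volterra_extension f'_def[symmetric] by measurable
    have "k + ennreal ?\<kappa> * (\<integral>\<^sup>+s\<in>{r<..<t}. h s \<partial>lborel)
      \<le> ennreal (exp (c * t)) * (\<integral>\<^sup>+x\<in>{0<..<L}. ennreal (exp (- c * t) * (g\<^sup>2 * (\<phi> x)\<^sup>2 * (\<phi> x)\<^sup>2)) \<partial>lborel)
        + ennreal (exp (c * t)) * (ennreal a * ground_energy L (volterra L f t))"
    proof (rule add_mono[OF _ vol])
      show "k \<le> ennreal (exp (c * t)) * (\<integral>\<^sup>+x\<in>{0<..<L}. ennreal (exp (- c * t) * (g\<^sup>2 * (\<phi> x)\<^sup>2 * (\<phi> x)\<^sup>2)) \<partial>lborel)"
        unfolding k_def
        by (subst nn_integral_cmult[symmetric], measurable, intro nn_integral_mono)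
          (auto simp: ennreal_mult[symmetric] mult.assoc[symmetric] exp_add[symmetric] split: split_indicator)
    qed
    also have "\<dots> = ennreal (exp (c * t)) * (\<integral>\<^sup>+x. ennreal (exp (- c * t) * (g\<^sup>2 * (\<phi> x)\<^sup>2 * (\<phi> x)\<^sup>2)) * indicator {0<..<L} x
        + ennreal a * (volterra L f t x * ennreal ((\<phi> x)\<^sup>2) * indicator {0<..<L} x) \<partial>lborel)"
      unfolding GE using Vm
      by (simp add: nn_integral_add nn_integral_cmult distrib_left)
    also have "\<dots> \<le> ennreal (exp (c * t)) * (\<integral>\<^sup>+x\<in>{0<..<L}. f t x * ennreal ((\<phi> x)\<^sup>2) \<partial>lborel)"
    proof (intro mult_left_mono nn_integral_mono)
      fix x
      show "ennreal (exp (- c * t) * (g\<^sup>2 * (\<phi> x)\<^sup>2 * (\<phi> x)\<^sup>2)) * indicator {0<..<L} x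
        + ennreal a * (volterra L f t x * ennreal ((\<phi> x)\<^sup>2) * indicator {0<..<L} x)
        \<le> f t x * ennreal ((\<phi> x)\<^sup>2) * indicator {0<..<L} x"
      proof (cases "0 < x \<and> x < L")
        case True
        then have x: "0 < x" "x < L" by auto
        have "(g * exp (- c / 2 * t) * \<phi> x)\<^sup>2 \<le> (G t x)\<^sup>2"
          using t g \<phi>_pos[OF x] by (intro power_mono G x) auto
        moreover have "(exp (- c / 2 * t))\<^sup>2 = exp (- c * t)"
          by (simp add: power2_eq_square exp_add[symmetric])
        ultimately have "exp (- c * t) * (g\<^sup>2 * (\<phi> x)\<^sup>2) \<le> (G t x)\<^sup>2"
          by (simp add: power_mult_distrib mult_ac)
        then have "ennreal (exp (- c * t) * (g\<^sup>2 * (\<phi> x)\<^sup>2)) + ennreal a * volterra L f t x \<le> f t x"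
          using f[OF t0 x] by (meson add_right_mono ennreal_leI order_trans)
        then have "(ennreal (exp (- c * t) * (g\<^sup>2 * (\<phi> x)\<^sup>2)) + ennreal a * volterra L f t x) * ennreal ((\<phi> x)\<^sup>2)
          \<le> f t x * ennreal ((\<phi> x)\<^sup>2)" by (rule mult_right_mono) simp
        moreover have "ennreal (exp (- c * t) * (g\<^sup>2 * (\<phi> x)\<^sup>2 * (\<phi> x)\<^sup>2)) =
            ennreal (exp (- c * t) * (g\<^sup>2 * (\<phi> x)\<^sup>2)) * ennreal ((\<phi> x)\<^sup>2)"
          by (subst ennreal_mult[symmetric]) (auto simp: mult.assoc)
        ultimately show ?thesis using x by (simp add: distrib_right mult.assoc)
      qed auto
    qed simp
    also have "\<dots> = h t" by (simp add: h_def H)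
    finally show ?thesis .
  qed
  \<comment> \<open>The constant \<open>k\<close> could be infinite as an extended real, so it is replaced by a smaller real one.\<close>
  obtain k' where k': "0 < k'" "ennreal k' \<le> k"
  proof -
    obtain k' where "min k 1 = ennreal k'" "0 \<le> k'" by (cases "min k 1") (auto simp: min_def top_unique split: if_splits)
    moreover have "min k 1 \<noteq> 0" using k by (auto simp: min_def)
    ultimately show thesis by (intro that[of k']) (auto simp: min_def split: if_splits)
  qed
  have growth: "ennreal (k' * exp (- ?\<kappa> * r) * exp ((?\<kappa> - c) * s)) \<le> H s" if s: "r < s" for s
  proof -
    have "k * ennreal (exp (?\<kappa> * (s - r))) \<le> h s"
      by (rule exponential_lower_bound[OF _ h s]) (use \<kappa> in auto)
    then have "ennreal (exp (- c * s)) * (ennreal k' * ennreal (exp (?\<kappa> * (s - r)))) \<le> ennreal (exp (- c * s)) * h s"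
      using k' by (meson mult_left_mono mult_right_mono order_trans zero_le)
    also have "\<dots> = H s"
      by (simp add: h_def ennreal_exp_mult)
    also have "ennreal (exp (- c * s)) * (ennreal k' * ennreal (exp (?\<kappa> * (s - r)))) =
        ennreal (k' * exp (- ?\<kappa> * r) * exp ((?\<kappa> - c) * s))"
    proof -
      have "k' * exp (- ?\<kappa> * r) * exp ((?\<kappa> - c) * s) = exp (- c * s) * (k' * exp (?\<kappa> * (s - r)))"
      proof -
        have "exp (- q * r) * exp ((q - w) * s) = exp (- w * s) * exp (q * (s - r))" for q w :: real
          by (simp add: exp_add[symmetric] algebra_simps)
        from this[of ?\<kappa> c] show ?thesis by (simp only: mult_ac)
      qed
      then show ?thesis using k' by (simp only: ennreal_mult' exp_ge_zero less_imp_le)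
    qed
    finally show ?thesis .
  qed
  obtain r0 where r0: "1 \<le> r0" and kernel: "\<And>t x y. r0 \<le> t \<Longrightarrow> x \<in> {0..L} \<Longrightarrow> y \<in> {0..L} \<Longrightarrow>
      exp (- c / 2 * t) * \<phi> x * \<phi> y / L \<le> ?p t x y"
    using kernel_ground_state_lower[OF L] unfolding c_def \<phi>_def by metis
  \<comment> \<open>\<open>E\<close> bounds the square of the kernel on the time window of length 1, and \<open>K\<close> comes from the earliest time there.\<close>
  define E where "E = exp (- c * (r0 + 1)) / L\<^sup>2"
  define K where "K = k' * exp (- ?\<kappa> * r) * exp (- (?\<kappa> - c) * (r0 + 1))"
  have E: "0 < E" and K: "0 < K" using L k' by (auto simp: E_def K_def)
  have main: "ennreal (a * E * (\<phi> x)\<^sup>2 * K * exp ((?\<kappa> - c) * t)) \<le> f t x"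
    if t: "r + r0 + 1 < t" and x: "0 < x" "x < L" for t x
  proof -
    have "ennreal (E * (\<phi> x)\<^sup>2 * (K * exp ((?\<kappa> - c) * t)))
      = (\<integral>\<^sup>+s\<in>{t - r0 - 1<..<t - r0}. ennreal (E * (\<phi> x)\<^sup>2) * ennreal (K * exp ((?\<kappa> - c) * t)) \<partial>lborel)"
      using E K by (simp add: nn_integral_cmult_indicator ennreal_mult[symmetric])
    also have "\<dots> \<le> volterra L f t x"
      unfolding volterra_def
    proof (rule nn_integral_mono)
      fix s
      show "ennreal (E * (\<phi> x)\<^sup>2) * ennreal (K * exp ((?\<kappa> - c) * t)) * indicator {t - r0 - 1<..<t - r0} s
        \<le> (\<integral>\<^sup>+y\<in>{0<..<L}. ennreal ((?p (t - s) x y)\<^sup>2) * f s y \<partial>lborel) * indicator {0<..<t} s"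
      proof (cases "t - r0 - 1 < s \<and> s < t - r0")
        case True
        then have s: "t - r0 - 1 < s" "s < t - r0" "0 < s" "s < t" "r < s" using t r0 g by auto
        have "K * exp ((?\<kappa> - c) * t) = k' * exp (- ?\<kappa> * r) * exp ((?\<kappa> - c) * (t - r0 - 1))"
        proof -
          have "exp (- q * (r0 + 1)) * exp (q * t) = exp (q * (t - r0 - 1))" for q :: real
            by (simp add: exp_add[symmetric] algebra_simps)
          from this[of "?\<kappa> - c"] show ?thesis by (simp only: K_def mult.assoc)
        qed
        also have "\<dots> \<le> k' * exp (- ?\<kappa> * r) * exp ((?\<kappa> - c) * s)"
          using s k' supercritical by (intro mult_left_mono) (auto intro!: mult_left_mono)
        finally have "ennreal (K * exp ((?\<kappa> - c) * t)) \<le> H s"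
          using growth[OF s(5)] by (meson ennreal_leI order_trans)
        then have "ennreal (E * (\<phi> x)\<^sup>2) * ennreal (K * exp ((?\<kappa> - c) * t)) \<le> ennreal (E * (\<phi> x)\<^sup>2) * H s"
          by (rule mult_left_mono) simp
        also have "\<dots> = (\<integral>\<^sup>+y. ennreal (E * (\<phi> x)\<^sup>2) * (f' s y * ennreal ((\<phi> y)\<^sup>2)) \<partial>lborel)"
        proof -
          have "H s = (\<integral>\<^sup>+y. f' s y * ennreal ((\<phi> y)\<^sup>2) \<partial>lborel)"
            unfolding H f'_def using s by (intro nn_integral_cong) (auto split: split_indicator)
          then show ?thesis by (simp add: nn_integral_cmult)
        qed
        also have "\<dots> \<le> (\<integral>\<^sup>+y\<in>{0<..<L}. ennreal ((?p (t - s) x y)\<^sup>2) * f s y \<partial>lborel)"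
        proof (rule nn_integral_mono)
          fix y
          show "ennreal (E * (\<phi> x)\<^sup>2) * (f' s y * ennreal ((\<phi> y)\<^sup>2))
            \<le> ennreal ((?p (t - s) x y)\<^sup>2) * f s y * indicator {0<..<L} y"
          proof (cases "0 < y \<and> y < L")
            case True
            then have y: "0 < y" "y < L" by auto
            have "0 \<le> c" by (simp add: c_def)
            then have "c * (t - s) \<le> c * (r0 + 1)" using s by (intro mult_left_mono) auto
            then have "exp (- c * (r0 + 1)) \<le> exp (- c * (t - s))" by simp
            also have "\<dots> = (exp (- c / 2 * (t - s)))\<^sup>2"
              by (simp add: power2_eq_square exp_add[symmetric])
            finally have "E * (\<phi> x)\<^sup>2 * (\<phi> y)\<^sup>2 \<le> (exp (- c / 2 * (t - s)) * \<phi> x * \<phi> y / L)\<^sup>2"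
              by (simp add: E_def power_mult_distrib power_divide divide_right_mono mult_right_mono)
            also have "\<dots> \<le> (?p (t - s) x y)\<^sup>2"
              using \<phi>_pos[OF x] \<phi>_pos[OF y] L s x y by (intro power_mono kernel) auto
            finally have "ennreal (E * (\<phi> x)\<^sup>2) * ennreal ((\<phi> y)\<^sup>2) \<le> ennreal ((?p (t - s) x y)\<^sup>2)"
              using E by (simp add: ennreal_mult[symmetric] ennreal_leI)
            then have "ennreal (E * (\<phi> x)\<^sup>2) * ennreal ((\<phi> y)\<^sup>2) * f s y \<le> ennreal ((?p (t - s) x y)\<^sup>2) * f s y"
              by (rule mult_right_mono) simp
            then show ?thesis using y s by (simp add: f'_def mult_ac)
          qed (simp add: f'_def)
        qed
        finally show ?thesis using True s by simp
      qed simp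
    qed
    finally have "ennreal a * ennreal (E * (\<phi> x)\<^sup>2 * (K * exp ((?\<kappa> - c) * t))) \<le> ennreal a * volterra L f t x"
      by (rule mult_left_mono) simp
    also have "\<dots> \<le> ennreal ((G t x)\<^sup>2) + ennreal a * volterra L f t x" by simp
    also have "\<dots> \<le> f t x" using t r0 g x by (intro f) auto
    finally show ?thesis using a by (simp add: ennreal_mult'[symmetric] mult.assoc)
  qed
  have "0 < a * E * (\<phi> x)\<^sup>2 * K" using \<phi>_pos[OF x] a E K by simp
  moreover have "\<forall>\<^sub>F t in at_top. ennreal (a * E * (\<phi> x)\<^sup>2 * K * exp ((?\<kappa> - c) * t)) \<le> f t x"
    using eventually_gt_at_top[of "r + r0 + 1"] by eventually_elim (rule main, auto simp: x)
  ultimately show ?thesis unfolding c_def[symmetric] by blast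
qed

section \<open>The heat flow of the initial condition\<close>

lemma bounded_times_continuous_integrable:
  fixes v g :: "real \<Rightarrow> real"
  assumes v: "v \<in> borel_measurable (lebesgue_on {0..L})" "bounded (v ` {0..L})" and g: "continuous_on {0..L} g"
  shows "integrable (lebesgue_on {0..L}) (\<lambda>y. v y * g y)"
proof -
  interpret finite_measure "lebesgue_on {0..L}" by (rule finite_measure_lebesgue_on) auto
  have "bounded (g ` {0..L})" by (intro compact_imp_bounded compact_continuous_image g) auto
  then obtain B C where B: "\<And>y. y \<in> {0..L} \<Longrightarrow> \<bar>v y\<bar> \<le> B" and C: "\<And>y. y \<in> {0..L} \<Longrightarrow> \<bar>g y\<bar> \<le> C"
    using v(2) by (auto simp: bounded_iff simp del: atLeastAtMost_iff)
  show ?thesis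
  proof (rule integrable_const_bound)
    show "AE y in lebesgue_on {0..L}. norm (v y * g y) \<le> B * C"
    proof (rule AE_I2)
      fix y assume "y \<in> space (lebesgue_on {0..L})"
      then have "y \<in> {0..L}" by simp
      then show "norm (v y * g y) \<le> B * C"
        using mult_mono[OF B C, of y y] B[of y] by (auto simp: abs_mult intro: order.trans[OF abs_ge_zero])
    qed
    show "(\<lambda>y. v y * g y) \<in> borel_measurable (lebesgue_on {0..L})"
      by (rule borel_measurable_times[OF v(1) continuous_imp_measurable_on_sets_lebesgue[OF g]]) auto
  qed
qed

lemma initial_flow_eq:
  "initial_flow L u0 t x = (\<integral>y. u0 y * dirichlet_heat_kernel L t x y \<partial>lebesgue_on {0..L})"
  unfolding initial_flow_def set_lebesgue_integral_def
  by (subst integral_restrict_space) auto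

lemma initial_flow_abs_le:
  assumes L: "L > 0" and t: "t \<ge> 1"
    and u0: "u0 \<in> borel_measurable (lebesgue_on {0..L})" "\<And>y. y \<in> {0..L} \<Longrightarrow> \<bar>u0 y\<bar> \<le> B"
  shows "\<bar>initial_flow L u0 t x\<bar> \<le> 2 * B * dirichlet_trace L 1 * exp (- (dirichlet_freq L 0)\<^sup>2 / 2 * (t - 1))"
proof -
  interpret finite_measure "lebesgue_on {0..L}" by (rule finite_measure_lebesgue_on) auto
  let ?K = "2 / L * (exp (- (dirichlet_freq L 0)\<^sup>2 / 2 * (t - 1)) * dirichlet_trace L 1)"
  have t0: "t > 0" using t by simp
  have K: "\<bar>dirichlet_heat_kernel L t x y\<bar> \<le> ?K" for y
  proof -
    have "2 / L * dirichlet_trace L t \<le> ?K"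
      using dirichlet_trace_decay[OF L t] L by (intro mult_left_mono) auto
    then show ?thesis using dirichlet_heat_kernel_abs_le[OF L t0, of x y] by (rule order.trans[rotated])
  qed
  have K0: "0 \<le> ?K" using K[of 0] by (rule order.trans[rotated]) simp
  have B0: "0 \<le> B" using u0(2)[of 0] L by (auto intro: order.trans[OF abs_ge_zero])
  have "\<bar>initial_flow L u0 t x\<bar> \<le> (\<integral>y. \<bar>u0 y * dirichlet_heat_kernel L t x y\<bar> \<partial>lebesgue_on {0..L})"
    unfolding initial_flow_eq by (rule integral_abs_bound)
  also have "\<dots> \<le> (\<integral>y. B * ?K \<partial>lebesgue_on {0..L})"
  proof (rule integral_mono')
    fix y assume "y \<in> space (lebesgue_on {0..L})"
    then show "\<bar>u0 y * dirichlet_heat_kernel L t x y\<bar> \<le> B * ?K"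
      unfolding abs_mult using u0(2)[of y] K B0 by (intro mult_mono) auto
    show "0 \<le> B * ?K" by (rule mult_nonneg_nonneg[OF B0 K0])
  qed simp
  also have "\<dots> = L * (B * ?K)"
    using L by (simp add: measure_restrict_space)
  also have "\<dots> = 2 * B * dirichlet_trace L 1 * exp (- (dirichlet_freq L 0)\<^sup>2 / 2 * (t - 1))"
    using L by simp
  finally show ?thesis .
qed

text \<open>
  By \<open>kernel_ground_state_lower\<close> one can take for \<open>g\<close> the integral of \<open>u0 \<phi>\<close> divided by \<open>L\<close>.  It is positive because \<open>\<phi>\<close>
  is positive in the interior and \<open>u0\<close> is positive on a set of positive measure.
\<close>

lemma initial_flow_lower:
  assumes L: "L > 0"
    and u0: "u0 \<in> borel_measurable (lebesgue_on {0..L})" "bounded (u0 ` {0..L})"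
      "\<And>y. y \<in> {0..L} \<Longrightarrow> 0 \<le> u0 y" "emeasure lebesgue {y \<in> {0..L}. u0 y > 0} > 0"
  obtains g r where "0 < g" "0 < r"
    "\<And>t x. r \<le> t \<Longrightarrow> 0 < x \<Longrightarrow> x < L \<Longrightarrow>
      g * exp (- (dirichlet_freq L 0)\<^sup>2 / 2 * t) * sin (dirichlet_freq L 0 * x) \<le> initial_flow L u0 t x"
proof -
  let ?c = "(dirichlet_freq L 0)\<^sup>2" and ?\<phi> = "\<lambda>x. sin (dirichlet_freq L 0 * x)" and ?M = "lebesgue_on {0..L}"
  obtain r where r: "r \<ge> 1" and kernel: "\<And>t x y. r \<le> t \<Longrightarrow> x \<in> {0..L} \<Longrightarrow> y \<in> {0..L} \<Longrightarrow>
      exp (- ?c / 2 * t) * ?\<phi> x * ?\<phi> y / L \<le> dirichlet_heat_kernel L t x y"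
    using kernel_ground_state_lower[OF L] by metis
  define a where "a = (\<integral>y. u0 y * ?\<phi> y \<partial>?M)"
  have int: "integrable ?M (\<lambda>y. u0 y * ?\<phi> y)"
    by (intro bounded_times_continuous_integrable u0 continuous_intros)
  have nn: "0 \<le> u0 y * ?\<phi> y" if "y \<in> {0..L}" for y
    using u0(3)[OF that] sin_ground_nonneg[OF L, of y] that by simp
  have ae: "AE y in ?M. 0 \<le> u0 y * ?\<phi> y" using nn by (intro AE_I2) simp
  have "a \<noteq> 0"
  proof
    assume "a = 0"
    then have "AE y in ?M. u0 y * ?\<phi> y = 0"
      using integral_nonneg_eq_0_iff_AE[OF int ae] by (simp only: a_def)
    then have "AE y in lebesgue. y \<in> {0..L} \<longrightarrow> u0 y * ?\<phi> y = 0"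
      by (subst (asm) AE_restrict_space_iff) auto
    moreover have "AE y in lebesgue. y \<notin> {0, L}"
      by (intro AE_not_in null_sets_completionI finite_imp_null_set_lborel) simp
    ultimately have "AE y in lebesgue. \<not> (y \<in> {0..L} \<and> u0 y > 0)"
    proof eventually_elim
      case (elim y)
      then show ?case using sin_ground_pos[OF L, of y] by (cases "y = 0 \<or> y = L") auto
    qed
    then have "emeasure lebesgue {y \<in> space lebesgue. y \<in> {0..L} \<and> u0 y > 0} = 0" by (rule emeasure_eq_0_AE)
    then show False using u0(4) by simp
  qed
  moreover have "0 \<le> a" unfolding a_def by (rule integral_nonneg_AE[OF ae])
  ultimately have a: "0 < a" by simp
  show thesis
  proof (rule that[of "a / L" r])
    show "0 < a / L" "0 < r" using a L r by auto
    fix t x assume t: "r \<le> t" and x: "0 < x" "x < L"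
    have t0: "0 < t" using t r by simp
    have "a / L * exp (- ?c / 2 * t) * ?\<phi> x = (\<integral>y. (exp (- ?c / 2 * t) * ?\<phi> x / L) * (u0 y * ?\<phi> y) \<partial>?M)"
      by (simp add: a_def)
    also have "\<dots> \<le> initial_flow L u0 t x"
      unfolding initial_flow_eq
    proof (rule integral_mono)
      show "integrable ?M (\<lambda>y. (exp (- ?c / 2 * t) * ?\<phi> x / L) * (u0 y * ?\<phi> y))"
        by (rule integrable_mult_right) (use int in simp)
      show "integrable ?M (\<lambda>y. u0 y * dirichlet_heat_kernel L t x y)"
        by (intro bounded_times_continuous_integrable u0 dirichlet_heat_kernel_continuous L t0)
      fix y assume "y \<in> space ?M"
      then have y: "y \<in> {0..L}" by simp
      have "u0 y * (exp (- ?c / 2 * t) * ?\<phi> x * ?\<phi> y / L) \<le> u0 y * dirichlet_heat_kernel L t x y"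
        using x y by (intro mult_left_mono kernel t u0) auto
      then show "(exp (- ?c / 2 * t) * ?\<phi> x / L) * (u0 y * ?\<phi> y) \<le> u0 y * dirichlet_heat_kernel L t x y"
        by (simp add: mult_ac)
    qed
    finally show "a / L * exp (- ?c / 2 * t) * ?\<phi> x \<le> initial_flow L u0 t x" .
  qed
qed

section \<open>Exponential growth rates\<close>

lemma elog_mono: "m \<le> n \<Longrightarrow> elog m \<le> elog n"
proof -
  assume mn: "m \<le> n"
  show ?thesis
  proof (cases "m = 0 \<or> n = \<infinity>")
    case False
    then have "m < \<infinity>" "n < \<infinity>" "m \<noteq> 0" "n \<noteq> 0" using mn by (auto simp: less_top order.strict_trans1)
    then show ?thesis using mn
      by (cases m; cases n) (auto simp: elog_def ennreal_eq_0_iff)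
  qed (use mn in \<open>auto simp: elog_def\<close>)
qed

lemma elog_exponential: "0 < C \<Longrightarrow> elog (ennreal (C * exp z)) = ereal (ln C + z)"
  by (simp add: elog_def ennreal_eq_0_iff ln_mult not_le)

text \<open>
  The slack between \<open>b\<close> and \<open>b'\<close> absorbs the term \<open>ln C / t\<close>.
\<close>

lemma growth_rate_upper:
  assumes f: "eventually (\<lambda>t. f t \<le> ennreal (C * exp (b * t))) at_top" and C: "0 < C" and b: "b < b'"
  shows "Limsup at_top (\<lambda>t. ereal (1 / t) * elog (f t)) \<le> ereal b'"
proof (rule Limsup_bounded)
  have "((\<lambda>t. ln C / t) \<longlongrightarrow> 0) at_top" by real_asymp
  then have "eventually (\<lambda>t. ln C / t < b' - b) at_top" using b by (intro order_tendstoD) auto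
  then show "\<forall>\<^sub>F t in at_top. ereal (1 / t) * elog (f t) \<le> ereal b'"
    using f eventually_gt_at_top[of 0]
  proof eventually_elim
    case (elim t)
    have "ereal (1 / t) * elog (f t) \<le> ereal (1 / t) * ereal (ln C + b * t)"
      using elog_mono[OF elim(2)] elim(3) by (intro ereal_mult_left_mono) (auto simp: elog_exponential[OF C])
    also have "\<dots> = ereal (ln C / t + b)" using elim(3) by (simp add: field_simps)
    also have "\<dots> \<le> ereal b'" using elim(1) by simp
    finally show ?case .
  qed
qed

lemma growth_rate_lower:
  assumes f: "eventually (\<lambda>t. ennreal (C * exp (b * t)) \<le> f t) at_top" and C: "0 < C" and b: "b' < b"
  shows "ereal b' \<le> Liminf at_top (\<lambda>t. ereal (1 / t) * elog (f t))"
proof (rule Liminf_bounded)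
  have "((\<lambda>t. ln C / t) \<longlongrightarrow> 0) at_top" by real_asymp
  then have "eventually (\<lambda>t. b' - b < ln C / t) at_top" using b by (intro order_tendstoD) auto
  then show "\<forall>\<^sub>F t in at_top. ereal b' \<le> ereal (1 / t) * elog (f t)"
    using f eventually_gt_at_top[of 0]
  proof eventually_elim
    case (elim t)
    have "ereal b' \<le> ereal (ln C / t + b)" using elim(1) by simp
    also have "\<dots> = ereal (1 / t) * ereal (ln C + b * t)" using elim(3) by (simp add: field_simps)
    also have "\<dots> \<le> ereal (1 / t) * elog (f t)"
      using elog_mono[OF elim(2)] elim(3) by (intro ereal_mult_left_mono) (auto simp: elog_exponential[OF C])
    finally show ?case .
  qed
qed

section \<open>Decay for weak noise and growth for strong noise\<close>

theorem theorem1p1: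
  fixes M :: "'a measure" and F :: "real \<Rightarrow> 'a measure"
    and W :: "(real \<times> real) set \<Rightarrow> 'a \<Rightarrow> real"
    and L l\<^sub>\<sigma> L\<^sub>\<sigma> :: real
    and \<sigma> u0 :: "real \<Rightarrow> real"
    and u :: "real \<Rightarrow> real \<Rightarrow> real \<Rightarrow> 'a \<Rightarrow> real"
  assumes "L > 0"
    and noise: "white_noise M F L W"
    and sigma_lipschitz: "\<exists>C. C-lipschitz_on UNIV \<sigma>"
    and sigma_const: "l\<^sub>\<sigma> > 0" "L\<^sub>\<sigma> > 0"
    and sigma_bounds: "\<And>z. l\<^sub>\<sigma> * \<bar>z\<bar> \<le> \<bar>\<sigma> z\<bar> \<and> \<bar>\<sigma> z\<bar> \<le> L\<^sub>\<sigma> * \<bar>z\<bar>"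
    and u0_measurable: "u0 \<in> borel_measurable (lebesgue_on {0..L})"
    and u0_nonneg: "\<And>y. y \<in> {0..L} \<Longrightarrow> 0 \<le> u0 y"
    and u0_bounded: "bounded (u0 ` {0..L})"
    and u0_support: "emeasure lebesgue {y \<in> {0..L}. u0 y > 0} > 0"
    and solution: "\<And>lam. lam > 0 \<Longrightarrow> mild_solution M F L W \<sigma> lam u0 (u lam)"
    and moments: "\<And>lam T. lam > 0 \<Longrightarrow> T \<ge> 0 \<Longrightarrow>
      (SUP t\<in>{0..T}. SUP x\<in>{0..L}. second_moment M (u lam) t x) < \<infinity>"
  shows "(\<exists>lam0>0. \<forall>lam\<in>{0<..<lam0}. \<forall>x\<in>{0<..<L}.
            -\<infinity> < Limsup at_top (\<lambda>t. ereal (1 / t) * elog (second_moment M (u lam) t x)) \<and>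
            Limsup at_top (\<lambda>t. ereal (1 / t) * elog (second_moment M (u lam) t x)) < 0)
       \<and> (\<forall>\<epsilon>>0. \<exists>lam1>0. \<forall>lam>lam1. \<forall>x\<in>{\<epsilon>..L - \<epsilon>}.
            0 < Liminf at_top (\<lambda>t. ereal (1 / t) * elog (second_moment M (u lam) t x)) \<and>
            Liminf at_top (\<lambda>t. ereal (1 / t) * elog (second_moment M (u lam) t x)) < \<infinity>)"
proof -
  interpret white_noise M F L W by (rule noise)
  note L = \<open>L > 0\<close>
  let ?c = "(dirichlet_freq L 0)\<^sup>2"
  have c: "0 < ?c" using dirichlet_freq_pos[OF L, of 0] by simp
  have \<sigma>: "\<sigma> \<in> borel_measurable borel"
    using sigma_lipschitz by (auto intro: borel_measurable_continuous_onI lipschitz_on_continuous_on)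
  define f where "f lam = second_moment M (u lam)" for lam
  let ?G = "initial_flow L u0" and ?rate = "\<lambda>lam x t. ereal (1 / t) * elog (f lam t x)"
  have ineq: "ennreal ((?G t x)\<^sup>2) + ennreal (lam\<^sup>2 * l\<^sub>\<sigma>\<^sup>2) * volterra L (f lam) t x \<le> f lam t x"
    "f lam t x \<le> ennreal ((?G t x)\<^sup>2) + ennreal (lam\<^sup>2 * L\<^sub>\<sigma>\<^sup>2) * volterra L (f lam) t x"
    if "0 < lam" "0 < t" "0 \<le> x" "x \<le> L" for lam t x :: real
    using mild_solution_moment_inequalities[OF solution[OF that(1)] \<sigma> sigma_bounds, of t x] that sigma_const
    by (auto simp: f_def)
  obtain g r where g: "0 < g" "0 < r" and G_lower: "\<And>t x. r \<le> t \<Longrightarrow> 0 < x \<Longrightarrow> x < L \<Longrightarrow>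
      g * exp (- ?c / 2 * t) * sin (dirichlet_freq L 0 * x) \<le> ?G t x"
    using initial_flow_lower[OF L u0_measurable u0_bounded u0_nonneg u0_support] by metis
  obtain B where B: "\<And>y. y \<in> {0..L} \<Longrightarrow> \<bar>u0 y\<bar> \<le> B" using u0_bounded
    by (auto simp: bounded_iff simp del: atLeastAtMost_iff)
  have G_upper: "\<exists>C>0. \<forall>t>0. \<forall>x\<in>{0<..<L}. exp (\<beta> * t) * (?G t x)\<^sup>2 \<le> C"
    if lam: "0 < lam" and \<beta>: "\<beta> \<le> ?c" for lam \<beta> :: real
  proof -
    obtain S where S: "(SUP t\<in>{0..1}. SUP x\<in>{0..L}. f lam t x) = ennreal S" "0 \<le> S"
      using moments[OF lam, of 1] less_top_ennreal unfolding f_def infinity_ennreal_def by fastforce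
    define A where "A = 2 * B * dirichlet_trace L 1"
    let ?C = "exp \<bar>\<beta>\<bar> * S + A\<^sup>2 * exp ?c + 1"
    have "exp (\<beta> * t) * (?G t x)\<^sup>2 \<le> ?C" if t: "0 < t" and x: "0 < x" "x < L" for t x
    \<comment> \<open>Near time \<open>0\<close> the bound on the kernel by its series blows up, but \<open>G\<^sup>2 \<le> f\<close> and the second moments are bounded there.\<close>
    proof (cases "t \<le> 1")
      case True
      have "ennreal ((?G t x)\<^sup>2) \<le> ennreal ((?G t x)\<^sup>2) + ennreal (lam\<^sup>2 * l\<^sub>\<sigma>\<^sup>2) * volterra L (f lam) t x" by simp
      also have "\<dots> \<le> f lam t x" using x by (intro ineq lam t) auto
      also have "\<dots> \<le> (SUP t\<in>{0..1}. SUP x\<in>{0..L}. f lam t x)"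
        by (rule SUP_upper2[of t], use t True in simp, rule SUP_upper) (use x in simp)
      finally have "(?G t x)\<^sup>2 \<le> S" using S by simp
      moreover have "\<beta> * t \<le> \<bar>\<beta>\<bar>" using True t mult_mono[of \<beta> "\<bar>\<beta>\<bar>" t 1] by simp
      ultimately have "exp (\<beta> * t) * (?G t x)\<^sup>2 \<le> exp \<bar>\<beta>\<bar> * S" by (intro mult_mono) auto
      then show ?thesis by (simp add: add_increasing2)
    next
      case False
      then have t1: "1 \<le> t" by simp
      have "\<bar>?G t x\<bar> \<le> A * exp (- ?c / 2 * (t - 1))"
        unfolding A_def by (rule initial_flow_abs_le[OF L t1 u0_measurable B])
      then have "(?G t x)\<^sup>2 \<le> (A * exp (- ?c / 2 * (t - 1)))\<^sup>2" using power_mono[of "\<bar>?G t x\<bar>" _ 2] by fastforce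
      also have "\<dots> = A\<^sup>2 * exp (- ?c * (t - 1))"
        by (simp add: power_mult_distrib power2_eq_square[of "exp _"] exp_add[symmetric])
      finally have "exp (\<beta> * t) * (?G t x)\<^sup>2 \<le> exp (?c * t) * (A\<^sup>2 * exp (- ?c * (t - 1)))"
        using \<beta> t by (intro mult_mono) auto
      also have "\<dots> = A\<^sup>2 * exp ?c"
      proof -
        have "exp (q * t) * exp (- q * (t - 1)) = exp q" for q :: real
          by (simp add: exp_add[symmetric] algebra_simps)
        from this[of ?c] show ?thesis by (simp only: mult_ac)
      qed
      also have "\<dots> \<le> ?C" using S by simp
      finally show ?thesis .
    qed
    moreover have "0 < ?C" using S by (simp add: add_nonneg_pos)
    ultimately show ?thesis by auto
  qed
  have upper: "Limsup at_top (?rate lam x) \<le> ereal b"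
    if lam: "0 < lam" and \<beta>: "\<beta> < ?c" and small: "lam\<^sup>2 * L\<^sub>\<sigma>\<^sup>2 * (2 / L * trace_resolvent L \<beta>) \<le> 1 / 2"
      and x: "0 < x" "x < L" and b: "- \<beta> < b" for lam \<beta> x b :: real
  proof -
    obtain C where C: "0 < C" "\<And>t x. 0 < t \<Longrightarrow> 0 < x \<Longrightarrow> x < L \<Longrightarrow> exp (\<beta> * t) * (?G t x)\<^sup>2 \<le> C"
      using G_upper[OF lam less_imp_le[OF \<beta>]] by auto
    have bound: "f lam t x \<le> ennreal (2 * C * exp (- \<beta> * t))" if t: "0 < t" for t
    proof (rule renewal_upper_bound[OF L \<beta> _ small _ _ C(2) t x])
      show "f lam t x \<le> ennreal ((?G t x)\<^sup>2) + ennreal (lam\<^sup>2 * L\<^sub>\<sigma>\<^sup>2) * volterra L (f lam) t x"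
        if "0 < t" "0 < x" "x < L" for t x using that by (intro ineq lam) auto
      show "(SUP t\<in>{0..T}. SUP x\<in>{0..L}. f lam t x) < \<infinity>" if "T \<ge> 0" for T
        unfolding f_def by (rule moments[OF lam that])
    qed auto
    have "eventually (\<lambda>t. f lam t x \<le> ennreal (2 * C * exp (- \<beta> * t))) at_top"
      by (rule eventually_mono[OF eventually_gt_at_top[of 0] bound])
    then show ?thesis by (rule growth_rate_upper) (use C b in auto)
  qed
  have lower_rate: "- \<infinity> < Limsup at_top (?rate lam x)" if lam: "0 < lam" and x: "0 < x" "x < L" for lam x :: real
  proof -
    let ?\<phi> = "sin (dirichlet_freq L 0 * x)"
    have \<phi>: "0 < ?\<phi>" by (rule sin_ground_pos[OF L x])
    have "eventually (\<lambda>t. ennreal ((g * ?\<phi>)\<^sup>2 * exp (- ?c * t)) \<le> f lam t x) at_top"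
      using eventually_ge_at_top[of r]
    proof eventually_elim
      case (elim t)
      have "(g * exp (- ?c / 2 * t) * ?\<phi>)\<^sup>2 \<le> (?G t x)\<^sup>2"
        using g \<phi> by (intro power_mono G_lower elim x) auto
      moreover have "(exp (- ?c / 2 * t))\<^sup>2 = exp (- ?c * t)"
        by (simp add: power2_eq_square exp_add[symmetric])
      ultimately have "(g * ?\<phi>)\<^sup>2 * exp (- ?c * t) \<le> (?G t x)\<^sup>2"
        by (simp add: power_mult_distrib mult_ac)
      then have "ennreal ((g * ?\<phi>)\<^sup>2 * exp (- ?c * t)) \<le> ennreal ((?G t x)\<^sup>2) + ennreal (lam\<^sup>2 * l\<^sub>\<sigma>\<^sup>2) * volterra L (f lam) t x"
        by (intro add_increasing2 ennreal_leI) auto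
      also have "\<dots> \<le> f lam t x" using x g elim by (intro ineq lam) auto
      finally show ?case .
    qed
    then have "ereal (- ?c - 1) \<le> Liminf at_top (?rate lam x)"
      by (rule growth_rate_lower) (use g \<phi> in auto)
    also have "\<dots> \<le> Limsup at_top (?rate lam x)" by (rule Liminf_le_Limsup) simp
    finally show ?thesis by (rule order.strict_trans2[rotated]) simp
  qed
  have part1: "\<exists>lam0>0. \<forall>lam\<in>{0<..<lam0}. \<forall>x\<in>{0<..<L}.
      -\<infinity> < Limsup at_top (?rate lam x) \<and> Limsup at_top (?rate lam x) < 0"
  proof -
    define K where "K = 2 / L * trace_resolvent L (?c / 2)"
    \<comment> \<open>\<open>K\<close> is used with an absolute value and increased by 1 only to keep the denominator positive.\<close>
    define lam0 where "lam0 = sqrt (1 / (2 * L\<^sub>\<sigma>\<^sup>2 * (\<bar>K\<bar> + 1)))"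
    have lam0: "0 < lam0" using sigma_const by (simp add: lam0_def)
    have sm: "lam\<^sup>2 * L\<^sub>\<sigma>\<^sup>2 * K \<le> 1 / 2" if "0 < lam" "lam < lam0" for lam :: real
    proof -
      have "lam\<^sup>2 \<le> lam0\<^sup>2" using that by (intro power_mono) auto
      also have "lam0\<^sup>2 = 1 / (2 * L\<^sub>\<sigma>\<^sup>2 * (\<bar>K\<bar> + 1))" by (simp add: lam0_def)
      finally have "lam\<^sup>2 * L\<^sub>\<sigma>\<^sup>2 * \<bar>K\<bar> \<le> 1 / (2 * L\<^sub>\<sigma>\<^sup>2 * (\<bar>K\<bar> + 1)) * L\<^sub>\<sigma>\<^sup>2 * \<bar>K\<bar>"
        by (intro mult_right_mono) auto
      also have "\<dots> = \<bar>K\<bar> / (2 * (\<bar>K\<bar> + 1))"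
      proof -
        have "1 / (2 * q * z) * q * k = k / (2 * z)" if "q \<noteq> 0" for q z k :: real using that by simp
        then show ?thesis using sigma_const by simp
      qed
      also have "\<dots> \<le> 1 / 2" by (simp add: divide_simps)
      finally have "lam\<^sup>2 * L\<^sub>\<sigma>\<^sup>2 * \<bar>K\<bar> \<le> 1 / 2" .
      moreover have "lam\<^sup>2 * L\<^sub>\<sigma>\<^sup>2 * K \<le> lam\<^sup>2 * L\<^sub>\<sigma>\<^sup>2 * \<bar>K\<bar>" by (intro mult_left_mono) auto
      ultimately show ?thesis by (rule order.trans[rotated])
    qed
    have "Limsup at_top (?rate lam x) < 0" if "0 < lam" "lam < lam0" "0 < x" "x < L" for lam x :: real
    proof -
      have "Limsup at_top (?rate lam x) \<le> ereal (- ?c / 4)"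
        by (rule upper[of _ "?c / 2"]) (use that sm[OF that(1,2)] c in \<open>auto simp: K_def\<close>)
      also have "\<dots> < 0" using c by simp
      finally show ?thesis .
    qed
    then show ?thesis using lam0 lower_rate by (intro exI[of _ lam0]) auto
  qed
  have part2: "\<exists>lam1>0. \<forall>lam>lam1. \<forall>x\<in>{\<epsilon>..L - \<epsilon>}.
      0 < Liminf at_top (?rate lam x) \<and> Liminf at_top (?rate lam x) < \<infinity>" if \<epsilon>: "\<epsilon> > 0" for \<epsilon>
  proof -
    \<comment> \<open>At this value of \<open>\<lambda>\<close> the growth rate \<open>\<lambda>\<^sup>2 l\<^sub>\<sigma>\<^sup>2/L\<close> equals \<open>c\<close>.\<close>
    define lam1 where "lam1 = sqrt (?c * L) / l\<^sub>\<sigma>"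
    have lam1: "0 < lam1" using c L sigma_const by (simp add: lam1_def)
    have "0 < Liminf at_top (?rate lam x)" if lam: "lam1 < lam" and x: "0 < x" "x < L" for lam x :: real
    proof -
      have lam0: "0 < lam" using lam lam1 by simp
      let ?a = "lam\<^sup>2 * l\<^sub>\<sigma>\<^sup>2"
      have "?c * L < ?a"
      proof -
        have "sqrt (?c * L) < lam * l\<^sub>\<sigma>" using lam sigma_const by (simp add: lam1_def field_simps)
        then have "(sqrt (?c * L))\<^sup>2 < (lam * l\<^sub>\<sigma>)\<^sup>2" using c L by (intro power_strict_mono) auto
        then show ?thesis using c L by (simp add: power_mult_distrib)
      qed
      then have sup: "?c < ?a / L" using L by (simp add: field_simps)
      have "(\<lambda>(s, y, \<omega>). u lam s y \<omega>) \<in> borel_measurable (predictable_sets M F L)"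
        using solution[OF lam0] by (simp add: mild_solution_def)
      note meas = second_moment_measurable[OF this, folded f_def]
      have "\<exists>D>0. \<forall>\<^sub>F t in at_top. ennreal (D * exp ((?a / L - ?c) * t)) \<le> f lam t x"
      proof (rule renewal_lower_bound[OF L _ sup meas _ g G_lower x])
        show "0 < ?a" using lam0 sigma_const by simp
        show "ennreal ((?G t x)\<^sup>2) + ennreal ?a * volterra L (f lam) t x \<le> f lam t x"
          if "0 < t" "0 < x" "x < L" for t x using that by (intro ineq lam0) auto
      qed
      then obtain D where D: "0 < D"
        "\<forall>\<^sub>F t in at_top. ennreal (D * exp ((?a / L - ?c) * t)) \<le> f lam t x" by blast
      have half: "q / 2 < q" if "0 < q" for q :: real using that by simp
      have gap: "0 < ?a / L - ?c" using sup by simp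
      then have "ereal 0 < ereal ((?a / L - ?c) / 2)" by simp
      also have "\<dots> \<le> Liminf at_top (?rate lam x)"
        by (rule growth_rate_lower[OF D(2,1) half[OF gap]])
      finally show ?thesis unfolding zero_ereal_def .
    qed
    moreover have "Liminf at_top (?rate lam x) < \<infinity>" if lam: "0 < lam" and x: "0 < x" "x < L" for lam x :: real
    proof -
      have "((\<lambda>b. lam\<^sup>2 * L\<^sub>\<sigma>\<^sup>2 * (2 / L * trace_resolvent L (- b))) \<longlongrightarrow> 0) at_top"
        by (intro tendsto_mult_right_zero trace_resolvent_tendsto_0 L)
      then have "eventually (\<lambda>b. lam\<^sup>2 * L\<^sub>\<sigma>\<^sup>2 * (2 / L * trace_resolvent L (- b)) < 1 / 2) at_top"
        by (rule order_tendstoD) simp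
      from eventually_conj[OF this eventually_gt_at_top[of 0]] obtain b where b: "lam\<^sup>2 * L\<^sub>\<sigma>\<^sup>2 * (2 / L * trace_resolvent L (- b)) < 1 / 2" "0 < b"
        by (auto dest!: eventually_happens)
      have "- b < ?c" using b(2) c by linarith
      note bound = upper[OF lam this less_imp_le[OF b(1)] x, of "b + 1"]
      have "Liminf at_top (?rate lam x) \<le> Limsup at_top (?rate lam x)" by (rule Liminf_le_Limsup) simp
      also have "\<dots> \<le> ereal (b + 1)" by (rule bound) simp
      finally show ?thesis by (rule order.strict_trans1) simp
    qed
    ultimately show ?thesis using lam1 \<epsilon> by (intro exI[of _ lam1]) auto
  qed
  show ?thesis using part1 part2 unfolding f_def by blast
qed

end
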